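(* Let $D$ be the degree sequence of a tree, with reduced degree sequence $(d_1,\dots,d_t)$, and let $\mathbb{T}_D$ be the set of all trees with degree sequence $D$. A tree $T\in\mathbb{T}_D$ satisfies $\mathrm{SO}(T)=\max\{\mathrm{SO}(T''):T''\in\mathbb{T}_D\}$ if and only if $T$ is isomorphic to a tree obtained from $\mathcal{M}(d_1,\dots,d_t)$ by a finite (possibly empty) sequence of exchanges of branches between vertices of the same degree.
   Context: For a graph $G$, $\mathrm{SO}(G)=\sum_{uv\in E(G)}\sqrt{\deg_G(u)^2+\deg_G(v)^2}$. The reduced degree sequence of a tree is the nonincreasing list $(d_1,\dots,d_t)$ of degrees of its non-leaf vertices; it determines the degree sequence (the number of leaves is $2-2t+\sum d_i$). Exchange of branches between vertices of the same degree: given a tree $T$ rooted at some vertex, choose distinct vertices $x,y$ with $\deg x=\deg y$, a child $a$ of $x$ and a child $b$ of $y$ such that $T-xa-yb+xb+ya$ is a tree, and replace $T$ by this tree (children of $x$ are its neighbours farther from the root). The tree $\mathcal{M}(d_1,\dots,d_t)$ with labels $v_1,v_2,\dots$ on some non-leaf vertices is defined recursively in $t$. (i) If $t\le d_t+1$: take a star with centre $c$ and $d_t$ leaves; for $i=1,\dots,t-1$ identify a distinct leaf of it with the centre of a star having $d_i-1$ leaves. Label $c$ as $v_1$ and the other non-leaf vertices $v_2,\dots,v_t$ so that $\deg(v_i)\le\deg(v_j)$ for $i<j$. (ii) If $t\ge d_t+2$: let $\mathcal{M}'=\mathcal{M}(d_{d_t},\dots,d_{t-1})$ with labels $v_1,\dots,v_\ell$,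 and let $s$ be the smallest index with $v_s$ adjacent to a leaf of $\mathcal{M}'$. Let $R$ be the rooted tree with root $r$ having $d_t-1$ children $x_1,\dots,x_{d_t-1}$, where $x_i$ has $d_i-1$ further neighbours, all leaves. Identify $r$ with a leaf of $\mathcal{M}'$ adjacent to $v_s$; label $x_1,\dots,x_{d_t-1}$ as $v_{\ell+1},\dots,v_{\ell+d_t-1}$ in nondecreasing order of degree ($r$ unlabelled). Ties may be broken arbitrarily. *)

theory Defs
  imports Complex_Main "HOL-Library.Multiset" "HOL-Library.Disjoint_Sets"
begin

(* A finite simple graph is a pair (vertex set, edge set), an edge being the set of its two
   distinct ends. *)
type_synonym 'a graph = "'a set \<times> 'a set set"

abbreviation verts :: "'a graph \<Rightarrow> 'a set" where
  "verts G \<equiv> fst G"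

abbreviation edges :: "'a graph \<Rightarrow> 'a set set" where
  "edges G \<equiv> snd G"

definition simple_graph :: "'a graph \<Rightarrow> bool" where
  "simple_graph G \<longleftrightarrow> finite (verts G) \<and> (\<forall>e\<in>edges G. e \<subseteq> verts G \<and> card e = 2)"

definition nbrs :: "'a graph \<Rightarrow> 'a \<Rightarrow> 'a set" where
  "nbrs G u = {v. {u, v} \<in> edges G}"

definition deg :: "'a graph \<Rightarrow> 'a \<Rightarrow> nat" where
  "deg G u = card (nbrs G u)"

definition adj_rel :: "'a graph \<Rightarrow> ('a \<times> 'a) set" where
  "adj_rel G = {(u, v). {u, v} \<in> edges G}"

definition connected_graph :: "'a graph \<Rightarrow> bool" where
  "connected_graph G \<longleftrightarrow> verts G \<noteq> {} \<and> (\<forall>u\<in>verts G. \<forall>v\<in>verts G. (u, v) \<in> (adj_rel G)\<^sup>*)"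

definition is_cycle :: "'a graph \<Rightarrow> 'a list \<Rightarrow> bool" where
  "is_cycle G p \<longleftrightarrow> length p \<ge> 3 \<and> distinct p \<and>
     (\<forall>i<length p. {p ! i, p ! (Suc i mod length p)} \<in> edges G)"

definition is_tree :: "'a graph \<Rightarrow> bool" where
  "is_tree G \<longleftrightarrow> simple_graph G \<and> connected_graph G \<and> (\<nexists>p. is_cycle G p)"

definition graph_iso :: "'a graph \<Rightarrow> 'b graph \<Rightarrow> bool" where
  "graph_iso G H \<longleftrightarrow> (\<exists>f. bij_betw f (verts G) (verts H) \<and>
     (\<forall>u\<in>verts G. \<forall>v\<in>verts G. {u, v} \<in> edges G \<longleftrightarrow> {f u, f v} \<in> edges H))"

(* The inner sum has exactly two terms, one for each end of the edge e. *)
definition SO :: "'a graph \<Rightarrow> real" where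
  "SO G = (\<Sum>e\<in>edges G. sqrt (\<Sum>u\<in>e. (real (deg G u))\<^sup>2))"

definition leaf :: "'a graph \<Rightarrow> 'a \<Rightarrow> bool" where
  "leaf G u \<longleftrightarrow> u \<in> verts G \<and> deg G u = 1"

(* Degree sequences are listed in nonincreasing order. *)
definition degree_seq :: "'a graph \<Rightarrow> nat list" where
  "degree_seq G = rev (sorted_list_of_multiset (image_mset (deg G) (mset_set (verts G))))"

(* The degrees of the non-leaf vertices.  The one-vertex tree has no leaf; its reduced degree
   sequence is [0]. *)
definition reduced_seq :: "nat list \<Rightarrow> nat list" where
  "reduced_seq D = filter (\<lambda>d. d \<noteq> 1) D"

definition trees_with :: "nat list \<Rightarrow> 'a graph set" where
  "trees_with D = {T. is_tree T \<and> degree_seq T = D}"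


definition gdist :: "'a graph \<Rightarrow> 'a \<Rightarrow> 'a \<Rightarrow> nat" where
  "gdist G u v = (LEAST n. (u, v) \<in> adj_rel G ^^ n)"

definition children :: "'a graph \<Rightarrow> 'a \<Rightarrow> 'a \<Rightarrow> 'a set" where
  "children T r x = {a \<in> nbrs T x. gdist T r x < gdist T r a}"

definition branch_exchange :: "'a graph \<Rightarrow> 'a graph \<Rightarrow> bool" where
  "branch_exchange T T' \<longleftrightarrow> is_tree T \<and>
     (\<exists>r\<in>verts T. \<exists>x\<in>verts T. \<exists>y\<in>verts T. \<exists>a\<in>children T r x. \<exists>b\<in>children T r y.
        x \<noteq> y \<and> deg T x = deg T y \<and>
        T' = (verts T, edges T - {{x, a}, {y, b}} \<union> {{x, b}, {y, a}})) \<and>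
     is_tree T'"


definition star :: "'a \<Rightarrow> 'a set \<Rightarrow> 'a graph" where
  "star c L = (insert c L, (\<lambda>l. {c, l}) ` L)"

(* G is the star with centre c and leaf set L in which, for every i, the leaf xs ! i is identified
   with the centre of a star having es ! i - 1 leaves (forming the set X i).  Here and in mtree,
   identifying two vertices is expressed by taking the union of two graphs that have exactly this
   vertex in common. *)
definition glued_stars :: "'a \<Rightarrow> 'a set \<Rightarrow> nat list \<Rightarrow> 'a list \<Rightarrow> 'a graph \<Rightarrow> bool" where
  "glued_stars c L es xs G \<longleftrightarrow>
     finite L \<and> c \<notin> L \<and> distinct xs \<and> set xs \<subseteq> L \<and> length xs = length es \<and>
     (\<exists>X. (\<forall>i<length xs. finite (X i) \<and> card (X i) = es ! i - 1 \<and>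
                          X i \<inter> verts (star c L) = {}) \<and>
          disjoint_family_on X {..<length xs} \<and>
          G = (verts (star c L) \<union> (\<Union>i<length xs. verts (star (xs ! i) (X i))),
               edges (star c L) \<union> (\<Union>i<length xs. edges (star (xs ! i) (X i)))))"

definition leaf_adjacent :: "'a graph \<Rightarrow> 'a \<Rightarrow> bool" where
  "leaf_adjacent G v \<longleftrightarrow> (\<exists>l. leaf G l \<and> {v, l} \<in> edges G)"

(* mtree ds M vs: M, with the labelled vertices listed as vs = [v_1, v_2, ...], is one of the
   labelled trees M(d_1, ..., d_t) for ds = [d_1, ..., d_t].  A relation rather than a function,
   since the construction leaves open the names of the vertices and how ties are broken. With 1-based
   indices,
   butlast ds = (d_1, ..., d_(t-1)),
   drop (last ds - 1) (butlast ds) = (d_(d_t), ..., d_(t-1)),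
   take (last ds - 1) ds = (d_1, ..., d_(d_t - 1)). *)
inductive mtree :: "nat list \<Rightarrow> 'a graph \<Rightarrow> 'a list \<Rightarrow> bool" where
  base:
    "\<lbrakk> ds \<noteq> []; length ds \<le> last ds + 1;
       card L = last ds; glued_stars c L (butlast ds) xs M;
       distinct ws; set ws = {v \<in> verts M. \<not> leaf M v} - {c};
       sorted_wrt (\<lambda>u v. deg M u \<le> deg M v) (c # ws) \<rbrakk>
     \<Longrightarrow> mtree ds M (c # ws)"
| step:
    "\<lbrakk> ds \<noteq> []; length ds \<ge> last ds + 2;
       mtree (drop (last ds - 1) (butlast ds)) M' vs;
       s < length vs; leaf_adjacent M' (vs ! s); \<forall>j<s. \<not> leaf_adjacent M' (vs ! j);
       leaf M' r; {vs ! s, r} \<in> edges M';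
       glued_stars r (set xs) (take (last ds - 1) ds) xs R;
       verts M' \<inter> verts R = {r};
       M = (verts M' \<union> verts R, edges M' \<union> edges R);
       distinct ws; set ws = set xs; sorted_wrt (\<lambda>u v. deg M u \<le> deg M v) ws \<rbrakk>
     \<Longrightarrow> mtree ds M (vs @ ws)"

end

(* The function f(x, y) = sqrt(x^2 + y^2) is strictly submodular on the nonnegative reals. Hence, if
   xa and yb are edges of a tree such that the path from x to y avoids a and b, and if
   deg x > deg y and deg a > deg b, then replacing xa, yb by xb, ya increases SO; if deg x = deg y,
   then SO does not change. So every tree that is reached by exchanges of branches from a tree of
   maximal SO is locally optimal: deg x > deg y implies deg a <= deg b for all such edges xa, yb.

   Conversely, let all trees reached from T be locally optimal, and let delta be the least degree of
   its t inner (non-leaf) vertices. In such a tree, inner vertices with at least two inner neighbours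
   have degrees at most those of the other inner vertices. If t <= delta + 1, then exchanges turn T
   into a tree in which some vertex of degree delta is adjacent to all other inner vertices.
   Otherwise, a suitably extremal choice of the tree and of a vertex r of degree delta shows that
   exchanges create the rooted tree R at r. When R is removed, the remaining tree inherits the
   hypothesis, and the neighbour of r has the least degree among the vertices adjacent to a leaf, just
   like v_s. By induction on t, T is equivalent to M(d_1, ..., d_t) under exchanges and isomorphism. *)
theory Submission
  imports Defs
begin

section \<open>Forests and paths\<close>

text \<open>Two obstacles shape the induction. Cutting off the branch turns \<open>r\<close> into a
  leaf, so an exchange that does not increase SO in the whole tree, where \<open>r\<close> has
  degree \<delta>, might do so in the remainder. Therefore \<open>r\<close> and \<open>v\<close> are
  chosen such that the degree of \<open>v\<close> is largest among all end branches in the class: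
  the only dangerous exchange would hang the branch on a vertex of larger degree. Conversely,
  exchanges in the remainder must survive when the branch is put back. Hence \<open>bswap\<close>
  asks for degree at least 2 of the two vertices of equal degree, which also makes the degree of the
  neighbour of each leaf an invariant. This invariant tells at which leaves the branch may be glued,
  and two leaves whose neighbours have equal degree can be interchanged by a swap, so it does not
  matter which of them an isomorphism selects. They make the neighbours of \<open>r\<close> pendant
  and let a whole branch move; exchanging all other branches at \<open>a\<close> and
  \<open>b\<close> simulates them up to isomorphism.\<close>

definition conn :: "'a set set \<Rightarrow> ('a \<times> 'a) set" where
  "conn E = {(u, v). {u, v} \<in> E}\<^sup>*"

text \<open>Every edge is a bridge. In this form acyclicity is a statement about
  \<open>conn\<close>, so edges can be deleted and inserted without handling cycles. As
  \<open>conn\<close> is reflexive, singletons are excluded as edges.\<close>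

definition forest :: "'a set set \<Rightarrow> bool" where
  "forest E \<longleftrightarrow> (\<forall>u v. {u, v} \<in> E \<longrightarrow> (u, v) \<notin> conn (E - {{u, v}}))"

definition path :: "'a set set \<Rightarrow> 'a list \<Rightarrow> bool" where
  "path E p \<longleftrightarrow> p \<noteq> [] \<and> distinct p \<and> successively (\<lambda>u v. {u, v} \<in> E) p"

lemma conn_refl [simp]: "(u, u) \<in> conn E"
  by (simp add: conn_def)

lemma conn_edge: "{u, v} \<in> E \<Longrightarrow> (u, v) \<in> conn E"
  by (auto simp: conn_def)

lemma conn_trans: "(u, v) \<in> conn E \<Longrightarrow> (v, w) \<in> conn E \<Longrightarrow> (u, w) \<in> conn E"
  by (auto simp: conn_def)

lemma conn_sym: "(u, v) \<in> conn E \<Longrightarrow> (v, u) \<in> conn E"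
proof -
  have "sym {(u, v). {u, v} \<in> E}" by (auto simp: sym_def insert_commute)
  then have "sym (conn E)" unfolding conn_def by (rule sym_rtrancl)
  then show "(u, v) \<in> conn E \<Longrightarrow> (v, u) \<in> conn E" by (auto simp: sym_def)
qed

text \<open>Besides inclusions and renamings this covers contractions, for instance of a leaf to its
  neighbour or of a whole branch to its root.\<close>

lemma conn_map:
  assumes "(u, v) \<in> conn E" and "\<And>u v. {u, v} \<in> E \<Longrightarrow> (f u, f v) \<in> conn E'"
  shows "(f u, f v) \<in> conn E'"
  using assms(1) unfolding conn_def
proof (induction rule: rtrancl_induct)
  case (step y z)
  then show ?case using assms(2)[of y z] by (auto simp: conn_def)
qed simp

lemma conn_mono: "(u, v) \<in> conn E \<Longrightarrow> E \<subseteq> E' \<Longrightarrow> (u, v) \<in> conn E'"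
  using conn_map[of u v E id E'] by (auto intro: conn_edge)

text \<open>Later crossings cancel: a walk that uses the new edge repeatedly can be shortened to one
  that uses it at most once.\<close>

lemma conn_insert:
  assumes "(p, q) \<in> conn (insert {u, w} E)"
  shows "(p, q) \<in> conn E \<or> (p, u) \<in> conn E \<and> (w, q) \<in> conn E \<or> (p, w) \<in> conn E \<and> (u, q) \<in> conn E"
  using assms unfolding conn_def[of "insert {u, w} E"]
proof (induction rule: rtrancl_induct)
  case base
  then show ?case by simp
next
  case (step y z)
  from step(2) consider "{y, z} \<in> E" | "y = u" "z = w" | "y = w" "z = u"
    by (auto simp: doubleton_eq_iff)
  then show ?case
  proof cases
    case 1
    then have "(y, z) \<in> conn E" by (rule conn_edge)
    then show ?thesis using step(3) by (blast intro: conn_trans)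
  next
    case 2
    then show ?thesis using step(3) by (auto intro: conn_trans)
  next
    case 3
    then show ?thesis using step(3) by (auto intro: conn_trans)
  qed
qed

lemma forest_mono: "forest E \<Longrightarrow> E' \<subseteq> E \<Longrightarrow> forest E'"
  unfolding forest_def by (meson conn_mono Diff_mono order_refl subsetD)

text \<open>If an old edge \<open>pq\<close> were bypassed, the bypass would use the new edge;
  closed up with \<open>pq\<close>, it would connect \<open>u\<close> to \<open>w\<close> inside
  \<open>F\<close>.\<close>

lemma forest_insert:
  assumes F: "forest F" and nc: "(u, w) \<notin> conn F"
  shows "forest (insert {u, w} F)"
  unfolding forest_def
proof (intro allI impI)
  fix p q assume pq: "{p, q} \<in> insert {u, w} F"
  show "(p, q) \<notin> conn (insert {u, w} F - {{p, q}})"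
  proof (cases "{p, q} = {u, w}")
    case True
    have "(p, q) \<notin> conn F"
      using True nc conn_sym by (metis doubleton_eq_iff)
    then show ?thesis using True conn_mono[of p q "insert {u, w} F - {{p, q}}" F] by blast
  next
    case False
    with pq have e: "{p, q} \<in> F" by simp
    have eq: "insert {u, w} F - {{p, q}} = insert {u, w} (F - {{p, q}})" using False by auto
    have b: "(p, q) \<notin> conn (F - {{p, q}})" using F e by (auto simp: forest_def)
    have m: "(s, t) \<in> conn (F - {{p, q}}) \<Longrightarrow> (s, t) \<in> conn F" for s t
      by (erule conn_mono) auto
    show ?thesis unfolding eq
    proof
      assume "(p, q) \<in> conn (insert {u, w} (F - {{p, q}}))"
      then have "(p, u) \<in> conn F \<and> (w, q) \<in> conn F \<or> (p, w) \<in> conn F \<and> (u, q) \<in> conn F"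
        using conn_insert[of p q u w "F - {{p, q}}"] b m by blast
      moreover have "(p, q) \<in> conn F" by (rule conn_edge[OF e])
      ultimately show False using nc by (blast intro: conn_sym conn_trans)
    qed
  qed
qed

lemma conn_path:
  assumes "(u, v) \<in> conn E"
  shows "\<exists>p. path E p \<and> hd p = u \<and> last p = v"
  using assms unfolding conn_def
proof (induction rule: converse_rtrancl_induct)
  case base
  have "path E [v]" by (simp add: path_def)
  then show ?case by (intro exI[of _ "[v]"]) simp
next
  case (step u w)
  then obtain p where p: "path E p" "hd p = w" "last p = v" by blast
  show ?case
  proof (cases "u \<in> set p")
    case True
    then obtain p1 p2 where s: "p = p1 @ u # p2" by (meson split_list)
    then have "path E (u # p2)" using p(1) by (auto simp: path_def successively_append_iff)
    then show ?thesis using s p(3) by (intro exI[of _ "u # p2"]) auto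
  next
    case False
    then have "path E (u # p)" using p step(1) by (auto simp: path_def successively_Cons)
    then show ?thesis using p by (intro exI[of _ "u # p"]) (auto simp: path_def)
  qed
qed

text \<open>Recording the vertices of the walk allows the deletion of every edge that has an end off
  the path.\<close>

lemma path_conn_within:
  "p \<noteq> [] \<Longrightarrow> successively (\<lambda>u v. {u, v} \<in> E) p \<Longrightarrow> (hd p, last p) \<in> conn {e \<in> E. e \<subseteq> set p}"
proof (induction p)
  case (Cons u p)
  show ?case
  proof (cases "p = []")
    case False
    have "(u, hd p) \<in> conn {e \<in> E. e \<subseteq> set (u # p)}"
      using Cons.prems False by (intro conn_edge) (auto simp: successively_Cons)
    moreover have "(hd p, last p) \<in> conn {e \<in> E. e \<subseteq> set (u # p)}"
      using Cons False by (intro conn_mono[OF Cons.IH]) (auto simp: successively_Cons)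
    ultimately show ?thesis using False conn_trans by fastforce
  qed simp
qed simp

text \<open>The usual way to establish the connectivity condition of a swap: neither of the two
  edges lies inside the path.\<close>

lemma path_conn_avoid:
  assumes "path E p" "a \<notin> set p" "b \<notin> set p" "hd p = x" "last p = y"
  shows "(x, y) \<in> conn (E - {{x, a}, {y, b}})"
  using path_conn_within[of p E] assms
  by (auto simp: path_def elim!: conn_mono)

lemma path_rev: "path E p \<Longrightarrow> path E (rev p)"
  by (auto simp: path_def insert_commute)

lemma path_nth: "path E p \<Longrightarrow> Suc i < length p \<Longrightarrow> {p ! i, p ! Suc i} \<in> E"
  unfolding path_def using successively_nth[of "\<lambda>u v. {u, v} \<in> E" p i] by blast

text \<open>If \<open>j\<close> exceeded \<open>i + 1\<close>, the section of the path between the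
  two vertices would bypass the chord, which is a bridge.\<close>

lemma path_chord_less:
  assumes F: "forest E" and p: "path E p" and ij: "i < j" "j < length p" and e: "{p ! i, p ! j} \<in> E"
  shows "j = Suc i"
proof (rule ccontr)
  assume ne: "j \<noteq> Suc i"
  have d: "distinct p" using p by (simp add: path_def)
  have "(p ! i, p ! (i + k)) \<in> conn (E - {{p ! i, p ! j}})" if "i + k \<le> j" for k
    using that
  proof (induction k)
    case (Suc k)
    have "{p ! (i + k), p ! (i + Suc k)} \<in> E - {{p ! i, p ! j}}"
      using path_nth[OF p, of "i + k"] Suc.prems ij ne d
      by (auto simp: doubleton_eq_iff nth_eq_iff_index_eq)
    from conn_edge[OF this] show ?case using Suc conn_trans[of "p ! i" "p ! (i + k)"] by simp
  qed simp
  from this[of "j - i"] have "(p ! i, p ! j) \<in> conn (E - {{p ! i, p ! j}})" using ij by simp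
  then show False using F e by (auto simp: forest_def)
qed

lemma forest_no_cycle:
  assumes "forest (edges G)"
  shows "\<not> is_cycle G p"
proof
  assume c: "is_cycle G p"
  then have d: "distinct p" "length p \<ge> 3" by (auto simp: is_cycle_def)
  have n: "\<And>i. Suc i < length p \<Longrightarrow> {p ! i, p ! Suc i} \<in> edges G"
    using c unfolding is_cycle_def by (metis Suc_lessD mod_less)
  then have p: "path (edges G) p" using d by (auto simp: path_def successively_conv_nth)
  have "Suc (length p - 1) = length p" "length p - 1 < length p" using d(2) by auto
  then have "Suc (length p - 1) mod length p = 0" "length p - 1 < length p" by auto
  then have "{p ! (length p - 1), p ! 0} \<in> edges G"
    using c unfolding is_cycle_def by metis
  then have "{p ! 0, p ! (length p - 1)} \<in> edges G" by (simp only: insert_commute)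
  \<comment> \<open>The closing edge joins the ends of the path \<open>p\<close>; in a forest these
    must then be consecutive.\<close>
  then have "length p - 1 = Suc 0" using d(2) by (intro path_chord_less[OF assms p]) linarith+
  then show False using d(2) by linarith
qed

lemma acyclic_forest:
  assumes "simple_graph G" "\<nexists>p. is_cycle G p"
  shows "forest (edges G)"
  unfolding forest_def
proof (intro allI impI notI)
  fix u v assume e: "{u, v} \<in> edges G" and c: "(u, v) \<in> conn (edges G - {{u, v}})"
  have "card {u, v} = 2" using e assms(1) unfolding simple_graph_def by blast
  then have ne: "u \<noteq> v" by auto
  obtain p where p: "path (edges G - {{u, v}}) p" "hd p = u" "last p = v" using conn_path[OF c] by blast
  have l: "length p \<ge> 3"
  proof -
    have "p \<noteq> []" using p by (simp add: path_def)
    then obtain a q where q: "p = a # q" by (cases p) auto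
    then have "q \<noteq> []" using p ne by auto
    then obtain b q' where q': "q = b # q'" by (cases q) auto
    have "q' \<noteq> []" using p q q' by (auto simp: path_def)
    then show ?thesis using q q' by (cases q') auto
  qed
  have "{p ! i, p ! (Suc i mod length p)} \<in> edges G" if "i < length p" for i
  proof (cases "Suc i < length p")
    case True
    then show ?thesis using path_nth[OF p(1), of i] by auto
  next
    case False
    then have i: "i = length p - 1" "Suc i = length p" using that by auto
    have "p ! i = v" "p ! 0 = u" using p l i by (auto simp: last_conv_nth hd_conv_nth path_def)
    then show ?thesis using e i by (simp add: insert_commute)
  qed
  then have "is_cycle G p" using l p by (auto simp: is_cycle_def path_def)
  then show False using assms(2) by blast
qed

lemma tree_iff: "is_tree G \<longleftrightarrow> simple_graph G \<and> connected_graph G \<and> forest (edges G)"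
  using forest_no_cycle acyclic_forest unfolding is_tree_def by blast

lemma connected_graph_conn:
  "connected_graph G \<longleftrightarrow> verts G \<noteq> {} \<and> (\<forall>u\<in>verts G. \<forall>v\<in>verts G. (u, v) \<in> conn (edges G))"
  by (simp add: connected_graph_def conn_def adj_rel_def)

lemma edge_verts: "simple_graph G \<Longrightarrow> {u, v} \<in> edges G \<Longrightarrow> u \<in> verts G \<and> v \<in> verts G \<and> u \<noteq> v"
  by (auto simp: simple_graph_def)

lemma edge_doubleton: "simple_graph G \<Longrightarrow> e \<in> edges G \<Longrightarrow> \<exists>u v. e = {u, v} \<and> u \<noteq> v"
  by (metis simple_graph_def card_2_iff)

lemma nbrs_iff [simp]: "v \<in> nbrs G u \<longleftrightarrow> {u, v} \<in> edges G"
  by (simp add: nbrs_def)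

lemma nbrs_verts: "simple_graph G \<Longrightarrow> nbrs G u \<subseteq> verts G - {u}"
proof
  fix v assume "simple_graph G" "v \<in> nbrs G u"
  then show "v \<in> verts G - {u}" using edge_verts[of G u v] by auto
qed

lemma finite_nbrs [simp]: "simple_graph G \<Longrightarrow> finite (nbrs G u)"
  by (meson finite_Diff finite_subset nbrs_verts simple_graph_def)

lemma finite_edges: "simple_graph G \<Longrightarrow> finite (edges G)"
  by (rule finite_subset[of _ "Pow (verts G)"]) (auto simp: simple_graph_def)

lemma deg_ge_2I:
  assumes "simple_graph G" "{u, v} \<in> edges G" "{u, w} \<in> edges G" "v \<noteq> w"
  shows "deg G u \<ge> 2"
proof -
  have "card {v, w} \<le> card (nbrs G u)" using assms by (intro card_mono) auto
  then show ?thesis using assms by (simp add: deg_def)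
qed

lemma path_interior_deg:
  assumes "simple_graph G" "path (edges G) p" "0 < i" "Suc i < length p"
  shows "deg G (p ! i) \<ge> 2"
proof (rule deg_ge_2I[OF assms(1), of _ "p ! (i - 1)" "p ! Suc i"])
  show "{p ! i, p ! (i - 1)} \<in> edges G"
    using path_nth[OF assms(2), of "i - 1"] assms by (simp add: insert_commute)
  show "{p ! i, p ! Suc i} \<in> edges G" using path_nth[OF assms(2)] assms by simp
  show "p ! (i - 1) \<noteq> p ! Suc i"
    using assms by (auto simp: path_def nth_eq_iff_index_eq)
qed

lemma tree_deg_pos:
  assumes "is_tree G" "u \<in> verts G" "v \<in> verts G" "u \<noteq> v"
  shows "deg G u \<ge> 1"
proof -
  have "(u, v) \<in> conn (edges G)" using assms by (simp add: tree_iff connected_graph_conn)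
  then obtain w where "{u, w} \<in> edges G" using assms(4) unfolding conn_def
    by (metis (mono_tags, lifting) converse_rtranclE case_prodD mem_Collect_eq)
  then have "nbrs G u \<noteq> {}" by auto
  then show ?thesis using assms(1) by (simp add: deg_def tree_iff Suc_le_eq card_gt_0_iff)
qed

lemma tree_path:
  assumes "is_tree G" "u \<in> verts G" "v \<in> verts G"
  obtains p where "path (edges G) p" "hd p = u" "last p = v"
  using assms conn_path by (metis tree_iff connected_graph_conn)

section \<open>Exchanging the ends of two edges\<close>

text \<open>In a tree, the condition on \<^term>\<open>conn\<close> says that the path from \<open>x\<close> to \<open>y\<close> avoids \<open>a\<close> and \<open>b\<close>;
  this is exactly the case in which the exchange of the two edges yields a tree again.\<close>

definition can_swap :: "'a graph \<Rightarrow> 'a \<Rightarrow> 'a \<Rightarrow> 'a \<Rightarrow> 'a \<Rightarrow> bool" where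
  "can_swap G x a y b \<longleftrightarrow> {x, a} \<in> edges G \<and> {y, b} \<in> edges G \<and> {x, b} \<notin> edges G \<and> {y, a} \<notin> edges G \<and>
     x \<noteq> y \<and> a \<noteq> b \<and> x \<noteq> b \<and> y \<noteq> a \<and> (x, y) \<in> conn (edges G - {{x, a}, {y, b}})"

definition swap :: "'a graph \<Rightarrow> 'a \<Rightarrow> 'a \<Rightarrow> 'a \<Rightarrow> 'a \<Rightarrow> 'a graph" where
  "swap G x a y b = (verts G, edges G - {{x, a}, {y, b}} \<union> {{x, b}, {y, a}})"

lemma verts_swap [simp]: "verts (swap G x a y b) = verts G"
  by (simp add: swap_def)

lemma edges_swap: "edges (swap G x a y b) = edges G - {{x, a}, {y, b}} \<union> {{x, b}, {y, a}}"
  by (simp add: swap_def)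

lemma can_swap_flip: "can_swap G x a y b \<Longrightarrow> can_swap G y b x a"
  by (auto simp: can_swap_def insert_commute intro: conn_sym)

lemma can_swap_distinct:
  assumes "simple_graph G" "can_swap G x a y b"
  shows "x \<noteq> a" "x \<noteq> y" "x \<noteq> b" "a \<noteq> y" "a \<noteq> b" "y \<noteq> b"
    "x \<in> verts G" "a \<in> verts G" "y \<in> verts G" "b \<in> verts G"
  using assms edge_verts[of G x a] edge_verts[of G y b] by (auto simp: can_swap_def)

lemma simple_graph_swap:
  assumes "simple_graph G" "can_swap G x a y b"
  shows "simple_graph (swap G x a y b)"
  using assms(1) can_swap_distinct[OF assms] by (auto simp: simple_graph_def edges_swap)

lemma nbrs_swap:
  assumes "simple_graph G" "can_swap G x a y b"
  shows "nbrs (swap G x a y b) x = nbrs G x - {a} \<union> {b}"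
    and "nbrs (swap G x a y b) a = nbrs G a - {x} \<union> {y}"
    and "nbrs (swap G x a y b) y = nbrs G y - {b} \<union> {a}"
    and "nbrs (swap G x a y b) b = nbrs G b - {y} \<union> {x}"
    and "u \<notin> {x, a, y, b} \<Longrightarrow> nbrs (swap G x a y b) u = nbrs G u"
proof -
  note d = can_swap_distinct(1-6)[OF assms]
  have iff: "{u, v} \<in> edges (swap G x a y b) \<longleftrightarrow>
      {u, v} \<in> edges G \<and> {u, v} \<noteq> {x, a} \<and> {u, v} \<noteq> {y, b} \<or> {u, v} = {x, b} \<or> {u, v} = {y, a}" for u v
    by (simp only: edges_swap) blast
  show "nbrs (swap G x a y b) x = nbrs G x - {a} \<union> {b}"
    by (rule set_eqI, unfold Un_iff Diff_iff singleton_iff nbrs_iff iff doubleton_eq_iff) (use d in blast)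
  show "nbrs (swap G x a y b) a = nbrs G a - {x} \<union> {y}"
    by (rule set_eqI, unfold Un_iff Diff_iff singleton_iff nbrs_iff iff doubleton_eq_iff) (use d in blast)
  show "nbrs (swap G x a y b) y = nbrs G y - {b} \<union> {a}"
    by (rule set_eqI, unfold Un_iff Diff_iff singleton_iff nbrs_iff iff doubleton_eq_iff) (use d in blast)
  show "nbrs (swap G x a y b) b = nbrs G b - {y} \<union> {x}"
    by (rule set_eqI, unfold Un_iff Diff_iff singleton_iff nbrs_iff iff doubleton_eq_iff) (use d in blast)
  show "u \<notin> {x, a, y, b} \<Longrightarrow> nbrs (swap G x a y b) u = nbrs G u"
    by (rule set_eqI, unfold nbrs_iff iff doubleton_eq_iff) blast
qed

lemma deg_swap:
  assumes "simple_graph G" "can_swap G x a y b"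
  shows "deg (swap G x a y b) u = deg G u"
proof -
  have c: "card (A - {p} \<union> {q}) = card A" if "finite A" "p \<in> A" "q \<notin> A" for A :: "'a set"
    and p q
    using that card_Suc_Diff1[of A p] by simp
  note s = nbrs_swap[OF assms]
  have m: "a \<in> nbrs G x" "x \<in> nbrs G a" "b \<in> nbrs G y" "y \<in> nbrs G b"
    "b \<notin> nbrs G x" "y \<notin> nbrs G a" "a \<notin> nbrs G y" "x \<notin> nbrs G b"
    using assms(2) by (auto simp: can_swap_def insert_commute)
  have f: "finite (nbrs G v)" for v using assms(1) by simp
  show ?thesis
  proof (cases "u \<in> {x, a, y, b}")
    case True
    then show ?thesis unfolding deg_def
      using c[OF f m(1,5)] c[OF f m(2,6)] c[OF f m(3,7)] c[OF f m(4,8)] s(1-4) by (elim insertE) simp_all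
  next
    case False
    then show ?thesis unfolding deg_def s(5)[OF False] by simp
  qed
qed

text \<open>Removing the exchanged edges leaves the same edge set before and after the swap, so the
  connectivity condition carries over unchanged.\<close>

lemma swap_back:
  assumes "simple_graph G" "can_swap G x a y b"
  shows "can_swap (swap G x a y b) x b y a" "swap (swap G x a y b) x b y a = G"
proof -
  note d = can_swap_distinct[OF assms]
  have e: "edges (swap G x a y b) - {{x, b}, {y, a}} = edges G - {{x, a}, {y, b}}"
    using assms(2) d by (auto simp: edges_swap can_swap_def doubleton_eq_iff)
  show "can_swap (swap G x a y b) x b y a"
    using assms(2) d e unfolding can_swap_def by (auto simp: edges_swap doubleton_eq_iff)
  show "swap (swap G x a y b) x b y a = G"
    unfolding swap_def[of "swap G x a y b"] e using assms(2)
    by (intro prod_eqI) (auto simp: can_swap_def)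
qed

lemma forest_bridge: "forest E \<Longrightarrow> {u, v} \<in> E \<Longrightarrow> (u, v) \<notin> conn (E - {{u, v}})"
  by (auto simp: forest_def)

text \<open>If one of the other conditions of \<open>can_swap\<close> failed, \<open>x\<close> would
  reach \<open>a\<close> without the edge \<open>xa\<close>, or \<open>y\<close> would reach
  \<open>b\<close> without \<open>yb\<close>, although both edges are bridges.\<close>

lemma tree_can_swap:
  assumes T: "is_tree G" and e: "{x, a} \<in> edges G" "{y, b} \<in> edges G" and ne: "x \<noteq> y"
    and c: "(x, y) \<in> conn (edges G - {{x, a}, {y, b}})"
  shows "can_swap G x a y b"
proof -
  have G: "simple_graph G" and F: "forest (edges G)" using T by (auto simp: tree_iff)
  have ca: "(x, y) \<in> conn (edges G - {{x, a}})" and cb: "(x, y) \<in> conn (edges G - {{y, b}})"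
    using c by (auto elim: conn_mono)
  have ba: "(x, a) \<notin> conn (edges G - {{x, a}})" and bb: "(y, b) \<notin> conn (edges G - {{y, b}})"
    using forest_bridge[OF F] e by auto
  have xb: "x \<noteq> b" using bb conn_sym[OF cb] by auto
  have ya: "y \<noteq> a" using ba ca by auto
  have ab: "a \<noteq> b"
  proof
    assume "a = b"
    then have "{y, a} \<in> edges G - {{x, a}}" using e ne ya by (auto simp: doubleton_eq_iff)
    then show False using ba ca conn_edge conn_trans by metis
  qed
  have "{x, b} \<notin> edges G"
  proof
    assume "{x, b} \<in> edges G"
    then have "{x, b} \<in> edges G - {{y, b}}" using ne xb by (auto simp: doubleton_eq_iff)
    then show False using bb cb conn_edge conn_trans conn_sym by metis
  qed
  moreover have "{y, a} \<notin> edges G"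
  proof
    assume "{y, a} \<in> edges G"
    then have "{y, a} \<in> edges G - {{x, a}}" using ne ya by (auto simp: doubleton_eq_iff)
    then show False using ba ca conn_edge conn_trans by metis
  qed
  ultimately show ?thesis using e ne xb ya ab c by (simp add: can_swap_def)
qed

text \<open>Without the two edges the tree falls into three parts, one containing \<open>x\<close>
  and \<open>y\<close>, one containing \<open>a\<close> and one containing \<open>b\<close>. The new
  edges attach the last two to the first again.\<close>

lemma is_tree_swap:
  assumes T: "is_tree G" and s: "can_swap G x a y b"
  shows "is_tree (swap G x a y b)"
proof -
  have G: "simple_graph G" and F: "forest (edges G)" and C: "connected_graph G"
    using T by (auto simp: tree_iff)
  note d = can_swap_distinct[OF G s]
  let ?F = "edges G - {{x, a}, {y, b}}"
  have e: "{x, a} \<in> edges G" "{y, b} \<in> edges G" and xy: "(x, y) \<in> conn ?F" using s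
    by (auto simp: can_swap_def)
  have ba: "(x, a) \<notin> conn (edges G - {{x, a}})" and bb: "(y, b) \<notin> conn (edges G - {{y, b}})"
    using forest_bridge[OF F] e by auto
  have ma: "(p, q) \<in> conn ?F \<Longrightarrow> (p, q) \<in> conn (edges G - {{x, a}})" for p q
    by (erule conn_mono) auto
  have mb: "(p, q) \<in> conn ?F \<Longrightarrow> (p, q) \<in> conn (edges G - {{y, b}})" for p q
    by (erule conn_mono) auto
  have yb: "(y, b) \<in> conn (edges G - {{x, a}})"
    using e d by (intro conn_edge) (auto simp: doubleton_eq_iff)
  have 1: "(y, a) \<notin> conn ?F" using ma[of y a] ma[OF xy] ba conn_trans by metis
  have 2: "(x, b) \<notin> conn (insert {y, a} ?F)"
  proof
    assume "(x, b) \<in> conn (insert {y, a} ?F)"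
    then consider "(x, b) \<in> conn ?F" | "(a, b) \<in> conn ?F" | "(x, a) \<in> conn ?F"
      using conn_insert by metis
    then show False
    proof cases
      case 1 then show False using mb[of x b] mb[OF xy] bb conn_trans conn_sym by metis
    next
      case 2 then show False using ma[of a b] ma[OF xy] yb ba conn_trans conn_sym by metis
    next
      case 3 then show False using ma[of x a] ba by metis
    qed
  qed
  have eq: "edges (swap G x a y b) = insert {x, b} (insert {y, a} ?F)" by (auto simp: edges_swap)
  have "forest ?F" by (rule forest_mono[OF F]) auto
  then have "forest (edges (swap G x a y b))" unfolding eq using 1 2 by (intro forest_insert)
  moreover have "connected_graph (swap G x a y b)"
  proof -
    let ?E = "edges (swap G x a y b)"
    have m: "(p, q) \<in> conn ?F \<Longrightarrow> (p, q) \<in> conn ?E" for p q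
      by (erule conn_mono) (auto simp: eq)
    have "(x, b) \<in> conn ?E" "(y, a) \<in> conn ?E" by (auto simp: eq intro: conn_edge)
    then have xa: "(x, a) \<in> conn ?E" "(y, b) \<in> conn ?E"
      using m[OF xy] by (blast intro: conn_trans conn_sym)+
    have "(u, v) \<in> conn ?E" if "{u, v} \<in> edges G" for u v
    proof (cases "{u, v} \<in> ?F")
      case True then show ?thesis using m conn_edge by metis
    next
      case False
      then have "{u, v} = {x, a} \<or> {u, v} = {y, b}" using that by auto
      then show ?thesis using xa conn_sym by (auto simp: doubleton_eq_iff)
    qed
    then have "(u, v) \<in> conn (edges G) \<Longrightarrow> (u, v) \<in> conn ?E" for u v
      using conn_map[of u v "edges G" id ?E] by auto
    then show ?thesis using C by (auto simp: connected_graph_conn)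
  qed
  ultimately show ?thesis using simple_graph_swap[OF G s] by (simp add: tree_iff)
qed

text \<open>If \<open>x\<close> and \<open>y\<close> have the same degree, this is an exchange of branches; if \<open>a\<close> and \<open>b\<close> have the same
  degree, it is a sequence of such exchanges up to isomorphism. The bounds \<open>2 \<le> \<dots>\<close> rule out that two leaves
  are moved between vertices of different degree: such swaps are lost when a branch is glued to one
  of the leaves.\<close>

definition bswap :: "'a graph \<Rightarrow> 'a graph \<Rightarrow> bool" where
  "bswap G H \<longleftrightarrow> (\<exists>x a y b. can_swap G x a y b \<and> H = swap G x a y b \<and>
     (deg G x = deg G y \<and> 2 \<le> deg G x \<or> deg G a = deg G b \<and> 2 \<le> deg G a))"

abbreviation bswaps :: "'a graph \<Rightarrow> 'a graph \<Rightarrow> bool" where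
  "bswaps \<equiv> bswap\<^sup>*\<^sup>*"

lemma bswapI1: "can_swap G x a y b \<Longrightarrow> deg G x = deg G y \<Longrightarrow> 2 \<le> deg G x \<Longrightarrow> bswap G (swap G x a y b)"
  unfolding bswap_def by blast

lemma bswapI2: "can_swap G x a y b \<Longrightarrow> deg G a = deg G b \<Longrightarrow> 2 \<le> deg G a \<Longrightarrow> bswap G (swap G x a y b)"
  unfolding bswap_def by blast

lemma bswap_pres:
  assumes "bswap G H" "simple_graph G"
  shows "simple_graph H" "verts H = verts G" "deg H = deg G"
  using assms simple_graph_swap deg_swap unfolding bswap_def by fastforce+

lemma bswap_tree: "bswap G H \<Longrightarrow> is_tree G \<Longrightarrow> is_tree H"
  unfolding bswap_def by (elim exE conjE) (simp add: is_tree_swap)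

lemma bswap_sym:
  assumes "bswap G H" "simple_graph G"
  shows "bswap H G"
proof -
  obtain x a y b where s: "can_swap G x a y b" "H = swap G x a y b"
    "deg G x = deg G y \<and> 2 \<le> deg G x \<or> deg G a = deg G b \<and> 2 \<le> deg G a"
    using assms(1) unfolding bswap_def by blast
  show ?thesis unfolding bswap_def
    using s swap_back[OF assms(2) s(1)] deg_swap[OF assms(2) s(1)] by metis
qed

lemma bswaps_pres:
  assumes "bswaps G H" "simple_graph G"
  shows "simple_graph H" "verts H = verts G" "deg H = deg G"
  using assms by (induction rule: rtranclp_induct) (auto simp: bswap_pres)

lemma bswaps_tree: "bswaps G H \<Longrightarrow> is_tree G \<Longrightarrow> is_tree H"
  by (induction rule: rtranclp_induct) (auto simp: bswap_tree)

lemma bswaps_sym: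
  assumes "bswaps G H" "simple_graph G"
  shows "bswaps H G"
  using assms
proof (induction rule: rtranclp_induct)
  case (step H K)
  then show ?case using bswap_sym[of H K] bswaps_pres[of G H] by (meson converse_rtranclp_into_rtranclp)
qed simp

section \<open>Isomorphic copies\<close>

definition gmap :: "('a \<Rightarrow> 'b) \<Rightarrow> 'a graph \<Rightarrow> 'b graph" where
  "gmap f G = (f ` verts G, (`) f ` edges G)"

lemma verts_gmap [simp]: "verts (gmap f G) = f ` verts G"
  by (simp add: gmap_def)

lemma edges_gmap: "edges (gmap f G) = (`) f ` edges G"
  by (simp add: gmap_def)

lemma gmap_comp: "gmap g (gmap f G) = gmap (g \<circ> f) G"
  by (simp add: gmap_def image_image image_comp comp_def)

lemma gmap_cong:
  assumes "simple_graph G" "\<And>v. v \<in> verts G \<Longrightarrow> f v = g v"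
  shows "gmap f G = gmap g G"
proof -
  have "f ` e = g ` e" if "e \<in> edges G" for e
    using assms that by (auto simp: simple_graph_def subset_iff intro!: image_cong)
  then show ?thesis using assms(2) by (auto simp: gmap_def intro!: image_cong)
qed

lemma gmap_id: "simple_graph G \<Longrightarrow> (\<And>v. v \<in> verts G \<Longrightarrow> f v = v) \<Longrightarrow> gmap f G = G"
  using gmap_cong[of G f id] by (simp add: gmap_def prod_eq_iff)

lemma simple_gmap:
  assumes "simple_graph G" "inj_on f (verts G)"
  shows "simple_graph (gmap f G)"
proof -
  have "card (f ` e) = 2" if "e \<in> edges G" for e
    using that assms by (metis card_image inj_on_subset simple_graph_def)
  then show ?thesis using assms(1) by (auto simp: simple_graph_def edges_gmap)
qed

lemma gmap_edge:
  assumes "simple_graph G" "inj_on f (verts G)" "u \<in> verts G" "v \<in> verts G"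
  shows "{f u, f v} \<in> edges (gmap f G) \<longleftrightarrow> {u, v} \<in> edges G"
proof
  assume "{f u, f v} \<in> edges (gmap f G)"
  then obtain e where e: "e \<in> edges G" "f ` e = {f u, f v}" by (auto simp: edges_gmap)
  then have "f ` e = f ` {u, v}" "e \<subseteq> verts G" using assms(1) by (auto simp: simple_graph_def)
  then have "e = {u, v}" using assms inj_on_image_eq_iff[of f "verts G" e "{u, v}"] by blast
  then show "{u, v} \<in> edges G" using e by simp
next
  assume "{u, v} \<in> edges G"
  then show "{f u, f v} \<in> edges (gmap f G)"
    by (auto simp: edges_gmap intro!: image_eqI[of _ _ "{u, v}"])
qed

lemma nbrs_gmap:
  assumes "simple_graph G" "inj_on f (verts G)" "u \<in> verts G"
  shows "nbrs (gmap f G) (f u) = f ` nbrs G u"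
proof (intro set_eqI iffI)
  fix w assume "w \<in> nbrs (gmap f G) (f u)"
  then have w: "{f u, w} \<in> edges (gmap f G)" by simp
  then have "w \<in> verts (gmap f G)" using edge_verts[OF simple_gmap[OF assms(1,2)]] by blast
  then obtain v where v: "v \<in> verts G" "w = f v" by auto
  then show "w \<in> f ` nbrs G u" using w gmap_edge[OF assms v(1)] by auto
next
  fix w assume "w \<in> f ` nbrs G u"
  then obtain v where "{u, v} \<in> edges G" "w = f v" by auto
  then show "w \<in> nbrs (gmap f G) (f u)"
    using edge_verts[OF assms(1)] gmap_edge[OF assms] by auto
qed

lemma deg_gmap:
  assumes "simple_graph G" "inj_on f (verts G)" "u \<in> verts G"
  shows "deg (gmap f G) (f u) = deg G u"
  unfolding deg_def nbrs_gmap[OF assms]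
  by (rule card_image) (meson assms nbrs_verts inj_on_subset Diff_subset subset_trans)

lemma conn_image: "(u, v) \<in> conn E \<Longrightarrow> (f u, f v) \<in> conn ((`) f ` E)"
  by (erule conn_map) (rule conn_edge, rule image_eqI, auto)

lemma gmap_inv:
  assumes "simple_graph G" "inj_on f (verts G)"
  shows "gmap (inv_into (verts G) f) (gmap f G) = G"
  unfolding gmap_comp using assms by (intro gmap_id) auto

lemma image_edges_Diff:
  assumes "simple_graph G" "inj_on f (verts G)" "D \<subseteq> edges G"
  shows "(`) f ` (edges G - D) = (`) f ` edges G - (`) f ` D"
proof (rule inj_on_image_set_diff[of _ "edges G"])
  show "inj_on ((`) f) (edges G)"
    by (rule inj_onI) (metis assms(1,2) inj_on_image_eq_iff simple_graph_def)
qed (use assms in auto)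

lemma tree_gmap:
  assumes "is_tree G" "inj_on f (verts G)"
  shows "is_tree (gmap f G)"
proof -
  have G: "simple_graph G" and F: "forest (edges G)" and C: "connected_graph G"
    using assms by (auto simp: tree_iff)
  have "connected_graph (gmap f G)"
    using C by (auto simp: connected_graph_conn edges_gmap intro: conn_image)
  moreover have "forest (edges (gmap f G))"
    unfolding forest_def
  proof (intro allI impI notI)
    fix p q assume e: "{p, q} \<in> edges (gmap f G)"
      and c: "(p, q) \<in> conn (edges (gmap f G) - {{p, q}})"
    obtain u v where uv: "u \<in> verts G" "v \<in> verts G" "p = f u" "q = f v"
      using edge_verts[OF simple_gmap[OF G assms(2)] e] by auto
    then have e': "{u, v} \<in> edges G" using gmap_edge[OF G assms(2)] e by auto
    let ?g = "inv_into (verts G) f"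
    have "(`) f ` (edges G - {{u, v}}) = edges (gmap f G) - {{p, q}}"
      using image_edges_Diff[OF G assms(2), of "{{u, v}}"] e' uv by (simp add: edges_gmap)
    then have "(?g p, ?g q) \<in> conn ((`) ?g ` (`) f ` (edges G - {{u, v}}))"
      using conn_image[OF c, of ?g] by simp
    moreover have "(`) ?g ` (`) f ` (edges G - {{u, v}}) = edges G - {{u, v}}"
    proof -
      have "?g ` f ` e = e" if "e \<in> edges G" for e
        using that G assms(2) inv_into_image_cancel by (metis simple_graph_def)
      then show ?thesis by (auto simp: image_image)
    qed
    ultimately have "(u, v) \<in> conn (edges G - {{u, v}})" using uv assms(2) by simp
    then show False using F e' by (auto simp: forest_def)
  qed
  ultimately show ?thesis using simple_gmap[OF G assms(2)] by (simp add: tree_iff)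
qed

lemma swap_gmap:
  assumes G: "simple_graph G" and f: "inj_on f (verts G)" and s: "can_swap G x a y b"
  shows "can_swap (gmap f G) (f x) (f a) (f y) (f b)"
    and "swap (gmap f G) (f x) (f a) (f y) (f b) = gmap f (swap G x a y b)"
proof -
  note d = can_swap_distinct[OF G s]
  have im: "(`) f ` (edges G - {{x, a}, {y, b}}) = edges (gmap f G) - {{f x, f a}, {f y, f b}}"
    using image_edges_Diff[OF G f, of "{{x, a}, {y, b}}"] s by (simp add: edges_gmap can_swap_def)
  show "can_swap (gmap f G) (f x) (f a) (f y) (f b)"
    using s d gmap_edge[OF G f] conn_image[of x y "edges G - {{x, a}, {y, b}}" f] f
    unfolding can_swap_def im by (auto dest: inj_onD)
  show "swap (gmap f G) (f x) (f a) (f y) (f b) = gmap f (swap G x a y b)"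
    using im by (simp add: swap_def gmap_def)
qed

lemma bswap_gmap:
  assumes "bswap G H" "simple_graph G" "inj_on f (verts G)"
  shows "bswap (gmap f G) (gmap f H)"
proof -
  obtain x a y b where s: "can_swap G x a y b" "H = swap G x a y b"
    "deg G x = deg G y \<and> 2 \<le> deg G x \<or> deg G a = deg G b \<and> 2 \<le> deg G a"
    using assms(1) unfolding bswap_def by blast
  note d = can_swap_distinct[OF assms(2) s(1)]
  note g = swap_gmap[OF assms(2,3) s(1)]
  have "deg (gmap f G) (f u) = deg G u" if "u \<in> {x, a, y, b}" for u
    using that d deg_gmap[OF assms(2,3)] by auto
  then show ?thesis unfolding bswap_def using s g
    by (intro exI[of _ "f x"] exI[of _ "f a"] exI[of _ "f y"] exI[of _ "f b"]) simp
qed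

lemma bswaps_gmap:
  assumes "bswaps G H" "simple_graph G" "inj_on f (verts G)"
  shows "bswaps (gmap f G) (gmap f H)"
  using assms
proof (induction rule: rtranclp_induct)
  case (step H K)
  then show ?case using bswap_gmap[of H K f] bswaps_pres[of G H] by (metis rtranclp.rtrancl_into_rtrancl)
qed simp

text \<open>An equation with a copy can be substituted directly, unlike the edge condition of
  \<open>graph_iso\<close>; \<open>iso_graph_iso\<close> shows that both agree on simple
  graphs.\<close>

definition iso :: "'a graph \<Rightarrow> 'b graph \<Rightarrow> bool" where
  "iso G H \<longleftrightarrow> (\<exists>f. inj_on f (verts G) \<and> H = gmap f G)"

lemma iso_sym:
  assumes "simple_graph G" "iso G H"
  shows "iso H G"
proof -
  obtain f where f: "inj_on f (verts G)" "H = gmap f G" using assms(2) by (auto simp: iso_def)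
  have "inj_on (inv_into (verts G) f) (verts H)" using f by (simp add: inj_on_inv_into)
  then show ?thesis unfolding iso_def using gmap_inv[OF assms(1) f(1)] f(2) by metis
qed

lemma iso_trans: "iso G H \<Longrightarrow> iso H K \<Longrightarrow> iso G K"
  unfolding iso_def by (metis comp_inj_on gmap_comp verts_gmap)

lemma iso_tree: "iso G H \<Longrightarrow> is_tree G \<Longrightarrow> is_tree H"
  by (auto simp: iso_def tree_gmap)

lemma iso_simple: "iso G H \<Longrightarrow> simple_graph G \<Longrightarrow> simple_graph H"
  by (auto simp: iso_def simple_gmap)

lemma iso_graph_iso:
  assumes "simple_graph G" "simple_graph H"
  shows "graph_iso G H \<longleftrightarrow> iso G H"
proof
  assume "graph_iso G H"
  then obtain f where f: "bij_betw f (verts G) (verts H)"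
    "\<And>u v. u \<in> verts G \<Longrightarrow> v \<in> verts G \<Longrightarrow> {u, v} \<in> edges G \<longleftrightarrow> {f u, f v} \<in> edges H"
    unfolding graph_iso_def by blast
  have inj: "inj_on f (verts G)" and im: "f ` verts G = verts H" using f(1) by (auto simp: bij_betw_def)
  have "edges H = (`) f ` edges G"
  proof (intro set_eqI iffI)
    fix e assume e: "e \<in> edges H"
    then obtain p q where pq: "e = {p, q}" using edge_doubleton[OF assms(2)] by blast
    then obtain u v where "u \<in> verts G" "v \<in> verts G" "p = f u" "q = f v"
      using edge_verts[OF assms(2), of p q] e im unfolding pq by blast
    then show "e \<in> (`) f ` edges G" using f(2)[of u v] e pq by (auto intro!: image_eqI[of _ _ "{u, v}"])
  next
    fix e assume "e \<in> (`) f ` edges G"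
    then obtain e' where e': "e' \<in> edges G" "e = f ` e'" by auto
    then obtain u v where uv: "e' = {u, v}" using edge_doubleton[OF assms(1)] by blast
    then show "e \<in> edges H" using f(2)[of u v] e' edge_verts[OF assms(1), of u v] by auto
  qed
  then show "iso G H" unfolding iso_def using inj im by (intro exI[of _ f]) (simp add: gmap_def prod_eq_iff)
next
  assume "iso G H"
  then obtain f where f: "inj_on f (verts G)" "H = gmap f G" by (auto simp: iso_def)
  then show "graph_iso G H" unfolding graph_iso_def
    using gmap_edge[OF assms(1) f(1)] by (intro exI[of _ f]) (auto simp: bij_betw_def)
qed

definition swap_equiv :: "'a graph \<Rightarrow> 'a graph \<Rightarrow> bool" where
  "swap_equiv G H \<longleftrightarrow> (\<exists>K. bswaps G K \<and> iso K H)"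

text \<open>The swaps from \<open>H\<close> to \<open>K\<close> are pulled back along the
  isomorphism, so that a single renaming remains at the end.\<close>

lemma swap_equiv_trans:
  assumes "swap_equiv G H" "bswaps H K" "simple_graph G"
  shows "swap_equiv G K"
proof -
  obtain L where L: "bswaps G L" "iso L H" using assms(1) by (auto simp: swap_equiv_def)
  have sL: "simple_graph L" using bswaps_pres[OF L(1) assms(3)] by simp
  have sH: "simple_graph H" using iso_simple[OF L(2) sL] .
  obtain f where f: "inj_on f (verts H)" "L = gmap f H" using iso_sym[OF sL L(2)] by (auto simp: iso_def)
  have "bswaps L (gmap f K)" unfolding f(2) by (rule bswaps_gmap[OF assms(2) sH f(1)])
  moreover have "iso (gmap f K) K"
  proof (rule iso_sym)
    show "simple_graph K" using bswaps_pres[OF assms(2) sH] by simp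
    show "iso K (gmap f K)" unfolding iso_def using bswaps_pres(2)[OF assms(2) sH] f(1) by metis
  qed
  ultimately show ?thesis using L(1) unfolding swap_equiv_def by (meson rtranclp_trans)
qed

section \<open>The Sombor index of trees with a given degree sequence\<close>

definition local_opt :: "'a graph \<Rightarrow> bool" where
  "local_opt G \<longleftrightarrow> (\<forall>x a y b. can_swap G x a y b \<longrightarrow> deg G y < deg G x \<longrightarrow> deg G a \<le> deg G b)"

definition class_opt :: "'a graph \<Rightarrow> bool" where
  "class_opt G \<longleftrightarrow> (\<forall>H. bswaps G H \<longrightarrow> local_opt H)"

definition weight :: "'a graph \<Rightarrow> 'a set \<Rightarrow> real" where
  "weight G e = sqrt (\<Sum>u\<in>e. (real (deg G u))\<^sup>2)"

lemma SO_weight: "SO G = sum (weight G) (edges G)"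
  by (simp add: SO_def weight_def)

lemma weight_pair: "u \<noteq> v \<Longrightarrow> weight G {u, v} = sqrt ((real (deg G u))\<^sup>2 + (real (deg G v))\<^sup>2)"
  by (simp add: weight_def)

text \<open>All degrees are preserved, so every edge that stays keeps its weight.\<close>

lemma SO_swap:
  assumes "simple_graph G" "can_swap G x a y b"
  shows "SO (swap G x a y b) = SO G - weight G {x, a} - weight G {y, b} + weight G {x, b} + weight G {y, a}"
proof -
  note d = can_swap_distinct[OF assms]
  let ?F = "edges G - {{x, a}, {y, b}}"
  have e: "{x, a} \<in> edges G" "{y, b} \<in> edges G" "{x, b} \<notin> edges G" "{y, a} \<notin> edges G"
    using assms(2) by (auto simp: can_swap_def)
  have ne: "{x, a} \<noteq> {y, b}" "{x, b} \<noteq> {y, a}" using d by (auto simp: doubleton_eq_iff)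
  have fin: "finite ?F" using finite_edges[OF assms(1)] by simp
  have weight: "weight (swap G x a y b) = weight G" using deg_swap[OF assms]
    by (auto simp: weight_def fun_eq_iff)
  have "edges G = insert {x, a} (insert {y, b} ?F)" using e by auto
  then have 1: "SO G = weight G {x, a} + (weight G {y, b} + sum (weight G) ?F)"
    unfolding SO_weight using fin ne
    by (metis (no_types, lifting) Diff_iff finite_insert insert_iff sum.insert)
  have "edges (swap G x a y b) = insert {x, b} (insert {y, a} ?F)" by (auto simp: edges_swap)
  then have 2: "SO (swap G x a y b) = weight G {x, b} + (weight G {y, a} + sum (weight G) ?F)"
    unfolding SO_weight weight using fin ne e by simp
  show ?thesis using 1 2 by simp
qed

lemma SO_swap_eq:
  assumes "simple_graph G" "can_swap G x a y b" "deg G x = deg G y \<or> deg G a = deg G b"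
  shows "SO (swap G x a y b) = SO G"
  using assms(3) can_swap_distinct(1-6)[OF assms(1,2)] unfolding SO_swap[OF assms(1,2)]
  by (auto simp: weight_pair)

text \<open>Squared, both sides contain the same sum of squares, so the products under the roots
  decide. These differ by \<open>(x\<^sup>2 - y\<^sup>2) * (a\<^sup>2 - b\<^sup>2)\<close>.\<close>

lemma sqrt_exchange_less:
  fixes x y a b :: real
  assumes "0 \<le> y" "y < x" "0 \<le> b" "b < a"
  shows "sqrt (x\<^sup>2 + a\<^sup>2) + sqrt (y\<^sup>2 + b\<^sup>2) < sqrt (x\<^sup>2 + b\<^sup>2) + sqrt (y\<^sup>2 + a\<^sup>2)"
proof (rule power2_less_imp_less)
  have "y\<^sup>2 < x\<^sup>2" "b\<^sup>2 < a\<^sup>2" using assms by (auto intro: power_strict_mono)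
  then have "0 < (x\<^sup>2 - y\<^sup>2) * (a\<^sup>2 - b\<^sup>2)" by simp
  then have "(x\<^sup>2 + a\<^sup>2) * (y\<^sup>2 + b\<^sup>2) < (x\<^sup>2 + b\<^sup>2) * (y\<^sup>2 + a\<^sup>2)" by (simp add: algebra_simps)
  then have "sqrt (x\<^sup>2 + a\<^sup>2) * sqrt (y\<^sup>2 + b\<^sup>2) < sqrt (x\<^sup>2 + b\<^sup>2) * sqrt (y\<^sup>2 + a\<^sup>2)"
    by (simp flip: real_sqrt_mult)
  then show "(sqrt (x\<^sup>2 + a\<^sup>2) + sqrt (y\<^sup>2 + b\<^sup>2))\<^sup>2 < (sqrt (x\<^sup>2 + b\<^sup>2) + sqrt (y\<^sup>2 + a\<^sup>2))\<^sup>2"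
    by (simp add: power2_sum)
qed (simp add: add_nonneg_nonneg)

lemma SO_swap_less:
  assumes "simple_graph G" "can_swap G x a y b" "deg G y < deg G x" "deg G b < deg G a"
  shows "SO G < SO (swap G x a y b)"
  using sqrt_exchange_less[of "real (deg G y)" "real (deg G x)" "real (deg G b)" "real (deg G a)"]
    assms(3,4) can_swap_distinct(1-6)[OF assms(1,2)] unfolding SO_swap[OF assms(1,2)]
  by (simp add: weight_pair)

lemma bswap_SO: "bswap G H \<Longrightarrow> simple_graph G \<Longrightarrow> SO H = SO G"
  unfolding bswap_def by (elim exE conjE) (simp, rule SO_swap_eq, auto)

lemma bswaps_SO: "bswaps G H \<Longrightarrow> simple_graph G \<Longrightarrow> SO H = SO G"
  by (induction rule: rtranclp_induct) (auto simp: bswap_SO dest: bswaps_pres)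

lemma SO_gmap:
  assumes "simple_graph G" "inj_on f (verts G)"
  shows "SO (gmap f G) = SO G"
proof -
  have "inj_on ((`) f) (edges G)"
    by (rule inj_onI) (metis assms inj_on_image_eq_iff simple_graph_def)
  moreover have "weight (gmap f G) (f ` e) = weight G e" if "e \<in> edges G" for e
  proof -
    have e: "e \<subseteq> verts G" using that assms(1) by (auto simp: simple_graph_def)
    have "(\<Sum>u\<in>f ` e. (real (deg (gmap f G) u))\<^sup>2) = (\<Sum>u\<in>e. (real (deg G u))\<^sup>2)"
      using e deg_gmap[OF assms] inj_on_subset[OF assms(2) e]
      by (subst sum.reindex) (auto intro!: sum.cong)
    then show ?thesis by (simp add: weight_def)
  qed
  ultimately show ?thesis unfolding SO_weight edges_gmap by (subst sum.reindex) auto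
qed

lemma iso_SO: "iso G H \<Longrightarrow> simple_graph G \<Longrightarrow> SO H = SO G"
  by (auto simp: iso_def SO_gmap)

definition deg_mset :: "'a graph \<Rightarrow> nat multiset" where
  "deg_mset G = image_mset (deg G) (mset_set (verts G))"

lemma degree_seq_eq_iff: "degree_seq G = degree_seq H \<longleftrightarrow> deg_mset G = deg_mset H"
  unfolding degree_seq_def deg_mset_def by (metis mset_sorted_list_of_multiset rev_is_rev_conv)

lemma deg_mset_swap: "simple_graph G \<Longrightarrow> can_swap G x a y b \<Longrightarrow> deg_mset (swap G x a y b) = deg_mset G"
proof -
  assume "simple_graph G" "can_swap G x a y b"
  then have "deg (swap G x a y b) = deg G" by (intro ext deg_swap)
  then show ?thesis by (simp add: deg_mset_def)
qed

lemma bswaps_deg_mset: "bswaps G H \<Longrightarrow> simple_graph G \<Longrightarrow> deg_mset H = deg_mset G"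
  by (simp add: deg_mset_def bswaps_pres)

text \<open>The vertex type may be infinite, and then there may be infinitely many such trees. Each
  has a copy on the numbers below \<open>length D\<close>, so there are finitely many values and
  \<open>Max\<close> is meaningful.\<close>

lemma finite_SO_trees: "finite (SO ` (trees_with D :: 'a graph set))"
proof (rule finite_subset)
  let ?N = "{{..<length D}} \<times> Pow (Pow {..<length D}) :: nat graph set"
  show "finite (SO ` ?N)" by simp
  show "SO ` (trees_with D :: 'a graph set) \<subseteq> SO ` ?N"
  proof (rule image_subsetI)
    fix T :: "'a graph" assume T: "T \<in> trees_with D"
    then have G: "simple_graph T" and D: "degree_seq T = D" by (auto simp: trees_with_def tree_iff)
    have fin: "finite (verts T)" using G by (simp add: simple_graph_def)
    have "length D = size (deg_mset T)"
      unfolding D[symmetric] degree_seq_def deg_mset_def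
      by (metis length_rev mset_sorted_list_of_multiset size_mset)
    then have "card (verts T) = length D" by (simp add: deg_mset_def)
    then obtain f where f: "bij_betw f (verts T) {..<length D}"
      using fin finite_same_card_bij[of "verts T" "{..<length D}"] by auto
    then have i: "inj_on f (verts T)" "f ` verts T = {..<length D}" by (auto simp: bij_betw_def)
    have "edges (gmap f T) \<subseteq> Pow {..<length D}"
      using simple_gmap[OF G i(1)] i(2) by (auto simp: simple_graph_def)
    then have "gmap f T \<in> ?N" using i(2) by (auto simp: mem_Times_iff)
    then show "SO T \<in> SO ` ?N" using SO_gmap[OF G i(1)] by (metis image_eqI)
  qed
qed

lemma max_class_opt:
  assumes T: "T \<in> (trees_with D :: 'a graph set)"
    and m: "SO T = Max (SO ` (trees_with D :: 'a graph set))"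
  shows "class_opt T"
  unfolding class_opt_def local_opt_def
proof (intro allI impI)
  fix H x a y b assume H: "bswaps T H" and s: "can_swap H x a y b" and d: "deg H y < deg H x"
  have tT: "is_tree T" "degree_seq T = D" using T by (auto simp: trees_with_def)
  then have sT: "simple_graph T" by (simp add: tree_iff)
  have tH: "is_tree H" using bswaps_tree[OF H tT(1)] .
  then have sH: "simple_graph H" by (simp add: tree_iff)
  have "swap H x a y b \<in> trees_with D"
    using is_tree_swap[OF tH s] deg_mset_swap[OF sH s] bswaps_deg_mset[OF H sT] tT(2)
    by (auto simp: trees_with_def degree_seq_eq_iff)
  then have "SO (swap H x a y b) \<le> SO T" unfolding m by (intro Max_ge finite_SO_trees) auto
  also have "\<dots> = SO H" using bswaps_SO[OF H sT] by simp
  finally show "deg H a \<le> deg H b" using SO_swap_less[OF sH s d] by (meson not_less)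
qed

section \<open>Exchanges of branches\<close>

lemma conn_insert_conn:
  assumes "(u, w) \<in> conn E" "(p, q) \<in> conn (insert {u, w} E)"
  shows "(p, q) \<in> conn E"
  using conn_map[OF assms(2), of id E] assms(1) conn_sym[OF assms(1)] conn_edge[of _ _ E]
  by (auto simp: doubleton_eq_iff)

text \<open>The walk has to use the edge \<open>pq\<close>. Just before its first crossing it stands
  at an end of this edge, which it has reached in fewer steps and without the edge.\<close>

lemma relpow_cross:
  assumes "(r, w) \<in> adj_rel G ^^ n" "(r, w) \<notin> conn (edges G - {{p, q}})"
  shows "\<exists>m<n. (r, p) \<in> adj_rel G ^^ m \<and> (r, p) \<in> conn (edges G - {{p, q}}) \<or>
               (r, q) \<in> adj_rel G ^^ m \<and> (r, q) \<in> conn (edges G - {{p, q}})"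
  using assms
proof (induction n arbitrary: w)
  case (Suc n)
  then obtain w' where w': "(r, w') \<in> adj_rel G ^^ n" "{w', w} \<in> edges G"
    by (auto simp: adj_rel_def)
  show ?case
  proof (cases "(r, w') \<in> conn (edges G - {{p, q}})")
    case True
    then have "{w', w} \<notin> edges G - {{p, q}}" using Suc.prems(2) conn_edge conn_trans by metis
    then have "{w', w} = {p, q}" using w'(2) by simp
    then have "w' = p \<or> w' = q" by (auto simp: doubleton_eq_iff)
    then show ?thesis using True w' by blast
  next
    case False
    then show ?thesis using Suc.IH[OF w'(1)] less_SucI by blast
  qed
qed simp

lemma gdist_le: "(u, v) \<in> adj_rel G ^^ n \<Longrightarrow> gdist G u v \<le> n"
  unfolding gdist_def by (rule Least_le)

lemma gdist_relpow:
  assumes "(u, v) \<in> conn (edges G)"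
  shows "(u, v) \<in> adj_rel G ^^ gdist G u v"
proof -
  have "\<exists>n. (u, v) \<in> adj_rel G ^^ n"
    using assms unfolding conn_def adj_rel_def by (rule rtrancl_imp_relpow[THEN exE]) blast
  then show ?thesis unfolding gdist_def by (rule LeastI_ex)
qed

lemma swap_branch_exchange:
  assumes T: "is_tree G" and s: "can_swap G x a y b" and d: "deg G x = deg G y"
  shows "branch_exchange G (swap G x a y b)"
proof -
  have G: "simple_graph G" and F: "forest (edges G)" and C: "connected_graph G" using T
    by (auto simp: tree_iff)
  note ds = can_swap_distinct[OF G s]
  have e: "{x, a} \<in> edges G" "{y, b} \<in> edges G" using s by (auto simp: can_swap_def)
  have cn: "(x, w) \<in> conn (edges G)" if "w \<in> verts G" for w using C that ds
    by (auto simp: connected_graph_conn)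
  \<comment> \<open>The root is \<open>x\<close> itself: then \<open>a\<close> is a child of
    \<open>x\<close>, and \<open>b\<close> is a child of \<open>y\<close>, as each walk from
    \<open>x\<close> to \<open>b\<close> visits \<open>y\<close> before it crosses
    \<open>yb\<close>.\<close>
  have "gdist G x x = 0" using gdist_le[of x x 0 G] by simp
  moreover have "gdist G x a \<noteq> 0" using gdist_relpow[OF cn[OF ds(8)]] ds(1) by (metis relpow_0_E)
  ultimately have a: "a \<in> children G x x" using e by (simp add: children_def)
  have "(x, y) \<in> conn (edges G - {{y, b}})" using s by (auto simp: can_swap_def elim: conn_mono)
  then have "(x, b) \<notin> conn (edges G - {{y, b}})"
    using forest_bridge[OF F e(2)] conn_sym conn_trans by metis
  then have "\<exists>m<gdist G x b. (x, y) \<in> adj_rel G ^^ m"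
    using relpow_cross[OF gdist_relpow[OF cn[OF ds(10)]], of y b] by blast
  then have "gdist G x y < gdist G x b" using gdist_le[of x y _ G] by (meson le_less_trans)
  then have b: "b \<in> children G x y" using e by (simp add: children_def)
  show ?thesis unfolding branch_exchange_def
    using T is_tree_swap[OF T s] a b d ds unfolding swap_def by blast
qed

text \<open>Otherwise every walk from \<open>r\<close> to \<open>x\<close> would enter through
  \<open>a\<close>, and \<open>a\<close> would be nearer to the root than \<open>x\<close>.\<close>

lemma child_conn:
  assumes "connected_graph G" "r \<in> verts G" "x \<in> verts G" "a \<in> children G r x"
  shows "(r, x) \<in> conn (edges G - {{x, a}})"
proof (rule ccontr)
  assume n: "(r, x) \<notin> conn (edges G - {{x, a}})"
  have "(r, x) \<in> conn (edges G)" using assms by (auto simp: connected_graph_conn)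
  from relpow_cross[OF gdist_relpow[OF this] n] n
  obtain m where "m < gdist G r x" "(r, a) \<in> adj_rel G ^^ m" by blast
  then show False using gdist_le[of r a m G] assms(4) by (auto simp: children_def)
qed

text \<open>Suppose that \<open>x\<close> and \<open>y\<close> are separated when both edges are
  deleted. If the path joining them uses exactly one of the edges at its end, the exchange
  disconnects the graph. If it has the form \<open>x a ... b y\<close>, the exchange does give a
  tree, and only the requirement that \<open>a\<close> and \<open>b\<close> are children rules this
  out.\<close>

lemma branch_exchange_swap:
  assumes "branch_exchange G H"
  obtains x a y b where "can_swap G x a y b" "deg G x = deg G y" "H = swap G x a y b"
proof -
  obtain r x y a b where v: "r \<in> verts G" "x \<in> verts G" "y \<in> verts G" "a \<in> children G r x"
    "b \<in> children G r y" "x \<noteq> y" "deg G x = deg G y" and H: "H = swap G x a y b"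
      and T: "is_tree G" "is_tree H"
    using assms unfolding branch_exchange_def swap_def by blast
  have G: "simple_graph G" and F: "forest (edges G)" and C: "connected_graph G" using T
    by (auto simp: tree_iff)
  have CH: "connected_graph H" using T by (auto simp: tree_iff)
  have e: "{x, a} \<in> edges G" "{y, b} \<in> edges G" using v by (auto simp: children_def)
  let ?F = "edges G - {{x, a}, {y, b}}"
  have ba: "(x, a) \<notin> conn (edges G - {{x, a}})" and bb: "(y, b) \<notin> conn (edges G - {{y, b}})"
    using forest_bridge[OF F] e by auto
  have ma: "(p, q) \<in> conn ?F \<Longrightarrow> (p, q) \<in> conn (edges G - {{x, a}})" for p q
    by (erule conn_mono) auto
  have mb: "(p, q) \<in> conn ?F \<Longrightarrow> (p, q) \<in> conn (edges G - {{y, b}})" for p q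
    by (erule conn_mono) auto
  have nxa: "(x, a) \<notin> conn ?F" and nyb: "(y, b) \<notin> conn ?F" using ba bb ma mb by metis+
  have ins: "(p, q) \<in> conn (edges G) \<Longrightarrow> (p, q) \<in> conn (insert {x, a} (insert {y, b} ?F))" for p q
    by (erule conn_mono) auto
  have insH: "(p, q) \<in> conn (edges H) \<Longrightarrow> (p, q) \<in> conn (insert {x, b} (insert {y, a} ?F))" for p q
    by (erule conn_mono) (auto simp: H edges_swap)
  have av: "a \<in> verts G" "b \<in> verts G" using e edge_verts[OF G] by auto
  have "(x, y) \<in> conn ?F"
  proof (rule ccontr)
    assume nxy: "(x, y) \<notin> conn ?F"
    have "(x, y) \<in> conn (insert {x, a} (insert {y, b} ?F))"
      using C v by (intro ins) (auto simp: connected_graph_conn)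
    then consider "(a, y) \<in> conn ?F" | "(x, b) \<in> conn ?F" | "(a, b) \<in> conn ?F"
      using conn_insert[of _ _ y b ?F] conn_insert[of x y x a "insert {y, b} ?F"] nxy nxa
        conn_sym conn_trans conn_refl by (smt (verit, ccfv_threshold))
    then show False
    proof cases
      case 1
      have "(x, a) \<in> conn (insert {x, b} (insert {y, a} ?F))"
        using CH v av by (intro insH) (auto simp: connected_graph_conn H)
      moreover have "(p, q) \<in> conn (insert {y, a} ?F) \<Longrightarrow> (p, q) \<in> conn ?F" for p q
        using conn_insert_conn[OF conn_sym[OF 1]] .
      ultimately show False
        using conn_insert[of x a x b "insert {y, a} ?F"] nxa nyb 1 conn_sym conn_trans by metis
    next
      case 2
      have "(y, b) \<in> conn (insert {y, a} (insert {x, b} ?F))"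
        using CH v av by (subst insert_commute, intro insH) (auto simp: connected_graph_conn H)
      moreover have "(p, q) \<in> conn (insert {x, b} ?F) \<Longrightarrow> (p, q) \<in> conn ?F" for p q
        using conn_insert_conn[OF 2] .
      ultimately show False
        using conn_insert[of y b y a "insert {x, b} ?F"] nxa nyb 2 conn_sym conn_trans by metis
    next
      case 3
      have ia: "edges G - {{x, a}} \<subseteq> insert {y, b} ?F"
        and ib: "edges G - {{y, b}} \<subseteq> insert {x, a} ?F" by auto
      have "(r, x) \<in> conn (insert {y, b} ?F)"
        using child_conn[OF C v(1,2,4)] ia by (rule conn_mono)
      then have rx: "(r, x) \<in> conn ?F \<or> (r, b) \<in> conn ?F"
        using conn_insert[of r x y b ?F] 3 nxa conn_sym conn_trans by metis
      have "(r, y) \<in> conn (insert {x, a} ?F)"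
        using child_conn[OF C v(1,3,5)] ib by (rule conn_mono)
      then have ry: "(r, y) \<in> conn ?F \<or> (r, a) \<in> conn ?F"
        using conn_insert[of r y x a ?F] 3 nyb conn_sym conn_trans by metis
      have "(r, x) \<notin> conn ?F \<or> (r, y) \<notin> conn ?F" using nxy conn_sym conn_trans by metis
      \<comment> \<open>The root cannot be on the side of \<open>x\<close> and on the side of
        \<open>y\<close>, so it lies in the part of \<open>a\<close> and \<open>b\<close>; but then
        it reaches \<open>x\<close> only through \<open>a\<close>, which contradicts that
        \<open>a\<close> is a child of \<open>x\<close>.\<close>
      then have rab: "(r, a) \<in> conn ?F" using rx ry 3 conn_sym conn_trans by metis
      then have "(a, x) \<in> conn (edges G - {{x, a}})"
        using child_conn[OF C v(1,2,4)] ma[OF rab] conn_sym conn_trans by metis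
      then show False using ba conn_sym by metis
    qed
  qed
  then have "can_swap G x a y b" by (intro tree_can_swap T e v)
  then show thesis using that v H by blast
qed

lemma branch_exchange_SO:
  assumes "branch_exchange\<^sup>*\<^sup>* G H" "is_tree G"
  shows "SO H = SO G \<and> is_tree H"
  using assms
proof (induction rule: rtranclp_induct)
  case (step K H)
  then obtain x a y b where "can_swap K x a y b" "deg K x = deg K y" "H = swap K x a y b"
    using branch_exchange_swap by metis
  then show ?case using step SO_swap_eq is_tree_swap by (metis tree_iff)
qed simp

section \<open>Simulating swaps whose moved ends have equal degree\<close>

definition spokes :: "'a \<Rightarrow> 'a set \<Rightarrow> 'a set set" where
  "spokes c S = (\<lambda>l. {c, l}) ` S"

lemma spokes_iff: "e \<in> spokes c S \<longleftrightarrow> (\<exists>l\<in>S. e = {c, l})"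
  by (auto simp: spokes_def)

lemma spokes_insert: "spokes c (insert l S) = insert {c, l} (spokes c S)"
  by (simp add: spokes_def)

lemma no_loop: "simple_graph G \<Longrightarrow> {u} \<notin> edges G"
  using edge_verts[of G u u] by auto

text \<open>One pair of branches is exchanged at a time. The connection between \<open>a\<close> and
  \<open>b\<close> avoids all edges that are to be moved, so it is available in every step.\<close>

lemma multi_exchange:
  assumes "finite A" "card A = card B" "is_tree G" "a \<noteq> b" "deg G a = deg G b"
    "A \<subseteq> nbrs G a" "B \<subseteq> nbrs G b" "(a, b) \<in> conn (edges G - spokes a A - spokes b B)"
  shows "branch_exchange\<^sup>*\<^sup>* G (verts G, edges G - spokes a A - spokes b B \<union> spokes a B \<union> spokes b A)"
  using assms
proof (induction A arbitrary: B G rule: finite_induct)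
  case empty
  have "finite (nbrs G b)" using empty by (simp add: tree_iff)
  then have "B = {}" using empty finite_subset by fastforce
  then show ?case by (simp add: spokes_def)
next
  case (insert \<alpha> A)
  have G: "simple_graph G" using insert by (simp add: tree_iff)
  have "finite B" using insert.prems(6) G finite_nbrs finite_subset by metis
  moreover have "card B = Suc (card A)" using insert by simp
  ultimately obtain \<beta> B' where B: "B = insert \<beta> B'" "\<beta> \<notin> B'" "card A = card B'"
    by (metis card_Suc_eq)
  have e: "{a, \<alpha>} \<in> edges G" "{b, \<beta>} \<in> edges G" using insert.prems(5,6) B by auto
  have "(a, b) \<in> conn (edges G - {{a, \<alpha>}, {b, \<beta>}})"
    using insert.prems(7) by (rule conn_mono) (auto simp: B spokes_iff)
  then have s: "can_swap G a \<alpha> b \<beta>" by (intro tree_can_swap insert.prems e)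
  note d = can_swap_distinct[OF G s]
  let ?H = "swap G a \<alpha> b \<beta>"
  have be: "branch_exchange G ?H" by (rule swap_branch_exchange[OF insert.prems(2) s insert.prems(4)])
  have nA: "\<alpha> \<notin> A" "\<beta> \<notin> A" "\<alpha> \<notin> B'" "\<beta> \<notin> B'" "a \<notin> A" "b \<notin> B'"
    using s insert.hyps(2) insert.prems(5,6) B no_loop[OF G] by (auto simp: can_swap_def)
  have n: "A \<subseteq> nbrs ?H a" "B' \<subseteq> nbrs ?H b"
    unfolding nbrs_swap(1,3)[OF G s] using insert.prems(5,6) B nA by auto
  have "(a, b) \<in> conn (edges ?H - spokes a A - spokes b B')"
    using insert.prems(7) by (rule conn_mono) (auto simp: B spokes_iff edges_swap)
  then have "branch_exchange\<^sup>*\<^sup>* ?H (verts ?H, edges ?H - spokes a A - spokes b B' \<union> spokes a B' \<union> spokes b A)"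
    using insert.prems deg_swap[OF G s] is_tree_swap[OF _ s] B n by (intro insert.IH) auto
  moreover have "{a, \<beta>} \<notin> spokes a A \<union> spokes b B'" "{b, \<alpha>} \<notin> spokes a A \<union> spokes b B'"
    using nA d by (auto simp: spokes_iff doubleton_eq_iff)
  then have "edges ?H - spokes a A - spokes b B' \<union> spokes a B' \<union> spokes b A
      = edges G - spokes a (insert \<alpha> A) - spokes b B \<union> spokes a B \<union> spokes b (insert \<alpha> A)"
  proof -
    have aux: "E - {p, q} \<union> {p', q'} - P - Q \<union> P' \<union> Q' = E - insert p P - insert q Q \<union> insert p' P' \<union> insert q' Q'"
      if "p' \<notin> P \<union> Q" "q' \<notin> P \<union> Q" for E P Q P' Q' :: "'a set set" and p q p' q'
      using that by blast
    show ?thesis unfolding edges_swap B(1) spokes_insert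
      using \<open>{a, \<beta>} \<notin> spokes a A \<union> spokes b B'\<close> \<open>{b, \<alpha>} \<notin> spokes a A \<union> spokes b B'\<close> by (rule aux)
  qed
  ultimately show ?case using be by (auto intro: converse_rtranclp_into_rtranclp)
qed

definition transp :: "'a \<Rightarrow> 'a \<Rightarrow> 'a \<Rightarrow> 'a" where
  "transp a b = id(a := b, b := a)"

lemma transp_simps [simp]: "transp a b a = b" "transp a b b = a" "v \<noteq> a \<Longrightarrow> v \<noteq> b \<Longrightarrow> transp a b v = v"
  by (auto simp: transp_def)

lemma transp_transp [simp]: "transp a b (transp a b v) = v"
  by (auto simp: transp_def)

lemma inj_transp [simp]: "inj_on (transp a b) A"
  by (metis inj_onI transp_transp)

lemma transp_image: "a \<in> A \<Longrightarrow> b \<in> A \<Longrightarrow> transp a b ` A = A"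
proof -
  assume "a \<in> A" "b \<in> A"
  then have "transp a b ` A \<subseteq> A" by (auto simp: transp_def)
  then have "transp a b ` transp a b ` A \<subseteq> transp a b ` A" "transp a b ` A \<subseteq> A" by auto
  then show ?thesis by (simp add: image_image)
qed

lemma transp_fix: "a \<notin> A \<Longrightarrow> b \<notin> A \<Longrightarrow> transp a b ` A = A"
  by (force simp: transp_def)

lemma transp_spokes:
  assumes "a \<notin> S" "b \<notin> S"
  shows "(`) (transp a b) ` spokes a S = spokes b S" "(`) (transp a b) ` spokes b S = spokes a S"
proof -
  have "\<And>l. l \<in> S \<Longrightarrow> transp a b l = l" using assms by (metis transp_simps(3))
  then show "(`) (transp a b) ` spokes a S = spokes b S" "(`) (transp a b) ` spokes b S = spokes a S"
    unfolding spokes_def image_image by (auto intro!: image_cong)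
qed

text \<open>Exchanging \<open>x\<close> and \<open>y\<close> between \<open>a\<close> and \<open>b\<close> is, up to renaming \<open>a\<close> and \<open>b\<close>, the exchange of
  all the remaining branches at \<open>a\<close> and \<open>b\<close>.\<close>

lemma swap_branch_exchanges:
  assumes T: "is_tree G" and s: "can_swap G x a y b" and d: "deg G a = deg G b"
  shows "\<exists>H. branch_exchange\<^sup>*\<^sup>* G H \<and> iso H (swap G x a y b)"
proof -
  have G: "simple_graph G" and F: "forest (edges G)" using T by (auto simp: tree_iff)
  note ds = can_swap_distinct[OF G s]
  have e: "{x, a} \<in> edges G" "{y, b} \<in> edges G" using s by (auto simp: can_swap_def)
  have ba: "(x, a) \<notin> conn (edges G - {{x, a}})" and bb: "(y, b) \<notin> conn (edges G - {{y, b}})"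
    using forest_bridge[OF F] e by auto
  let ?F = "edges G - {{x, a}, {y, b}}"
  obtain p where p: "path ?F p" "hd p = x" "last p = y" using s conn_path[of x y ?F]
    by (auto simp: can_swap_def)
  have part: "(x, u) \<in> conn ?F" if u: "u \<in> set p" for u
  proof -
    obtain p1 p2 where q: "p = (p1 @ [u]) @ p2" using split_list[OF u] by auto
    then have "path ?F (p1 @ [u])" using p(1) unfolding path_def q successively_append_iff by auto
    then show ?thesis using path_conn_within[of "p1 @ [u]" ?F] p(2) q
      by (auto simp: path_def hd_append split: if_splits elim!: conn_mono)
  qed
  have ap: "a \<notin> set p"
  proof
    assume "a \<in> set p"
    from conn_mono[OF part[OF this], of "edges G - {{x, a}}"] ba show False by auto
  qed
  have bp: "b \<notin> set p"
  proof
    assume "b \<in> set p"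
    then have "(y, b) \<in> conn ?F" using s part conn_sym conn_trans unfolding can_swap_def by metis
    from conn_mono[OF this, of "edges G - {{y, b}}"] bb show False by auto
  qed
  define A where "A = nbrs G a - {x}"
  define B where "B = nbrs G b - {y}"
  let ?E = "edges G - spokes a A - spokes b B"
  have "(x, y) \<in> conn ?E"
    using path_conn_within[of p ?F] p ap bp
    by (auto simp: path_def spokes_iff elim!: conn_mono)
  moreover have "(a, x) \<in> conn ?E" "(y, b) \<in> conn ?E"
    using e ds by (auto intro!: conn_edge simp: A_def B_def spokes_iff insert_commute doubleton_eq_iff)
  ultimately have ab: "(a, b) \<in> conn ?E" by (meson conn_trans)
  \<comment> \<open>An edge \<open>ab\<close> would be bypassed via \<open>x\<close> and
    \<open>y\<close>. Hence transposing \<open>a\<close> and \<open>b\<close> fixes all their other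
    neighbours.\<close>
  have nab: "{a, b} \<notin> edges G"
  proof
    assume e': "{a, b} \<in> edges G"
    then have "{a, b} \<in> spokes a A" using ds by (auto simp: A_def spokes_iff)
    then have "(a, b) \<in> conn (edges G - {{a, b}})" using ab by (auto elim!: conn_mono)
    then show False using forest_bridge[OF F e'] by simp
  qed
  have nA: "a \<notin> A" "b \<notin> A" "x \<notin> A" "a \<notin> B" "b \<notin> B" "y \<notin> B"
    using nab no_loop[OF G] by (auto simp: A_def B_def insert_commute)
  have xA: "x \<in> nbrs G a" "y \<in> nbrs G b" using e by (auto simp: insert_commute)
  have "card A = card B" using d xA G by (simp add: A_def B_def deg_def)
  moreover have "finite A" using G by (simp add: A_def)
  ultimately have be: "branch_exchange\<^sup>*\<^sup>* G (verts G, ?E \<union> spokes a B \<union> spokes b A)"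
    using ds d ab T by (intro multi_exchange) (auto simp: A_def B_def)
  \<comment> \<open>Both the result of the exchanges and the target consist of \<open>E0\<close>,
    two edges at \<open>x\<close> and \<open>y\<close>, and the spokes at \<open>a\<close> and
    \<open>b\<close>. The transposition of \<open>a\<close> and \<open>b\<close> fixes
    \<open>E0\<close> and carries one into the other.\<close>
  define E0 where "E0 = {e \<in> edges G. a \<notin> e \<and> b \<notin> e}"
  have E: "edges G = E0 \<union> {{x, a}, {y, b}} \<union> spokes a A \<union> spokes b B"
  proof (intro set_eqI iffI)
    fix e assume e': "e \<in> edges G"
    have ex: "\<exists>w. e = {c, w} \<and> w \<in> nbrs G c" if "c \<in> e" for c
      using edge_doubleton[OF G e'] e' that by (auto simp: insert_commute)
    consider "e \<in> E0" | "a \<in> e" | "b \<in> e" using e' by (auto simp: E0_def)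
    then show "e \<in> E0 \<union> {{x, a}, {y, b}} \<union> spokes a A \<union> spokes b B"
    proof cases
      case 2
      then obtain w where "e = {a, w}" "w \<in> nbrs G a" using ex by blast
      then show ?thesis by (cases "w = x") (auto simp: A_def spokes_def insert_commute)
    next
      case 3
      then obtain w where "e = {b, w}" "w \<in> nbrs G b" using ex by blast
      then show ?thesis by (cases "w = y") (auto simp: B_def spokes_def insert_commute)
    qed simp
  qed (auto simp: E0_def e A_def B_def spokes_iff)
  have dis: "E0 \<inter> spokes a A = {}" "E0 \<inter> spokes b B = {}" "spokes a A \<inter> spokes b B = {}"
    "{x, a} \<notin> E0" "{y, b} \<notin> E0" "{x, a} \<notin> spokes a A" "{x, a} \<notin> spokes b B"
    "{y, b} \<notin> spokes a A" "{y, b} \<notin> spokes b B"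
    using nA ds by (auto simp: E0_def spokes_iff doubleton_eq_iff)
  have E1: "?E \<union> spokes a B \<union> spokes b A = E0 \<union> {{x, a}, {y, b}} \<union> spokes a B \<union> spokes b A"
    using E dis by blast
  have E2: "edges (swap G x a y b) = E0 \<union> {{x, b}, {y, a}} \<union> spokes a A \<union> spokes b B"
    unfolding edges_swap using E dis by blast
  have t0: "(`) (transp a b) ` E0 = E0"
  proof -
    have "transp a b ` e = e" if "e \<in> E0" for e using that by (intro transp_fix) (auto simp: E0_def)
    then show ?thesis by auto
  qed
  have "(`) (transp a b) ` {{x, a}, {y, b}} = {{x, b}, {y, a}}" using ds by auto
  then have "gmap (transp a b) (verts G, ?E \<union> spokes a B \<union> spokes b A) = swap G x a y b"
    unfolding E1 using t0 transp_spokes[OF nA(1,2)] transp_spokes[OF nA(4,5)] ds E2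
    by (auto simp: gmap_def prod_eq_iff transp_image image_Un)
  then show ?thesis using be unfolding iso_def by (metis inj_transp)
qed

lemma branch_exchange_gmap:
  assumes "branch_exchange G H" "inj_on f (verts G)"
  shows "branch_exchange (gmap f G) (gmap f H)"
proof -
  obtain x a y b where s: "can_swap G x a y b" "deg G x = deg G y" "H = swap G x a y b"
    using branch_exchange_swap[OF assms(1)] by metis
  have T: "is_tree G" using assms(1) by (auto simp: branch_exchange_def)
  then have G: "simple_graph G" by (simp add: tree_iff)
  note d = can_swap_distinct[OF G s(1)]
  have "deg (gmap f G) (f x) = deg (gmap f G) (f y)"
    using s(2) deg_gmap[OF G assms(2) d(7)] deg_gmap[OF G assms(2) d(9)] by simp
  from swap_branch_exchange[OF tree_gmap[OF T assms(2)] swap_gmap(1)[OF G assms(2) s(1)] this]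
  show ?thesis unfolding swap_gmap(2)[OF G assms(2) s(1)] s(3) .
qed

lemma branch_exchanges_verts: "branch_exchange\<^sup>*\<^sup>* G H \<Longrightarrow> verts H = verts G"
proof (induction rule: rtranclp_induct)
  case (step H K)
  then show ?case using branch_exchange_swap verts_swap by metis
qed simp

lemma branch_exchanges_gmap:
  assumes "branch_exchange\<^sup>*\<^sup>* G H" "inj_on f (verts G)"
  shows "branch_exchange\<^sup>*\<^sup>* (gmap f G) (gmap f H)"
  using assms
proof (induction rule: rtranclp_induct)
  case (step H K)
  then show ?case using branch_exchange_gmap[of H K f] branch_exchanges_verts[of G H]
    by (metis rtranclp.rtrancl_into_rtrancl)
qed simp

text \<open>A swap with \<open>deg a = deg b\<close> is simulated only up to isomorphism. The
  exchanges for each new swap are carried through the isomorphism obtained so far, so that all of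
  them precede one final renaming.\<close>

lemma bswaps_branch_exchanges:
  assumes "bswaps G H" "is_tree G"
  shows "\<exists>K. branch_exchange\<^sup>*\<^sup>* G K \<and> iso K H"
  using assms
proof (induction rule: rtranclp_induct)
  case base
  have "iso G G" using base by (auto simp: iso_def tree_iff intro!: exI[of _ id] gmap_id[symmetric])
  then show ?case by blast
next
  case (step H L)
  then obtain K where K: "branch_exchange\<^sup>*\<^sup>* G K" "iso K H" by blast
  have tH: "is_tree H" using bswaps_tree step by blast
  then have sH: "simple_graph H" by (simp add: tree_iff)
  have sK: "simple_graph K" using branch_exchange_SO[OF K(1)] step.prems by (simp add: tree_iff)
  obtain x a y b where s: "can_swap H x a y b" "L = swap H x a y b" "deg H x = deg H y \<or> deg H a = deg H b"
    using step.hyps(2) unfolding bswap_def by blast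
  have "\<exists>M. branch_exchange\<^sup>*\<^sup>* H M \<and> iso M L"
    using s(3)
  proof
    assume "deg H x = deg H y"
    then have "branch_exchange H L" using swap_branch_exchange[OF tH s(1)] s(2) by simp
    moreover have "iso L L" using bswap_pres[OF step.hyps(2) sH]
      by (auto simp: iso_def intro!: exI[of _ id] gmap_id[symmetric])
    ultimately show ?thesis by blast
  qed (use swap_branch_exchanges[OF tH s(1)] s(2) in blast)
  then obtain M where M: "branch_exchange\<^sup>*\<^sup>* H M" "iso M L" by blast
  obtain f where f: "inj_on f (verts H)" "K = gmap f H" using iso_sym[OF sK K(2)] by (auto simp: iso_def)
  have "branch_exchange\<^sup>*\<^sup>* K (gmap f M)" using branch_exchanges_gmap[OF M(1) f(1)] f(2) by simp
  moreover have "iso (gmap f M) M"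
  proof (rule iso_sym)
    show "simple_graph M" using branch_exchange_SO[OF M(1) tH] by (simp add: tree_iff)
    show "iso M (gmap f M)" unfolding iso_def using branch_exchanges_verts[OF M(1)] f(1) by metis
  qed
  ultimately show ?case using K(1) M(2) iso_trans rtranclp_trans by metis
qed

section \<open>Locally optimal trees\<close>

text \<open>The vertex of the one-vertex tree has degree 0 and counts as inner, in accordance with
  its reduced sequence \<open>[0]\<close>.\<close>

definition inner :: "'a graph \<Rightarrow> 'a set" where
  "inner G = {v \<in> verts G. deg G v \<noteq> 1}"

text \<open>For an inner vertex \<open>z\<close> of a tree: \<open>z\<close> has degree at most 1 in
  the subtree induced by the inner vertices.\<close>

definition pendant :: "'a graph \<Rightarrow> 'a \<Rightarrow> bool" where
  "pendant G z \<longleftrightarrow> card (nbrs G z \<inter> inner G) \<le> 1"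

lemma inner_bswaps: "bswaps G H \<Longrightarrow> simple_graph G \<Longrightarrow> inner H = inner G"
  by (simp add: inner_def bswaps_pres)

lemma inner_swap: "simple_graph G \<Longrightarrow> can_swap G x a y b \<Longrightarrow> inner (swap G x a y b) = inner G"
  by (simp add: inner_def deg_swap)

lemma bswaps_class_opt: "class_opt G \<Longrightarrow> bswaps G H \<Longrightarrow> class_opt H"
  unfolding class_opt_def by (meson rtranclp_trans)

lemma class_opt_local_opt: "class_opt G \<Longrightarrow> local_opt G"
  unfolding class_opt_def by blast

lemma deg_pos_if_edge: "simple_graph G \<Longrightarrow> {u, v} \<in> edges G \<Longrightarrow> 1 \<le> deg G u"
  by (auto simp: deg_def Suc_le_eq card_gt_0_iff)

lemma inner_deg_ge_2: "simple_graph G \<Longrightarrow> {u, v} \<in> edges G \<Longrightarrow> u \<in> inner G \<Longrightarrow> 2 \<le> deg G u"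
  using deg_pos_if_edge[of G u v] by (auto simp: inner_def)

lemma leaf_not_on_path:
  assumes "simple_graph G" "path (edges G) q" "deg G l = 1" "l \<noteq> hd q" "l \<noteq> last q"
  shows "l \<notin> set q"
proof
  assume "l \<in> set q"
  then obtain i where i: "i < length q" "l = q ! i" by (auto simp: in_set_conv_nth)
  have "q \<noteq> []" using assms(2) by (simp add: path_def)
  then have "i \<noteq> 0" "i \<noteq> length q - 1" using assms(4,5) i hd_conv_nth last_conv_nth by metis+
  moreover from this have "Suc i < length q" using i(1) by linarith
  ultimately show False using path_interior_deg[OF assms(1,2), of i] i assms(3) by auto
qed

lemma nbr_on_path:
  assumes "forest (edges G)" "path (edges G) q" "b \<in> set q" "{hd q, b} \<in> edges G" "simple_graph G"
  shows "b = q ! 1"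
proof -
  obtain i where i: "i < length q" "b = q ! i" using assms(3) by (auto simp: in_set_conv_nth)
  have q: "hd q = q ! 0" using assms(2) by (simp add: path_def hd_conv_nth)
  then have "i \<noteq> 0" using i assms(4) edge_verts[OF assms(5), of "hd q" b] by metis
  then show ?thesis using path_chord_less[OF assms(1,2), of 0 i] i assms(4) q by auto
qed

text \<open>The standard move of the extremal arguments: the vertex \<open>hd q\<close> is detached
  from its neighbour on the path and hung on \<open>last q\<close>, while \<open>b\<close> goes the
  other way. Length 3 ensures that this neighbour is not \<open>last q\<close>.\<close>

lemma path_can_swap:
  assumes T: "is_tree G" and q: "path (edges G) q" "3 \<le> length q"
    and b: "{last q, b} \<in> edges G" "b \<notin> set q"
  shows "can_swap G (q ! 1) (hd q) (last q) b" "2 \<le> deg G (q ! 1)" "q ! 1 \<in> set q"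
proof -
  have G: "simple_graph G" using T by (simp add: tree_iff)
  obtain a p q' where e: "q = a # p # q'" "q' \<noteq> []"
    using q(2) by (cases q; cases "tl q"; cases "tl (tl q)") auto
  have d: "distinct q" using q(1) by (simp add: path_def)
  have "path (edges G) (p # q')" using q(1) by (auto simp: path_def e)
  then have "(p, last q) \<in> conn (edges G - {{p, a}, {last q, b}})"
    using d b(2) e by (intro path_conn_avoid[of _ "p # q'"]) auto
  moreover have "{p, a} \<in> edges G" using path_nth[OF q(1), of 0] e by (simp add: insert_commute)
  moreover have "p \<noteq> last q" using d e by auto
  ultimately show "can_swap G (q ! 1) (hd q) (last q) b" using b(1) T e(1) by (auto intro!: tree_can_swap)
  show "2 \<le> deg G (q ! 1)" using path_interior_deg[OF G q(1), of 1] q(2) by simp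
  show "q ! 1 \<in> set q" using q(2) by simp
qed

lemma path_length_3:
  assumes "path E q" "hd q \<noteq> last q" "{hd q, last q} \<notin> E"
  shows "3 \<le> length q"
  using assms by (cases q; cases "tl q"; cases "tl (tl q)") (auto simp: path_def)

lemma path_verts:
  assumes "simple_graph G" "path (edges G) q" "hd q \<in> verts G"
  shows "set q \<subseteq> verts G"
proof
  fix v assume "v \<in> set q"
  then obtain i where i: "i < length q" "v = q ! i" by (auto simp: in_set_conv_nth)
  show "v \<in> verts G"
  proof (cases i)
    case 0
    then show ?thesis using i assms by (simp add: hd_conv_nth path_def)
  next
    case (Suc j)
    then show ?thesis using path_nth[OF assms(2), of j] i edge_verts[OF assms(1)] by blast
  qed
qed

lemma path_internal:
  assumes G: "simple_graph G" and q: "path (edges G) q" "last q \<in> inner G" and i: "0 < i" "i < length q"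
  shows "q ! i \<in> inner G"
proof (cases "Suc i < length q")
  case True
  then have "2 \<le> deg G (q ! i)" using path_interior_deg[OF G q(1) i(1)] by simp
  then show ?thesis using edge_verts[OF G path_nth[OF q(1) True]] by (simp add: inner_def)
next
  case False
  then have "i = length q - 1" using i by linarith
  then show ?thesis using q by (simp add: path_def last_conv_nth)
qed

text \<open>All vertices of such a path are inner, so the second one has two inner neighbours,
  before and after it on the path.\<close>

lemma pseudo_leaf_not_inner:
  assumes G: "simple_graph G"
    and q: "path (edges G) q" "hd q \<in> inner G" "last q \<in> inner G" "3 \<le> length q"
  shows "\<not> pendant G (q ! 1)"
proof
  assume e: "pendant G (q ! 1)"
  have q0: "hd q = q ! 0" using q(1) by (simp add: path_def hd_conv_nth)
  have "{q ! 1, q ! 0} \<in> edges G" "{q ! 1, q ! 2} \<in> edges G"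
    using path_nth[OF q(1), of 0] path_nth[OF q(1), of 1] q(4) by (auto simp: insert_commute numeral_2_eq_2)
  then have "{q ! 0, q ! 2} \<subseteq> nbrs G (q ! 1) \<inter> inner G"
    using path_internal[OF G q(1,3), of 2] q(2,4) q0 by auto
  then have "card {q ! 0, q ! 2} \<le> card (nbrs G (q ! 1) \<inter> inner G)" using G
    by (intro card_mono) auto
  moreover have "q ! 0 \<noteq> q ! 2"
    using q(1,4) nth_eq_iff_index_eq[of q 0 2] by (simp add: path_def)
  ultimately show False using e by (simp add: pendant_def)
qed

lemma exists_other:
  assumes "\<not> card A \<le> 1" obtains w where "w \<in> A" "w \<noteq> u"
proof -
  have "\<not> A \<subseteq> {u}" using assms card_mono[of "{u}" A] by auto
  then show thesis using that by blast
qed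

lemma ex_max_nat:
  fixes f :: "'b \<Rightarrow> nat"
  assumes "P k" "\<forall>y. P y \<longrightarrow> f y \<le> N"
  shows "\<exists>x. P x \<and> (\<forall>y. P y \<longrightarrow> f y \<le> f x)"
  using ex_has_greatest_nat[of P k f "Suc N"] assms by (simp add: less_Suc_eq_le)

text \<open>The vertex \<open>z\<close> has a leaf \<open>l\<close>, and \<open>b\<close> has an
  inner neighbour \<open>a\<close> off the path to \<open>z\<close>. If \<open>b\<close> had larger
  degree than \<open>z\<close>, local optimality for the edges \<open>ba\<close> and
  \<open>zl\<close> would force \<open>a\<close> to have degree at most 1.\<close>

lemma deg_le_pendant:
  assumes T: "is_tree G" and local_opt: "local_opt G" and z: "z \<in> inner G" "pendant G z"
    and b: "b \<in> inner G" "\<not> pendant G b"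
  shows "deg G b \<le> deg G z"
proof (rule ccontr)
  assume lt: "\<not> deg G b \<le> deg G z"
  have G: "simple_graph G" and F: "forest (edges G)" using T by (auto simp: tree_iff)
  have ne: "b \<noteq> z" using z b by auto
  have bz: "b \<in> verts G" "z \<in> verts G" using b z by (auto simp: inner_def)
  obtain q where q: "path (edges G) q" "hd q = b" "last q = z" using tree_path[OF T bz] .
  obtain a where a: "a \<in> nbrs G b \<inter> inner G" "a \<noteq> q ! 1"
    using exists_other[of "nbrs G b \<inter> inner G"] b(2) unfolding pendant_def .
  have aq: "a \<notin> set q" using nbr_on_path[OF F q(1) _ _ G, of a] a q(2) by auto
  have "deg G z \<ge> 2" using tree_deg_pos[OF T bz(2,1)] ne z(1) by (auto simp: inner_def)
  then have "\<not> nbrs G z \<subseteq> nbrs G z \<inter> inner G"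
    using z(2) card_mono[of "nbrs G z \<inter> inner G" "nbrs G z"] G by (auto simp: pendant_def deg_def)
  then obtain l where "l \<in> nbrs G z" and l': "l \<notin> inner G" by blast
  then have l: "{z, l} \<in> edges G" "l \<notin> inner G" by auto
  then have dl: "deg G l = 1" using edge_verts[OF G l(1)] by (auto simp: inner_def)
  have lq: "l \<notin> set q" using l b z q by (intro leaf_not_on_path[OF G q(1) dl]) auto
  have "can_swap G b a z l" using path_conn_avoid[OF q(1) aq lq q(2,3)] a l ne
    by (intro tree_can_swap T) auto
  then have "deg G a \<le> 1" using local_opt lt dl unfolding local_opt_def by fastforce
  moreover have "2 \<le> deg G a" using a
    by (intro inner_deg_ge_2[OF G, of a b]) (auto simp: insert_commute)
  ultimately show False by simp
qed

text \<open>A longest path of inner vertices that starts with \<open>r, v\<close> can only stop at a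
  pendant vertex; it does not stop at \<open>v\<close>.\<close>

lemma exists_pendant_beyond:
  assumes T: "is_tree G"
    and rv: "{r, v} \<in> edges G" "r \<in> inner G" "v \<in> inner G" "\<not> pendant G v"
  shows "\<exists>q. path (edges G) q \<and> hd q = r \<and> q ! 1 = v \<and> 3 \<le> length q \<and> last q \<in> inner G \<and> pendant G (last q)"
proof -
  have G: "simple_graph G" and F: "forest (edges G)" using T by (auto simp: tree_iff)
  define P where "P q \<longleftrightarrow> path (edges G) q \<and> hd q = r \<and> q ! 1 = v \<and> 2 \<le> length q \<and> set q \<subseteq> inner G" for q
  have "r \<noteq> v" using edge_verts[OF G rv(1)] by auto
  then have P0: "P [r, v]" using rv by (simp add: P_def path_def)
  have bound: "length q \<le> card (verts G)" if "P q" for q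
  proof -
    have "length q = card (set q)" using that by (simp add: P_def path_def distinct_card)
    also have "\<dots> \<le> card (verts G)" using that G
      by (intro card_mono) (auto simp: P_def inner_def simple_graph_def)
    finally show ?thesis .
  qed
  from bound have "\<forall>q. P q \<longrightarrow> length q \<le> card (verts G)" by blast
  from ex_max_nat[of P, OF P0 this]
  obtain q where q: "P q" and mx: "\<And>q'. P q' \<Longrightarrow> length q' \<le> length q"
    by blast
  have p: "path (edges G) q" "q \<noteq> []" "2 \<le> length q" "set q \<subseteq> inner G" "hd q = r" "q ! 1 = v"
    using q by (auto simp: P_def path_def)
  have "pendant G (last q)"
  proof (rule ccontr)
    assume "\<not> pendant G (last q)"
    then obtain w where w: "w \<in> nbrs G (last q) \<inter> inner G" "w \<noteq> rev q ! 1"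
      using exists_other unfolding pendant_def by metis
    have "w \<notin> set q"
      using nbr_on_path[OF F path_rev[OF p(1)] _ _ G, of w] w p(2) by (auto simp: hd_rev)
    then have "path (edges G) (q @ [w])"
      using p(1) w by (simp add: path_def successively_append_iff)
    moreover have "(q @ [w]) ! 1 = q ! 1" using p(3) by (simp add: nth_append)
    ultimately have "P (q @ [w])" using p w by (simp add: P_def)
    then show False using mx[of "q @ [w]"] by simp
  qed
  moreover have "3 \<le> length q"
  proof (rule ccontr)
    assume "\<not> 3 \<le> length q"
    then have "length q - 1 = 1" using p(3) by linarith
    then have "last q = q ! 1" using p(2) by (simp add: last_conv_nth)
    then show False using calculation p(6) rv(4) by simp
  qed
  ultimately show ?thesis using p last_in_set[OF p(2)] by blast
qed

text \<open>Among all trees in the class and all \<open>c\<close> of degree \<delta>, maximize the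
  number of inner neighbours of \<open>c\<close>. If an inner vertex \<open>a\<close> is not
  adjacent to \<open>c\<close>, then \<open>c\<close> has a leaf. Local optimality forces the
  neighbour of \<open>a\<close> towards \<open>c\<close> to have degree \<delta> as well, and
  swapping \<open>a\<close> with this leaf contradicts maximality.\<close>

lemma star_like_exists:
  assumes T: "is_tree T" and L: "class_opt T"
    and min: "\<And>u. u \<in> inner T \<Longrightarrow> \<delta> \<le> deg T u"
    and c0: "c0 \<in> inner T" "deg T c0 = \<delta>" and small: "card (inner T) \<le> \<delta> + 1"
  shows "\<exists>G c. bswaps T G \<and> c \<in> inner G \<and> deg G c = \<delta> \<and> inner G - {c} \<subseteq> nbrs G c"
proof -
  have sT: "simple_graph T" using T by (simp add: tree_iff)
  define P where "P = (\<lambda>(G, c). bswaps T G \<and> c \<in> inner G \<and> deg G c = \<delta>)"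
  define f where "f = (\<lambda>(G :: 'a graph, c). card (nbrs G c \<inter> inner G))"
  have P0: "P (T, c0)" using c0 by (simp add: P_def)
  have bound: "f y \<le> card (verts T)" if "P y" for y
  proof -
    obtain G c where y: "y = (G, c)" by (metis surj_pair)
    then have step: "bswaps T G" using that by (simp add: P_def)
    have "nbrs G c \<inter> inner G \<subseteq> verts T" using inner_bswaps[OF step sT]
      by (auto simp: inner_def)
    then show ?thesis using y sT by (auto simp: f_def simple_graph_def intro: card_mono)
  qed
  from bound have "\<exists>N. \<forall>y. P y \<longrightarrow> f y \<le> N" by blast
  then obtain N where "\<forall>y. P y \<longrightarrow> f y \<le> N" ..
  from ex_max_nat[of P, OF P0 this]
  obtain y where y: "P y" and mx: "\<And>y'. P y' \<Longrightarrow> f y' \<le> f y"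
    by blast
  obtain G c where Gc: "y = (G, c)" by fastforce
  have XG: "bswaps T G" and c: "c \<in> inner G" "deg G c = \<delta>" using y by (auto simp: P_def Gc)
  have TG: "is_tree G" using bswaps_tree[OF XG T] .
  then have G: "simple_graph G" by (simp add: tree_iff)
  have LG: "local_opt G" using class_opt_local_opt[OF bswaps_class_opt[OF L XG]] .
  have dG: "deg G = deg T" and iG: "inner G = inner T"
    using bswaps_pres[OF XG sT] inner_bswaps[OF XG sT] by auto
  have "inner G - {c} \<subseteq> nbrs G c"
  proof (rule ccontr)
    assume "\<not> ?thesis"
    then obtain a where "a \<in> inner G - {c}" "a \<notin> nbrs G c" by blast
    then have a: "a \<in> inner G" "a \<noteq> c" "{c, a} \<notin> edges G" by auto
    have fin: "finite (inner G)" using G by (simp add: inner_def simple_graph_def)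
    \<comment> \<open>At most \<open>\<delta> - 1\<close> inner vertices remain besides
      \<open>a\<close> and \<open>c\<close>, fewer than \<open>c\<close> has neighbours; so some
      neighbour of \<open>c\<close> is a leaf.\<close>
    have "card (nbrs G c \<inter> inner G) \<le> card (inner G - {a, c})"
      using a edge_verts[OF G, of c c] fin by (intro card_mono) auto
    also have "\<dots> < card (nbrs G c)"
    proof -
      have "card {a, c} \<le> card (inner G)" using a c fin by (intro card_mono) auto
      moreover have "card (inner G - {a, c}) = card (inner G) - card {a, c}"
        using a c fin by (intro card_Diff_subset) auto
      moreover have "card {a, c} = 2" using a by simp
      ultimately show ?thesis using small[folded iG] c(2) unfolding deg_def by linarith
    qed
    finally have "\<not> nbrs G c \<subseteq> nbrs G c \<inter> inner G"
      by (metis inf.absorb_iff1 inf.left_idem less_irrefl)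
    then obtain l where "l \<in> nbrs G c" and l': "l \<notin> inner G" by blast
    then have l: "{c, l} \<in> edges G" "l \<notin> inner G" by auto
    then have dl: "deg G l = 1" using edge_verts[OF G l(1)] by (auto simp: inner_def)
    have ac: "a \<in> verts G" "c \<in> verts G" using a c by (auto simp: inner_def)
    obtain q where q: "path (edges G) q" "hd q = a" "last q = c" using tree_path[OF TG ac] .
    have lq: "l \<notin> set q" using a c l q by (intro leaf_not_on_path[OF G q(1) dl]) auto
    have len: "3 \<le> length q" using path_length_3[OF q(1)] q a by (auto simp: insert_commute)
    let ?p = "q ! 1"
    have s: "can_swap G ?p a c l" and dp: "2 \<le> deg G ?p" and pq: "?p \<in> set q"
      using path_can_swap[OF TG q(1) len, of l] q l lq by auto
    have "?p \<in> inner G" using dp pq path_verts[OF G q(1)] q ac by (auto simp: inner_def)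
    then have pd: "\<delta> \<le> deg G ?p" using min iG dG by simp
    have "{a, ?p} \<in> edges G" using s by (simp add: can_swap_def insert_commute)
    then have da: "2 \<le> deg G a" using inner_deg_ge_2[OF G _ a(1)] by blast
    have eq: "deg G ?p = deg G c"
    proof (rule ccontr)
      assume "deg G ?p \<noteq> deg G c"
      then have "deg G a \<le> deg G l" using LG s pd c unfolding local_opt_def by auto
      then show False using da dl by simp
    qed
    let ?H = "swap G ?p a c l"
    have "bswap G ?H" using bswapI1[OF s eq dp] .
    then have "P (?H, c)" using XG c inner_swap[OF G s] deg_swap[OF G s] by (auto simp: P_def)
    from mx[OF this] have "card (nbrs ?H c \<inter> inner G) \<le> card (nbrs G c \<inter> inner G)"
      using inner_swap[OF G s] by (simp add: f_def Gc)
    moreover have "nbrs ?H c \<inter> inner G = insert a (nbrs G c \<inter> inner G)"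
      unfolding nbrs_swap(3)[OF G s] using a l by auto
    ultimately show False using a fin by simp
  qed
  then show ?thesis using XG c by blast
qed

section \<open>A copy of the rooted tree R at the end of some tree in the class\<close>

definition branch_root :: "nat \<Rightarrow> 'a graph \<Rightarrow> 'a \<Rightarrow> 'a \<Rightarrow> bool" where
  "branch_root \<delta> G r v \<longleftrightarrow> r \<in> inner G \<and> deg G r = \<delta> \<and> {r, v} \<in> edges G \<and> v \<in> inner G"

text \<open>Here \<open>r\<close>, its neighbours other than \<open>v\<close> and their leaves form a copy of the rooted tree
  \<open>R\<close> that is glued to \<open>M'\<close> in the construction of \<open>M\<close>.\<close>

definition end_branch :: "nat \<Rightarrow> 'a graph \<Rightarrow> 'a \<Rightarrow> 'a \<Rightarrow> bool" where
  "end_branch \<delta> G r v \<longleftrightarrow> branch_root \<delta> G r v \<and>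
     (\<forall>b\<in>nbrs G r - {v}. b \<in> inner G \<and> pendant G b \<and> (\<forall>u\<in>verts G - (nbrs G r - {v}). deg G u \<le> deg G b))"


text \<open>\<open>S1\<close> collects vertices of large degree around \<open>r\<close>. Since a
  pendant vertex may have the same degree as one that is not pendant, \<open>S1\<close> alone does
  not make the neighbours pendant; \<open>S2\<close> breaks these ties.\<close>

lemma end_branch_exists:
  assumes T: "is_tree T" and L: "class_opt T"
    and min: "\<And>u. u \<in> inner T \<Longrightarrow> \<delta> \<le> deg T u"
    and c0: "c0 \<in> inner T" "deg T c0 = \<delta>" and large: "\<delta> + 2 \<le> card (inner T)"
  shows "\<exists>G r v. bswaps T G \<and> end_branch \<delta> G r v"
proof -
  have sT: "simple_graph T" using T by (simp add: tree_iff)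
  define P where "P = (\<lambda>(G, r, v). bswaps T G \<and> branch_root \<delta> G r v)"
  define S1 where "S1 = (\<lambda>(G :: 'a graph, r, v). \<Sum>b\<in>nbrs G r - {v}. deg G b)"
  define S2 where "S2 = (\<lambda>(G :: 'a graph, r, v). card {b \<in> nbrs G r - {v}. pendant G b})"
  define n where "n = card (verts T)"
  have finT: "finite (verts T)" using sT by (simp add: simple_graph_def)
  have S1_le: "S1 y \<le> sum (deg T) (verts T)" and S2_le: "S2 y \<le> n" if "P y" for y
  proof -
    obtain G r v where y: "y = (G, r, v)" by (metis surj_pair)
    then have step: "bswaps T G" using that by (simp add: P_def)
    have dG: "deg G = deg T" and sub: "nbrs G r \<subseteq> verts T"
      using bswaps_pres[OF step sT] nbrs_verts[of G r] by auto
    show "S1 y \<le> sum (deg T) (verts T)" unfolding S1_def y dG prod.case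
      using sub finT by (intro sum_mono2) auto
    show "S2 y \<le> n" unfolding S2_def y n_def prod.case
      using sub finT by (intro card_mono) auto
  qed
  \<comment> \<open>Since \<open>S2 \<le> n\<close>, maximal \<open>f\<close> means lexicographically maximal \<open>(S1, S2)\<close>.\<close>
  define f where "f y = S1 y * (n + 1) + S2 y" for y
  have "\<exists>v. branch_root \<delta> T c0 v"
  proof -
    have "\<not> card (inner T) \<le> 1" using large by simp
    then obtain u where u: "u \<in> inner T" "u \<noteq> c0" using exists_other by metis
    have vs: "c0 \<in> verts T" "u \<in> verts T" using u c0 by (auto simp: inner_def)
    obtain q where q: "path (edges T) q" "hd q = c0" "last q = u" using tree_path[OF T vs] .
    then obtain v q' where e: "q = c0 # v # q'" using u(2)
      by (cases q; cases "tl q") (auto simp: path_def)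
    have e': "{c0, v} \<in> edges T" using path_nth[OF q(1), of 0] e by simp
    have "v \<in> inner T" using path_internal[OF sT q(1), of 1] q(3) u(1) e by simp
    then show ?thesis using c0 e' unfolding branch_root_def by blast
  qed
  then obtain v0 where "branch_root \<delta> T c0 v0" ..
  then have P0: "P (T, c0, v0)" by (simp add: P_def)
  have bound: "f y \<le> sum (deg T) (verts T) * (n + 1) + n" if "P y" for y
    unfolding f_def using S1_le[OF that] S2_le[OF that] by (intro add_mono mult_le_mono1)
  from bound have "\<exists>N. \<forall>y. P y \<longrightarrow> f y \<le> N" by blast
  then obtain N where "\<forall>y. P y \<longrightarrow> f y \<le> N" ..
  from ex_max_nat[of P, OF P0 this]
  obtain y where y: "P y" and mx: "\<And>y'. P y' \<Longrightarrow> f y' \<le> f y"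
    by blast
  have mx1: "S1 y' \<le> S1 y" if "P y'" for y'
  proof (rule ccontr)
    assume "\<not> S1 y' \<le> S1 y"
    then have "Suc (S1 y) * (n + 1) \<le> S1 y' * (n + 1)" by (intro mult_le_mono1) simp
    then have "f y < f y'" using S2_le[OF y] by (simp add: f_def)
    then show False using mx[OF that] by simp
  qed
  have mx2: "S2 y' \<le> S2 y" if "P y'" "S1 y \<le> S1 y'" for y'
    using mx[OF that(1)] mx1[OF that(1)] that(2) by (simp add: f_def)
  obtain G r v where yG: "y = (G, r, v)" by (metis surj_pair)
  have XG: "bswaps T G" and branch_root: "branch_root \<delta> G r v" using y by (auto simp: P_def yG)
  have r: "r \<in> inner G" "deg G r = \<delta>" and rv: "{r, v} \<in> edges G" and v: "v \<in> inner G"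
    using branch_root by (auto simp: branch_root_def)
  have TG: "is_tree G" using bswaps_tree[OF XG T] .
  then have G: "simple_graph G" and F: "forest (edges G)" by (auto simp: tree_iff)
  have LG: "local_opt G" using class_opt_local_opt[OF bswaps_class_opt[OF L XG]] .
  have dG: "deg G = deg T" and iG: "inner G = inner T"
    using bswaps_pres[OF XG sT] inner_bswaps[OF XG sT] by auto
  have fin: "finite (verts G)" "finite (nbrs G r)" using G by (auto simp: simple_graph_def)
  have rV: "r \<in> verts G" using r by (simp add: inner_def)
  have d2: "2 \<le> \<delta>" using inner_deg_ge_2[OF G rv r(1)] r(2) by simp
  have i2: "2 \<le> deg G u" if "u \<in> inner G" for u using min[of u] that d2 iG dG by simp
  let ?E = "{u \<in> nbrs G r - {v}. pendant G u}"
  have rnr: "r \<notin> nbrs G r" using no_loop[OF G] by auto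

  \<comment> \<open>Otherwise \<open>a\<close> could be hung on \<open>r\<close> in place of
    \<open>b\<close>, which increases \<open>S1\<close>. This swap stays in the class when the
    neighbour of \<open>a\<close> towards \<open>r\<close> has degree \<delta>; if its degree is
    larger, local optimality already gives the inequality.\<close>
  have star: "deg G a \<le> deg G b"
    if q: "path (edges G) q" "hd q = a" "last q = r"
    and a: "a \<noteq> r" "a \<notin> nbrs G r" "a \<in> verts G"
      and b: "b \<in> nbrs G r - {v}" "b \<notin> set q" for a b q
  proof (rule ccontr)
    assume lt: "\<not> deg G a \<le> deg G b"
    have len: "3 \<le> length q" using path_length_3[OF q(1)] q a by (auto simp: insert_commute)
    let ?p = "q ! 1"
    have s: "can_swap G ?p a r b" and dp: "2 \<le> deg G ?p" and pq: "?p \<in> set q"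
      using path_can_swap[OF TG q(1) len, of b] q b by auto
    have "?p \<in> inner G" using dp pq path_verts[OF G q(1)] q a by (auto simp: inner_def)
    then have pd: "\<delta> \<le> deg G ?p" using min iG dG by simp
    have eq: "deg G ?p = deg G r"
    proof (rule ccontr)
      assume "deg G ?p \<noteq> deg G r"
      then show False using LG s pd r lt unfolding local_opt_def by auto
    qed
    let ?H = "swap G ?p a r b"
    have "bswap G ?H" using bswapI1[OF s eq dp] .
    moreover have nr: "nbrs ?H r = nbrs G r - {b} \<union> {a}" using nbrs_swap(3)[OF G s] .
    moreover have "v \<in> nbrs ?H r" using nr rv b by auto
    ultimately have "P (?H, r, v)"
      using XG r v inner_swap[OF G s] deg_swap[OF G s] by (auto simp: P_def branch_root_def)
    from mx1[OF this] have le: "(\<Sum>u\<in>nbrs ?H r - {v}. deg G u) \<le> (\<Sum>u\<in>nbrs G r - {v}. deg G u)"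
      using deg_swap[OF G s] by (simp add: S1_def yG)
    have "a \<noteq> v" using a(2) rv by auto
    then have "nbrs ?H r - {v} = insert a (nbrs G r - {v} - {b})" unfolding nr using b by auto
    then have "(\<Sum>u\<in>nbrs ?H r - {v}. deg G u) = deg G a + (\<Sum>u\<in>nbrs G r - {v} - {b}. deg G u)"
      using a(2) fin by simp
    moreover have "(\<Sum>u\<in>nbrs G r - {v}. deg G u) = deg G b + (\<Sum>u\<in>nbrs G r - {v} - {b}. deg G u)"
      using b fin by (intro sum.remove) auto
    ultimately show False using le lt by simp
  qed

  \<comment> \<open>If \<open>b\<close> were a leaf, the comparison above would force all inner
    vertices other than \<open>r\<close> to be neighbours of \<open>r\<close>, which is too few of
    them.\<close>
  have b_int: "b \<in> inner G" if b: "b \<in> nbrs G r - {v}" for b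
  proof (rule ccontr)
    assume nb: "b \<notin> inner G"
    have bV: "b \<in> verts G" using b edge_verts[OF G, of r b] by auto
    then have db: "deg G b = 1" using nb by (simp add: inner_def)
    have "inner G \<subseteq> insert r (nbrs G r - {b})"
    proof
      fix a assume a: "a \<in> inner G"
      show "a \<in> insert r (nbrs G r - {b})"
      proof (rule ccontr)
        assume "a \<notin> insert r (nbrs G r - {b})"
        then have an: "a \<noteq> r" "a \<notin> nbrs G r" using a nb by auto
        have aV: "a \<in> verts G" using a by (simp add: inner_def)
        obtain q where q: "path (edges G) q" "hd q = a" "last q = r" using tree_path[OF TG aV rV] .
        have "b \<notin> set q" using a nb r q by (intro leaf_not_on_path[OF G q(1) db]) auto
        from star[OF q an aV b this] show False using i2[OF a] db by simp
      qed
    qed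
    then have "card (inner G) \<le> card (insert r (nbrs G r - {b}))" using fin by (intro card_mono) auto
    also have "\<dots> \<le> Suc (card (nbrs G r - {b}))" by (rule card_insert_le_m1) auto
    also have "\<dots> \<le> Suc \<delta>" using r(2) card_Diff1_le[of "nbrs G r" b] by (simp add: deg_def)
    finally show False using large iG by simp
  qed

  have b_end: "pendant G b" if b: "b \<in> nbrs G r - {v}" for b
  proof (rule ccontr)
    assume nb: "\<not> pendant G b"
    show False
    proof (cases "pendant G v")
      \<comment> \<open>Interchanging the roles of \<open>v\<close> and \<open>b\<close> leaves the
        tree unchanged: \<open>S1\<close> does not decrease because
        \<open>deg G b \<le> deg G v\<close>, and the pendant vertex \<open>v\<close> now counts in
        \<open>S2\<close>.\<close>
      case True
      have "P (G, r, b)" using XG r b b_int[OF b] by (auto simp: P_def branch_root_def)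
      moreover have "nbrs G r - {b} = insert v (nbrs G r - {v} - {b})" using b rv by auto
      moreover have "nbrs G r - {v} = insert b (nbrs G r - {v} - {b})" using b by auto
      then have sv: "(\<Sum>u\<in>nbrs G r - {v}. deg G u) = deg G b + (\<Sum>u\<in>nbrs G r - {v} - {b}. deg G u)"
        using fin b by (intro sum.remove) auto
      ultimately have "S1 (G, r, b) = deg G v + (\<Sum>u\<in>nbrs G r - {v} - {b}. deg G u)"
        using fin by (simp add: S1_def)
      moreover have "deg G b \<le> deg G v" by (rule deg_le_pendant[OF TG LG v True b_int[OF b] nb])
      ultimately have "S1 y \<le> S1 (G, r, b)" using sv by (simp add: S1_def yG)
      from mx2[OF \<open>P (G, r, b)\<close> this]
      have "card {u \<in> nbrs G r - {b}. pendant G u} \<le> card ?E"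
        by (simp add: S2_def yG)
      moreover have "{u \<in> nbrs G r - {b}. pendant G u} = insert v ?E"
        using nb rv True b by auto
      moreover have "finite ?E" by (rule finite_subset[OF _ fin(2)]) auto
      moreover from this have "card (insert v ?E) = Suc (card ?E)"
        by (rule card_insert_disjoint) blast
      ultimately show False by simp
    next
      case False
      \<comment> \<open>A pendant vertex \<open>z\<close> beyond \<open>v\<close> has the same
        degree as \<open>b\<close>: one inequality comes from \<open>star\<close>, the other from
        \<open>deg_le_pendant\<close>. Hanging \<open>z\<close> on \<open>r\<close> in place of
        \<open>b\<close> keeps \<open>S1\<close> and increases \<open>S2\<close>; this is the swap
        that needs equal degrees of the moved ends.\<close>
      obtain q where q: "path (edges G) q" "hd q = r" "q ! 1 = v" "3 \<le> length q" "last q \<in> inner G" "pendant G (last q)"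
        using exists_pendant_beyond[OF TG rv r(1) v False] by blast
      define z where "z = last q"
      have z: "z \<in> inner G" "pendant G z" using q by (auto simp: z_def)
      have qne: "q \<noteq> []" using q by (simp add: path_def)
      have onpath: "u = v" if "u \<in> set q" "{r, u} \<in> edges G" for u
        using nbr_on_path[OF F q(1) that(1) _ G] q(2,3) that(2) by simp
      have bq: "b \<notin> set q" using onpath b by auto
      have zq: "z \<in> set q" using qne by (simp add: z_def)
      have d: "distinct q" using q(1) by (simp add: path_def)
      have "z = q ! (length q - 1)" "r = q ! 0" using qne q(2)
        by (auto simp: z_def last_conv_nth hd_conv_nth)
      then have zr: "z \<noteq> r" "z \<noteq> v"
        using nth_eq_iff_index_eq[OF d, of "length q - 1" 0] nth_eq_iff_index_eq[OF d, of "length q - 1" 1]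
          q(3,4) qne by auto
      have zn: "z \<notin> nbrs G r" using onpath[OF zq] zr by auto
      have zV: "z \<in> verts G" using z by (simp add: inner_def)
      have rq: "path (edges G) (rev q)" "hd (rev q) = z" "last (rev q) = r"
        using path_rev[OF q(1)] qne q(2) by (auto simp: hd_rev last_rev z_def)
      have "deg G z \<le> deg G b" using star[OF rq zr(1) zn zV b] bq by simp
      moreover have "deg G b \<le> deg G z" by (rule deg_le_pendant[OF TG LG z b_int[OF b] nb])
      ultimately have zb: "deg G z = deg G b" by simp
      let ?p = "rev q ! 1"
      have s: "can_swap G ?p z r b" and dp: "2 \<le> deg G ?p" and pq: "?p \<in> set q"
        using path_can_swap[OF TG rq(1), of b] rq b bq q(4) by auto
      have pint: "?p \<in> inner G" using dp pq path_verts[OF G q(1)] q(2) rV by (auto simp: inner_def)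
      let ?H = "swap G ?p z r b"
      note ds = can_swap_distinct[OF G s]
      have iH: "inner ?H = inner G" using inner_swap[OF G s] .
      have "bswap G ?H" using bswapI2[OF s zb] i2[OF z(1)] by simp
      moreover have nr: "nbrs ?H r = nbrs G r - {b} \<union> {z}" using nbrs_swap(3)[OF G s] .
      moreover have "v \<in> nbrs ?H r" using nr rv b by auto
      ultimately have PH: "P (?H, r, v)"
        using XG r v iH deg_swap[OF G s] by (auto simp: P_def branch_root_def)
      have nrv: "nbrs ?H r - {v} = insert z (nbrs G r - {v} - {b})" unfolding nr using zr by auto
      have "(\<Sum>u\<in>nbrs G r - {v}. deg G u) = deg G b + (\<Sum>u\<in>nbrs G r - {v} - {b}. deg G u)"
        using fin b by (intro sum.remove) auto
      moreover have "(\<Sum>u\<in>nbrs ?H r - {v}. deg G u) = deg G z + (\<Sum>u\<in>nbrs G r - {v} - {b}. deg G u)"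
        unfolding nrv using zn fin by simp
      ultimately have "S1 y \<le> S1 (?H, r, v)"
        using zb deg_swap[OF G s] by (simp add: S1_def yG)
      from mx2[OF PH this]
      have le: "card {u \<in> nbrs ?H r - {v}. pendant ?H u} \<le> card ?E"
        by (simp add: S2_def yG)
      have "pendant ?H z"
      proof -
        have "nbrs ?H z \<inter> inner ?H = insert r (nbrs G z \<inter> inner G - {?p})"
          unfolding nbrs_swap(2)[OF G s] iH using r(1) by auto
        moreover have "card (insert r (nbrs G z \<inter> inner G - {?p})) \<le> Suc (card (nbrs G z \<inter> inner G - {?p}))"
          by (rule card_insert_le_m1) auto
        moreover have "?p \<in> nbrs G z \<inter> inner G" using s pint
          by (auto simp: can_swap_def insert_commute)
        then have "Suc (card (nbrs G z \<inter> inner G - {?p})) = card (nbrs G z \<inter> inner G)"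
          using G by (intro card_Suc_Diff1) auto
        ultimately show ?thesis using z(2) by (simp add: pendant_def)
      qed
      moreover have "pendant ?H u" if u: "u \<in> nbrs G r - {v}" "pendant G u" for u
      proof -
        have "u \<noteq> r" "u \<noteq> z" "u \<noteq> b" "u \<noteq> ?p"
          using u rnr zn nb onpath[OF pq] by auto
        then have "nbrs ?H u = nbrs G u" using nbrs_swap(5)[OF G s, of u] by simp
        then show ?thesis using u(2) unfolding pendant_def iH by simp
      qed
      ultimately have "insert z ?E \<subseteq> {u \<in> nbrs ?H r - {v}. pendant ?H u}"
        unfolding nrv using nb by auto
      moreover have "finite {u \<in> nbrs ?H r - {v}. pendant ?H u}"
        using finite_nbrs[OF simple_graph_swap[OF G s], of r] by (rule rev_finite_subset) auto
      ultimately have "card (insert z ?E) \<le> card {u \<in> nbrs ?H r - {v}. pendant ?H u}"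
        by (rule card_mono[rotated])
      moreover have "finite ?E" by (rule finite_subset[OF _ fin(2)]) auto
      moreover from this have "card (insert z ?E) = Suc (card ?E)"
        by (rule card_insert_disjoint) (use zn in blast)
      ultimately show False using le by linarith
    qed
  qed

  \<comment> \<open>If all neighbours of \<open>r\<close> were pendant, no inner vertex could lie
    beyond them, leaving at most \<open>\<delta> + 1\<close> inner vertices.\<close>
  have v_nonend: "\<not> pendant G v"
  proof
    assume ve: "pendant G v"
    have "inner G \<subseteq> insert r (nbrs G r)"
    proof
      fix u assume u: "u \<in> inner G"
      show "u \<in> insert r (nbrs G r)"
      proof (rule ccontr)
        assume nu: "u \<notin> insert r (nbrs G r)"
        have uV: "u \<in> verts G" using u by (simp add: inner_def)
        obtain q where q: "path (edges G) q" "hd q = r" "last q = u" using tree_path[OF TG rV uV] .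
        have len: "3 \<le> length q" using path_length_3[OF q(1)] q nu by auto
        then have "{r, q ! 1} \<in> edges G" using path_nth[OF q(1), of 0] q(1,2)
          by (auto simp: path_def hd_conv_nth)
        then have "pendant G (q ! 1)" using b_end[of "q ! 1"] ve by (cases "q ! 1 = v") auto
        then show False using pseudo_leaf_not_inner[OF G q(1)] q(2,3) r(1) u len by simp
      qed
    qed
    then have "card (inner G) \<le> card (insert r (nbrs G r))" using fin by (intro card_mono) auto
    also have "\<dots> \<le> Suc \<delta>" using r(2) fin rnr by (simp add: deg_def)
    finally show False using large iG by simp
  qed

  have "deg G u \<le> deg G b" if b: "b \<in> nbrs G r - {v}" and u: "u \<in> verts G - (nbrs G r - {v})"
    for u b
  proof -
    consider "u = r" | "u = v" | "deg G u \<le> 1" | "u \<noteq> r" "u \<notin> nbrs G r" "u \<in> inner G"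
      using u by (fastforce simp: inner_def)
    then show ?thesis
    proof cases
      case 1 then show ?thesis using min[of b] b_int[OF b] iG dG r by simp
    next
      case 2 then show ?thesis using deg_le_pendant[OF TG LG b_int[OF b] b_end[OF b] v v_nonend] by simp
    next
      case 3 then show ?thesis using i2[OF b_int[OF b]] by simp
    next
      case 4
      have uV: "u \<in> verts G" using u by simp
      obtain q where q: "path (edges G) q" "hd q = r" "last q = u" using tree_path[OF TG rV uV] .
      have qne: "q \<noteq> []" using q by (simp add: path_def)
      have bq: "b \<notin> set q"
      proof
        assume bin: "b \<in> set q"
        have b1: "b = q ! 1" using nbr_on_path[OF F q(1) bin _ G] q(2) b by auto
        have len: "3 \<le> length q" using path_length_3[OF q(1)] q 4 by auto
        then show False using pseudo_leaf_not_inner[OF G q(1)] q(2,3) r(1) 4 b1 b_end[OF b] by simp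
      qed
      have rq: "path (edges G) (rev q)" "hd (rev q) = u" "last (rev q) = r"
        using path_rev[OF q(1)] qne q by (auto simp: hd_rev last_rev)
      show ?thesis using star[OF rq 4(1,2) uV b] bq by simp
    qed
  qed
  then have "end_branch \<delta> G r v" unfolding end_branch_def using branch_root b_int b_end by blast
  then show ?thesis using XG by blast
qed

section \<open>Gluing graphs at a vertex\<close>

definition glue :: "'a graph \<Rightarrow> 'a graph \<Rightarrow> 'a graph" where
  "glue G R = (verts G \<union> verts R, edges G \<union> edges R)"

lemma glue_simps [simp]: "verts (glue G R) = verts G \<union> verts R" "edges (glue G R) = edges G \<union> edges R"
  by (auto simp: glue_def)

lemma simple_glue: "simple_graph G \<Longrightarrow> simple_graph R \<Longrightarrow> simple_graph (glue G R)"
  by (auto simp: simple_graph_def)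

lemma nbrs_glue: "nbrs (glue G R) u = nbrs G u \<union> nbrs R u"
  by auto

lemma nbrs_outside: "simple_graph G \<Longrightarrow> u \<notin> verts G \<Longrightarrow> nbrs G u = {}"
  using edge_verts[of G u] by auto

lemma deg_glue_left: "simple_graph R \<Longrightarrow> u \<notin> verts R \<Longrightarrow> deg (glue G R) u = deg G u"
  unfolding deg_def nbrs_glue by (simp add: nbrs_outside)

lemma deg_glue_right: "simple_graph G \<Longrightarrow> u \<notin> verts G \<Longrightarrow> deg (glue G R) u = deg R u"
  unfolding deg_def nbrs_glue by (simp add: nbrs_outside)

text \<open>\<open>R\<close> shares only one vertex with \<open>G\<close>, so it contains no edge
  between two vertices of \<open>G\<close>.\<close>

lemma swap_glue:
  assumes G: "simple_graph G" "simple_graph R" "verts G \<inter> verts R = {r}" and s: "can_swap G x a y b"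
  shows "can_swap (glue G R) x a y b" "swap (glue G R) x a y b = glue (swap G x a y b) R"
proof -
  note d = can_swap_distinct[OF G(1) s]
  have n: "{u, v} \<notin> edges R" if "u \<in> verts G" "v \<in> verts G" for u v
  proof
    assume e: "{u, v} \<in> edges R"
    then have "u \<in> verts G \<inter> verts R" "v \<in> verts G \<inter> verts R"
      using edge_verts[OF G(2) e] that by auto
    then show False using edge_verts[OF G(2) e] unfolding G(3) by simp
  qed
  have "(x, y) \<in> conn (edges (glue G R) - {{x, a}, {y, b}})"
    using s unfolding can_swap_def by (auto elim: conn_mono)
  then show "can_swap (glue G R) x a y b" using s n d unfolding can_swap_def by simp
  have "edges R - {{x, a}, {y, b}} = edges R" using n d by auto
  then show "swap (glue G R) x a y b = glue (swap G x a y b) R"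
    by (simp add: swap_def glue_def Un_Diff)
qed

text \<open>Gluing changes the degree of no vertex of \<open>G\<close> but the leaf
  \<open>r\<close>. The equal degrees that justify the swap are at least 2, so they do not concern
  \<open>r\<close>.\<close>

lemma bswap_glue:
  assumes G: "simple_graph G" "simple_graph R" "verts G \<inter> verts R = {r}" and r: "deg G r = 1"
    and step: "bswap G H"
  shows "bswap (glue G R) (glue H R)"
proof -
  obtain x a y b where s: "can_swap G x a y b" "H = swap G x a y b"
    "deg G x = deg G y \<and> 2 \<le> deg G x \<or> deg G a = deg G b \<and> 2 \<le> deg G a"
    using step unfolding bswap_def by blast
  note d = can_swap_distinct[OF G(1) s(1)]
  have "deg (glue G R) u = deg G u" if "u \<in> verts G" "2 \<le> deg G u" for u
  proof (rule deg_glue_left[OF G(2)])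
    have "u \<noteq> r" using that r by auto
    then show "u \<notin> verts R" using that(1) G(3) by blast
  qed
  then have "deg (glue G R) x = deg (glue G R) y \<and> 2 \<le> deg (glue G R) x \<or>
      deg (glue G R) a = deg (glue G R) b \<and> 2 \<le> deg (glue G R) a"
    using s(3) d by auto
  then show ?thesis unfolding bswap_def s(2) using swap_glue[OF G s(1)] by metis
qed

lemma bswaps_glue:
  assumes G: "simple_graph G" "simple_graph R" "verts G \<inter> verts R = {r}" and r: "deg G r = 1"
    and steps: "bswaps G H"
  shows "bswaps (glue G R) (glue H R)"
  using steps
proof (induction rule: rtranclp_induct)
  case (step H K)
  have "bswap (glue H R) (glue K R)"
    using bswaps_pres[OF step.hyps(1) G(1)] G r step.hyps(2) by (intro bswap_glue) auto
  then show ?case using step.IH by simp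
qed simp

section \<open>Leaves and the degrees of their neighbours under swaps\<close>

lemma can_swap_deg_ge_2:
  assumes "simple_graph G" "can_swap G x a y b"
  shows "2 \<le> deg G x"
proof -
  have "(x, y) \<in> conn (edges G - {{x, a}, {y, b}})" "x \<noteq> y" using assms(2)
    by (auto simp: can_swap_def)
  then obtain w where w: "{x, w} \<in> edges G - {{x, a}, {y, b}}" unfolding conn_def
    by (metis (mono_tags, lifting) converse_rtranclE case_prodD mem_Collect_eq)
  then show ?thesis using assms by (intro deg_ge_2I[of G x a w]) (auto simp: can_swap_def)
qed

text \<open>The pair of equal degree at least 2 cannot contain the leaf. So if the edge at
  \<open>l\<close> is exchanged, this pair consists of the old and the new neighbour of
  \<open>l\<close>.\<close>

lemma bswap_leaf_edge:
  assumes "bswap G H" "simple_graph G" "deg G l = 1" "{l, u} \<in> edges G"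
  shows "\<exists>u'. {l, u'} \<in> edges H \<and> deg G u' = deg G u"
proof -
  obtain x a y b where s: "can_swap G x a y b" "H = swap G x a y b"
    "deg G x = deg G y \<and> 2 \<le> deg G x \<or> deg G a = deg G b \<and> 2 \<le> deg G a"
    using assms(1) unfolding bswap_def by blast
  show ?thesis
  proof (cases "{l, u} \<in> {{x, a}, {y, b}}")
    case False
    then have "{l, u} \<in> edges H" using assms(4) by (simp add: s(2) edges_swap)
    then show ?thesis by blast
  next
    case True
    have new: "{x, b} \<in> edges H" "{y, a} \<in> edges H" "{b, x} \<in> edges H" "{a, y} \<in> edges H"
      by (auto simp: s(2) edges_swap insert_commute)
    consider "l = x" "u = a" | "l = a" "u = x" | "l = y" "u = b" | "l = b" "u = y"
      using True by (auto simp: doubleton_eq_iff)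
    moreover have "deg G a = deg G b" if "l = x \<or> l = y" using that s(3) assms(3) by auto
    moreover have "deg G x = deg G y" if "l = a \<or> l = b" using that s(3) assms(3) by auto
    ultimately show ?thesis using new by metis
  qed
qed

lemma bswaps_leaf_edge:
  assumes "bswaps G H" "simple_graph G" "deg G l = 1" "{l, u} \<in> edges G"
  shows "\<exists>u'. {l, u'} \<in> edges H \<and> deg G u' = deg G u"
  using assms
proof (induction rule: rtranclp_induct)
  case (step H K)
  then obtain u' where "{l, u'} \<in> edges H" "deg G u' = deg G u" by blast
  then show ?case using bswap_leaf_edge[OF step.hyps(2), of l u'] bswaps_pres[OF step.hyps(1)] step.prems by metis
qed blast

text \<open>An invariant of \<open>swap_equiv\<close>. Its minimum is the degree of
  \<open>v_s\<close> in the construction, which is compared with the degree of the neighbour of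
  \<open>r\<close>.\<close>

definition leaf_nbr_degs :: "'a graph \<Rightarrow> nat set" where
  "leaf_nbr_degs G = {deg G u |u l. {l, u} \<in> edges G \<and> deg G l = 1}"

lemma leaf_nbr_degs_swaps_subset: "bswaps G H \<Longrightarrow> simple_graph G \<Longrightarrow> leaf_nbr_degs G \<subseteq> leaf_nbr_degs H"
proof
  fix k assume step: "bswaps G H" and G: "simple_graph G" and "k \<in> leaf_nbr_degs G"
  then obtain u l where "{l, u} \<in> edges G" "deg G l = 1" "k = deg G u" by (auto simp: leaf_nbr_degs_def)
  then obtain u' where "{l, u'} \<in> edges H" "deg H u' = k" "deg H l = 1"
    using bswaps_leaf_edge[OF step G, of l u] bswaps_pres(3)[OF step G] by auto
  then show "k \<in> leaf_nbr_degs H" unfolding leaf_nbr_degs_def by blast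
qed

lemma leaf_nbr_degs_iso_subset:
  assumes "iso G H" "simple_graph G"
  shows "leaf_nbr_degs G \<subseteq> leaf_nbr_degs H"
proof
  fix k assume "k \<in> leaf_nbr_degs G"
  then obtain u l where ul: "{l, u} \<in> edges G" "deg G l = 1" "k = deg G u"
    by (auto simp: leaf_nbr_degs_def)
  obtain f where f: "inj_on f (verts G)" "H = gmap f G" using assms by (auto simp: iso_def)
  have v: "l \<in> verts G" "u \<in> verts G" using edge_verts[OF assms(2) ul(1)] by auto
  have "{f l, f u} \<in> edges H" "deg H (f l) = 1" "deg H (f u) = k"
    using gmap_edge[OF assms(2) f(1) v] deg_gmap[OF assms(2) f(1)] v ul f(2) by auto
  then show "k \<in> leaf_nbr_degs H" unfolding leaf_nbr_degs_def by blast
qed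

lemma swap_equiv_leaf_nbr_degs:
  assumes "swap_equiv G H" "simple_graph G"
  shows "leaf_nbr_degs G = leaf_nbr_degs H"
proof -
  obtain K where K: "bswaps G K" "iso K H" using assms(1) by (auto simp: swap_equiv_def)
  have sK: "simple_graph K" using bswaps_pres[OF K(1) assms(2)] by simp
  have "leaf_nbr_degs G = leaf_nbr_degs K"
    using leaf_nbr_degs_swaps_subset[OF K(1) assms(2)] leaf_nbr_degs_swaps_subset[OF bswaps_sym[OF K(1) assms(2)] sK] by auto
  moreover have "leaf_nbr_degs K = leaf_nbr_degs H"
    using leaf_nbr_degs_iso_subset[OF K(2) sK] leaf_nbr_degs_iso_subset[OF iso_sym[OF sK K(2)] iso_simple[OF K(2) sK]] by auto
  ultimately show ?thesis by simp
qed

section \<open>Glued stars: structure and uniqueness up to isomorphism\<close>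

lemma spokes_star: "edges (star c L) = spokes c L" "verts (star c L) = insert c L"
  by (auto simp: star_def spokes_def)

text \<open>The set \<open>Y i\<close> consists of the leaves attached to \<open>xs ! i\<close>.\<close>

definition glued_leaves :: "'a \<Rightarrow> 'a set \<Rightarrow> nat list \<Rightarrow> 'a list \<Rightarrow> 'a graph \<Rightarrow> (nat \<Rightarrow> 'a set) \<Rightarrow> bool" where
  "glued_leaves c L es xs R Y \<longleftrightarrow> finite L \<and> c \<notin> L \<and> distinct xs \<and> set xs \<subseteq> L \<and> length xs = length es \<and>
     (\<forall>i<length es. finite (Y i) \<and> card (Y i) = es ! i - 1 \<and> Y i \<inter> insert c L = {}) \<and>
     disjoint_family_on Y {..<length es} \<and>
     verts R = insert c L \<union> (\<Union>i<length es. Y i) \<and>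
     edges R = spokes c L \<union> (\<Union>i<length es. spokes (xs ! i) (Y i))"

lemma glued_stars_iff: "glued_stars c L es xs R \<longleftrightarrow> (\<exists>Y. glued_leaves c L es xs R Y)"
proof -
  have "insert c L \<union> (\<Union>i<length es. insert (xs ! i) (Y i)) = insert c L \<union> (\<Union>i<length es. Y i)"
    if "set xs \<subseteq> L" "length xs = length es" for Y
    using that by auto
  then show ?thesis
    unfolding glued_stars_def glued_leaves_def spokes_star prod_eq_iff fst_conv snd_conv
    by (auto cong: conj_cong)
qed

lemma glued_leavesD:
  assumes "glued_leaves c L es xs R Y"
  shows "finite L" "c \<notin> L" "distinct xs" "set xs \<subseteq> L" "length xs = length es"
    "\<forall>i<length es. finite (Y i) \<and> card (Y i) = es ! i - 1 \<and> Y i \<inter> insert c L = {}"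
    "disjoint_family_on Y {..<length es}"
    "verts R = insert c L \<union> (\<Union>i<length es. Y i)"
    "edges R = spokes c L \<union> (\<Union>i<length es. spokes (xs ! i) (Y i))"
  using assms unfolding glued_leaves_def by blast+

lemma glued_stars_intro:
  assumes "finite L" "c \<notin> L" "distinct xs" "set xs \<subseteq> L" "length xs = length es"
    "\<And>i. i < length es \<Longrightarrow> finite (Y i) \<and> card (Y i) = es ! i - 1 \<and> Y i \<inter> insert c L = {}"
    "disjoint_family_on Y {..<length es}"
    "verts R = insert c L \<union> (\<Union>i<length es. Y i)"
    "edges R = spokes c L \<union> (\<Union>i<length es. spokes (xs ! i) (Y i))"
  shows "glued_stars c L es xs R"
  unfolding glued_stars_iff glued_leaves_def using assms by blast

lemma glued_stars_simple:
  assumes "glued_stars c L es xs R"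
  shows "simple_graph R"
proof -
  obtain Y where "glued_leaves c L es xs R Y" using assms unfolding glued_stars_iff by blast
  note S = glued_leavesD[OF this]
  have "finite (verts R)" unfolding S(8) using S(1,6) by auto
  moreover have "e \<subseteq> verts R \<and> card e = 2" if e: "e \<in> edges R" for e
  proof -
    consider l where "l \<in> L" "e = {c, l}" | i w where "i < length es" "w \<in> Y i" "e = {xs ! i, w}"
      using e unfolding S(9) by (auto simp: spokes_iff)
    then show ?thesis
    proof cases
      case 1
      then have "c \<noteq> l" using S(2) by auto
      then show ?thesis using 1 S(8) by auto
    next
      case 2
      then have "xs ! i \<in> L" using S(4,5) nth_mem by fastforce
      then have "xs ! i \<noteq> w" using 2(2) S(6)[rule_format, OF 2(1)] by auto
      then show ?thesis using 2 \<open>xs ! i \<in> L\<close> S(8) by auto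
    qed
  qed
  ultimately show ?thesis by (simp add: simple_graph_def)
qed

text \<open>The subtraction is truncated: the vertex \<open>xs ! i\<close> has degree
  \<open>es ! i\<close> only if this number is positive, and degree 1 otherwise.\<close>

lemma glued_stars_nbrs:
  assumes "glued_stars c L es xs R"
  shows "nbrs R c = L" "c \<in> verts R" "finite L" "distinct xs" "set xs \<subseteq> L" "length xs = length es" "c \<notin> L"
    and "\<And>i. i < length es \<Longrightarrow> deg R (xs ! i) = Suc (es ! i - 1)"
    and "\<And>u w. {u, w} \<in> edges R \<Longrightarrow> u = c \<and> w \<in> L \<or> w = c \<and> u \<in> L \<or> u \<in> set xs \<or> w \<in> set xs"
proof -
  obtain Y where "glued_leaves c L es xs R Y" using assms unfolding glued_stars_iff by blast
  note S = glued_leavesD[OF this]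
  show "c \<in> verts R" "finite L" "distinct xs" "set xs \<subseteq> L" "length xs = length es" "c \<notin> L"
    using S by auto
  have xL: "xs ! i \<in> L" if "i < length es" for i using S(4,5) that nth_mem by fastforce
  have e: "{u, w} \<in> edges R \<longleftrightarrow> u = c \<and> w \<in> L \<or> w = c \<and> u \<in> L \<or>
      (\<exists>i<length es. u = xs ! i \<and> w \<in> Y i \<or> w = xs ! i \<and> u \<in> Y i)" for u w
    unfolding S(9) by (auto simp: spokes_iff doubleton_eq_iff)
  show "nbrs R c = L"
  proof (intro set_eqI)
    fix w
    have "\<not> (\<exists>i<length es. c = xs ! i \<and> w \<in> Y i \<or> w = xs ! i \<and> c \<in> Y i)"
      using S(2,6) xL by blast
    then show "w \<in> nbrs R c \<longleftrightarrow> w \<in> L" unfolding nbrs_iff e using S(2) by blast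
  qed
  show "u = c \<and> w \<in> L \<or> w = c \<and> u \<in> L \<or> u \<in> set xs \<or> w \<in> set xs"
    if "{u, w} \<in> edges R" for u w
    using that S(5) unfolding e by auto
  show "deg R (xs ! i) = Suc (es ! i - 1)" if i: "i < length es" for i
  proof -
    have "nbrs R (xs ! i) = insert c (Y i)"
    proof (intro set_eqI)
      fix w
      have "xs ! i = xs ! j \<longleftrightarrow> i = j" if "j < length es" for j
        using that i S(3,5) by (simp add: nth_eq_iff_index_eq)
      then have "(\<exists>j<length es. xs ! i = xs ! j \<and> w \<in> Y j \<or> w = xs ! j \<and> xs ! i \<in> Y j) \<longleftrightarrow> w \<in> Y i"
        using i S(6) xL by blast
      then show "w \<in> nbrs R (xs ! i) \<longleftrightarrow> w \<in> insert c (Y i)"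
        unfolding nbrs_iff e using S(2) xL[OF i] by blast
    qed
    then show ?thesis using S(6)[rule_format, OF i] by (simp add: deg_def)
  qed
qed

text \<open>The leaf of \<open>M'\<close> at which the construction glues the branch need not be
  \<open>r\<close>; renaming only the centre keeps the vertex set of the glued graph.\<close>

lemma glued_stars_move:
  assumes "glued_stars c L es xs R" "c' = c \<or> c' \<notin> verts R"
  shows "\<exists>R'. glued_stars c' L es xs R' \<and> verts R' = insert c' (verts R - {c})"
proof -
  obtain Y where "glued_leaves c L es xs R Y" using assms(1) unfolding glued_stars_iff by blast
  note S = glued_leavesD[OF this]
  define R' where "R' = (insert c' L \<union> (\<Union>i<length es. Y i), spokes c' L \<union> (\<Union>i<length es. spokes (xs ! i) (Y i)))"
  have "c' \<notin> L" using assms(2) S(2,8) by auto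
  moreover have "Y i \<inter> insert c' L = {}" if "i < length es" for i
    using assms(2) S(6)[rule_format, OF that] S(8) that by auto
  ultimately have "glued_stars c' L es xs R'"
    using S by (intro glued_stars_intro[of _ _ _ _ Y]) (auto simp: R'_def)
  moreover have "verts R' = insert c' (verts R - {c})"
    unfolding S(8) R'_def using S(2,6) by auto
  ultimately show ?thesis by blast
qed

lemma glued_stars_card:
  assumes "finite L" "c \<notin> L"
    "\<And>i. i < n \<Longrightarrow> finite (Y i) \<and> card (Y i) = es ! i - 1 \<and> Y i \<inter> insert c L = {}"
    "disjoint_family_on Y {..<n}"
  shows "card (insert c L \<union> (\<Union>i<n. Y i)) = Suc (card L) + (\<Sum>i<n. es ! i - 1)"
proof -
  have "card (\<Union>i<n. Y i) = (\<Sum>i<n. card (Y i))"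
    using assms(3,4) by (intro card_UN_disjoint) (auto simp: disjoint_family_on_def)
  also have "\<dots> = (\<Sum>i<n. es ! i - 1)" using assms(3) by simp
  finally show ?thesis using assms by (subst card_Un_disjoint) auto
qed

lemma image_spokes: "(`) f ` spokes c S = spokes (f c) (f ` S)"
  by (auto simp: spokes_def image_image)

text \<open>The map sends \<open>xs ! i\<close> to \<open>xs' ! i\<close>, the leaves attached to
  the former to those attached to the latter, and the other neighbours of the centre to each other
  by any bijection. It is onto between sets of equal size, hence injective.\<close>

lemma glued_stars_iso:
  assumes R: "glued_stars c L es xs R" and R': "glued_stars c' L' es xs' R'" and L: "card L = card L'"
  shows "\<exists>f. inj_on f (verts R) \<and> gmap f R = R' \<and> f c = c'"
proof -
  obtain Y where "glued_leaves c L es xs R Y" using R unfolding glued_stars_iff by blast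
  note S = glued_leavesD[OF this]
  obtain Y' where "glued_leaves c' L' es xs' R' Y'" using R' unfolding glued_stars_iff by blast
  note S' = glued_leavesD[OF this]
  have "card (L - set xs) = card (L' - set xs')"
    using S(1,3-5) S'(1,3-5) L by (simp add: card_Diff_subset distinct_card)
  then obtain k where k: "bij_betw k (L - set xs) (L' - set xs')"
    using finite_same_card_bij[of "L - set xs" "L' - set xs'"] S(1) S'(1) by auto
  have "\<exists>h. bij_betw h (Y i) (Y' i)" if "i < length es" for i
    using finite_same_card_bij[of "Y i" "Y' i"] S(6)[rule_format, OF that] S'(6)[rule_format, OF that] by auto
  then obtain h where h: "\<And>i. i < length es \<Longrightarrow> bij_betw (h i) (Y i) (Y' i)" by metis
  define ix where "ix v = (THE i. i < length es \<and> xs ! i = v)" for v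
  define jx where "jx v = (THE i. i < length es \<and> v \<in> Y i)" for v
  have ix: "ix (xs ! i) = i" if "i < length es" for i
    unfolding ix_def using that S(3,5) by (intro the_equality) (auto simp: nth_eq_iff_index_eq)
  have jx: "jx v = i" if "i < length es" "v \<in> Y i" for i v
    unfolding jx_def using that S(7) by (intro the_equality) (auto simp: disjoint_family_on_def)
  define f where "f v = (if v = c then c' else if v \<in> set xs then xs' ! ix v
      else if v \<in> L then k v else h (jx v) v)" for v
  have fc: "f c = c'" by (simp add: f_def)
  have fx: "f (xs ! i) = xs' ! i" if "i < length es" for i
  proof -
    have "xs ! i \<in> set xs" using that S(5) by simp
    moreover from this have "xs ! i \<noteq> c" using S(2,4) by auto
    ultimately show ?thesis using ix[OF that] by (simp add: f_def)
  qed
  have fX: "f v = h i v" if "i < length es" "v \<in> Y i" for i v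
    using that S(4) S(6)[rule_format, OF that(1)] jx[OF that] by (auto simp: f_def)
  have imX: "f ` Y i = Y' i" if "i < length es" for i
    using fX[OF that] h[OF that] by (auto simp: bij_betw_def cong: image_cong)
  have "f ` set xs = set xs'"
  proof -
    have "f ` set xs = (\<lambda>i. f (xs ! i)) ` {..<length es}" using S(5) by (auto simp: set_conv_nth)
    also have "\<dots> = (\<lambda>i. xs' ! i) ` {..<length es}" using fx by (intro image_cong) auto
    also have "\<dots> = set xs'" using S'(5) by (auto simp: set_conv_nth)
    finally show ?thesis .
  qed
  moreover have "f ` (L - set xs) = L' - set xs'"
  proof -
    have "f ` (L - set xs) = k ` (L - set xs)" using S(2) by (intro image_cong) (auto simp: f_def)
    then show ?thesis using k by (simp add: bij_betw_def)
  qed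
  ultimately have imL: "f ` L = L'"
    using S(4) S'(4) by (metis Diff_partition image_Un)
  have imV: "f ` verts R = verts R'"
    unfolding S(8) S'(8) using fc imL imX by (auto simp: image_Un image_UN)
  have imE: "(`) f ` edges R = edges R'"
    unfolding S(9) S'(9) image_Un image_UN image_spokes fc imL using fx imX by simp
  have "card (verts R) = card (verts R')"
    unfolding S(8) S'(8) using glued_stars_card[OF S(1,2) S(6)[rule_format] S(7)] glued_stars_card[OF S'(1,2) S'(6)[rule_format] S'(7)] L by simp
  moreover have "finite (verts R)" unfolding S(8) using S(1,6) by auto
  ultimately have "inj_on f (verts R)" using imV by (intro eq_card_imp_inj_on) auto
  then show ?thesis using imV imE fc by (intro exI[of _ f]) (simp add: gmap_def prod_eq_iff)
qed

text \<open>The leaf sets are the neighbours of the \<open>xs ! i\<close> other than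
  \<open>c\<close>. They are disjoint from each other and from the neighbours of \<open>c\<close>,
  since otherwise a path \<open>c, x, w\<close> or \<open>c, x, w, x'\<close> would have a
  chord.\<close>

lemma glued_stars_from_tree:
  assumes G: "simple_graph R" and F: "forest (edges R)" and c: "c \<in> verts R"
    and xs: "distinct xs" "set xs \<subseteq> nbrs R c"
    and V: "verts R \<subseteq> insert c (nbrs R c \<union> (\<Union>x\<in>set xs. nbrs R x))"
    and E: "\<And>e. e \<in> edges R \<Longrightarrow> c \<in> e \<or> (\<exists>x\<in>set xs. x \<in> e)"
  shows "glued_stars c (nbrs R c) (map (deg R) xs) xs R"
proof (rule glued_stars_intro[of _ _ _ _ "\<lambda>i. nbrs R (xs ! i) - {c}"])
  have cx: "{c, xs ! i} \<in> edges R" if "i < length xs" for i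
    using xs(2) that nth_mem by fastforce
  have tri: "w \<notin> nbrs R c" if "i < length xs" "w \<in> nbrs R (xs ! i) - {c}" for i w
  proof
    assume w: "w \<in> nbrs R c"
    have "xs ! i \<noteq> w" "xs ! i \<noteq> c" using that(2) cx[OF that(1)] no_loop[OF G] by auto
    then have "path (edges R) [c, xs ! i, w]" using that cx[OF that(1)] by (auto simp: path_def)
    from nbr_on_path[OF F this _ _ G, of w] show False using w that no_loop[OF G] by auto
  qed
  show "finite (nbrs R c)" using G by simp
  show "c \<notin> nbrs R c" using no_loop[OF G] by auto
  show "finite (nbrs R (xs ! i) - {c}) \<and> card (nbrs R (xs ! i) - {c}) = map (deg R) xs ! i - 1 \<and>
      (nbrs R (xs ! i) - {c}) \<inter> insert c (nbrs R c) = {}" if "i < length (map (deg R) xs)" for i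
  proof -
    have i: "i < length xs" using that by simp
    have "c \<in> nbrs R (xs ! i)" using cx[OF i] by (simp add: insert_commute)
    moreover have "(nbrs R (xs ! i) - {c}) \<inter> insert c (nbrs R c) = {}" using tri[OF i] by blast
    ultimately show ?thesis using i G by (simp add: deg_def)
  qed
  show "disjoint_family_on (\<lambda>i. nbrs R (xs ! i) - {c}) {..<length (map (deg R) xs)}"
    unfolding disjoint_family_on_def
  proof (intro ballI impI equals0I)
    fix i j w assume ij: "i \<in> {..<length (map (deg R) xs)}" "j \<in> {..<length (map (deg R) xs)}" "i \<noteq> j"
      and w: "w \<in> (nbrs R (xs ! i) - {c}) \<inter> (nbrs R (xs ! j) - {c})"
    then have l: "i < length xs" "j < length xs" by auto
    have ne: "xs ! i \<noteq> xs ! j" using ij l xs(1) by (simp add: nth_eq_iff_index_eq)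
    have "xs ! i \<noteq> w" "xs ! i \<noteq> c" "xs ! j \<noteq> w" "xs ! j \<noteq> c"
      using w cx[OF l(1)] cx[OF l(2)] no_loop[OF G] by auto
    then have "path (edges R) [c, xs ! i, w, xs ! j]"
      using w ne cx[OF l(1)] by (auto simp: path_def insert_commute)
    from nbr_on_path[OF F this _ _ G, of "xs ! j"] show False using cx[OF l(2)] ne by auto
  qed
  show "verts R = insert c (nbrs R c) \<union> (\<Union>i<length (map (deg R) xs). nbrs R (xs ! i) - {c})"
  proof (intro equalityI subsetI)
    fix u assume "u \<in> verts R"
    then show "u \<in> insert c (nbrs R c) \<union> (\<Union>i<length (map (deg R) xs). nbrs R (xs ! i) - {c})"
      using V by (fastforce simp: in_set_conv_nth)
  next
    fix u assume "u \<in> insert c (nbrs R c) \<union> (\<Union>i<length (map (deg R) xs). nbrs R (xs ! i) - {c})"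
    then show "u \<in> verts R" using c nbrs_verts[OF G] by blast
  qed
  show "edges R = spokes c (nbrs R c) \<union> (\<Union>i<length (map (deg R) xs). spokes (xs ! i) (nbrs R (xs ! i) - {c}))"
  proof (intro equalityI subsetI)
    fix e assume e: "e \<in> edges R"
    have ex: "\<exists>w. e = {u, w} \<and> w \<in> nbrs R u" if "u \<in> e" for u
      using edge_doubleton[OF G e] e that by (auto simp: insert_commute)
    show "e \<in> spokes c (nbrs R c) \<union> (\<Union>i<length (map (deg R) xs). spokes (xs ! i) (nbrs R (xs ! i) - {c}))"
    proof (cases "c \<in> e")
      case True
      then obtain w where "e = {c, w}" "w \<in> nbrs R c" using ex by blast
      then have "e \<in> spokes c (nbrs R c)" unfolding spokes_iff by blast
      then show ?thesis by blast
    next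
      case False
      then obtain x where x: "x \<in> set xs" "x \<in> e" using E[OF e] by blast
      then obtain i where i: "i < length xs" "x = xs ! i" by (auto simp: in_set_conv_nth)
      obtain w where w: "e = {x, w}" "w \<in> nbrs R x" using ex[OF x(2)] by blast
      then have "e \<in> spokes x (nbrs R x - {c})" using False by (auto simp: spokes_iff)
      then show ?thesis using i by auto
    qed
  qed (auto simp: spokes_iff)
qed (use xs in auto)

section \<open>Removing and restoring a branch\<close>

text \<open>\<open>R\<close> consists of the edges that meet \<open>B\<close>, the neighbours of
  \<open>r\<close> other than \<open>v\<close>. The remainder retains \<open>r\<close> as a leaf at
  \<open>v\<close>, the place where the branch is glued.\<close>

lemma end_branch_decompose:
  assumes T: "is_tree T" and rs: "end_branch \<delta> T r v" and d2: "2 \<le> \<delta>"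
  obtains G R where "T = glue G R" "verts G \<inter> verts R = {r}" "is_tree G" "simple_graph R" "forest (edges R)"
    "nbrs R r = nbrs T r - {v}" "nbrs G r = {v}" "r \<in> verts R"
    "verts R = insert r (nbrs R r \<union> (\<Union>b\<in>nbrs R r. nbrs R b))"
    "\<And>e. e \<in> edges R \<Longrightarrow> e \<inter> nbrs R r \<noteq> {}"
    "\<And>b. b \<in> nbrs R r \<Longrightarrow> deg R b = deg T b"
    "\<And>u. u \<in> verts G \<Longrightarrow> u \<noteq> r \<Longrightarrow> deg G u = deg T u"
    "inner G = inner T - insert r (nbrs R r)"
proof -
  have G: "simple_graph T" and F: "forest (edges T)" and C: "connected_graph T" using T
    by (auto simp: tree_iff)
  define B where "B = nbrs T r - {v}"
  have r: "r \<in> inner T" "deg T r = \<delta>" and rv: "{r, v} \<in> edges T" and v: "v \<in> inner T"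
    and B: "\<And>b. b \<in> B \<Longrightarrow> b \<in> inner T" "\<And>b. b \<in> B \<Longrightarrow> pendant T b"
    using rs by (auto simp: end_branch_def branch_root_def B_def)
  define S where "S = B \<union> (\<Union>b\<in>B. nbrs T b - {r})"
  have rB: "r \<notin> B" "v \<notin> B" using no_loop[OF G] by (auto simp: B_def)
  have Br: "{r, b} \<in> edges T" if "b \<in> B" for b using that by (simp add: B_def)
  \<comment> \<open>Since \<open>b\<close> is pendant and adjacent to the inner vertex
    \<open>r\<close>, all its other neighbours are leaves.\<close>
  have lf: "l \<notin> inner T \<and> nbrs T l = {b} \<and> deg T l = 1" if b: "b \<in> B"
    and l: "l \<in> nbrs T b - {r}" for b l
  proof -
    have "r \<in> nbrs T b \<inter> inner T" using Br[OF b] r by (simp add: insert_commute)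
    moreover have "card (nbrs T b \<inter> inner T) \<le> 1" using B(2)[OF b] by (simp add: pendant_def)
    moreover have "finite (nbrs T b \<inter> inner T)" using G by simp
    ultimately have "\<forall>u\<in>nbrs T b \<inter> inner T. u = r"
      using card_le_Suc0_iff_eq[of "nbrs T b \<inter> inner T"] unfolding One_nat_def by blast
    then have nl: "l \<notin> inner T" using l by blast
    have e: "{l, b} \<in> edges T" using l by (simp add: insert_commute)
    then have "deg T l = 1" using nl edge_verts[OF G e] by (simp add: inner_def)
    moreover have "b \<in> nbrs T l" using e by simp
    ultimately show ?thesis using nl by (metis card_1_singletonE deg_def singletonD)
  qed
  have vS: "v \<notin> S" using rB lf v by (auto simp: S_def)
  have rS: "r \<notin> S" using rB by (auto simp: S_def)
  have SV: "S \<subseteq> verts T" using nbrs_verts[OF G] by (auto simp: S_def B_def)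
  have eB: "e \<inter> B \<noteq> {}" if e: "e \<in> edges T" "e \<inter> S \<noteq> {}" for e
  proof -
    obtain u where u: "u \<in> e" "u \<in> S" using e by blast
    show ?thesis
    proof (cases "u \<in> B")
      case False
      then obtain b where b: "b \<in> B" "u \<in> nbrs T b - {r}" using u by (auto simp: S_def)
      obtain w where w: "e = {u, w}" using edge_doubleton[OF G e(1)] u by auto
      then have "w \<in> nbrs T u" using e by simp
      then have "w = b" using lf[OF b] by simp
      then show ?thesis using b w by auto
    qed (use u in blast)
  qed
  define R where "R = (insert r S, {e \<in> edges T. e \<inter> B \<noteq> {}})"
  define H where "H = (verts T - S, {e \<in> edges T. e \<inter> S = {}})"
  have vR: "verts R = insert r S" and vH: "verts H = verts T - S" by (auto simp: R_def H_def)
  have eR: "e \<in> edges R \<longleftrightarrow> e \<in> edges T \<and> e \<inter> B \<noteq> {}"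
    and eH: "e \<in> edges H \<longleftrightarrow> e \<in> edges T \<and> e \<inter> S = {}" for e
    by (auto simp: R_def H_def)
  have BS: "B \<subseteq> S" by (auto simp: S_def)
  have rV: "r \<in> verts T" using r by (simp add: inner_def)
  have nRb: "nbrs R b = nbrs T b" if "b \<in> B" for b unfolding nbrs_def eR using that by blast
  have nRr: "nbrs R r = B" unfolding nbrs_def eR using rB(1) Br by blast
  have sR: "simple_graph R"
    unfolding simple_graph_def
  proof (intro conjI ballI)
    show "finite (verts R)" using SV G by (auto simp: vR simple_graph_def intro: finite_subset)
    fix e assume e: "e \<in> edges R"
    then obtain b where b: "b \<in> B" "b \<in> e" "e \<in> edges T" by (auto simp: eR)
    then obtain w where w: "e = {b, w}" using edge_doubleton[OF G b(3)] by auto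
    then have "w \<in> nbrs T b" using b by simp
    then show "e \<subseteq> verts R" using b w by (auto simp: vR S_def)
    show "card e = 2" using b(3) G by (simp add: simple_graph_def)
  qed
  have sH: "simple_graph H" using G by (auto simp: simple_graph_def vH eH)
  have nHu: "nbrs H u = nbrs T u" if u: "u \<in> verts H" "u \<noteq> r" for u
  proof -
    have uS: "u \<notin> S" using u by (simp add: vH)
    have "{u, w} \<inter> S = {}" if w: "{u, w} \<in> edges T" for w
    proof (rule ccontr)
      assume "{u, w} \<inter> S \<noteq> {}"
      then have "w \<in> B" using eB[OF w] uS BS by auto
      moreover have "u \<in> nbrs T w" using w by (simp add: insert_commute)
      ultimately show False using uS u(2) by (auto simp: S_def)
    qed
    then show ?thesis by (auto simp: eH)
  qed
  have nHr: "nbrs H r = {v}"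
  proof (intro equalityI subsetI)
    fix w assume "w \<in> nbrs H r"
    then have "w \<in> nbrs T r" "w \<notin> S" using eH[of "{r, w}"] by auto
    then show "w \<in> {v}" using BS unfolding B_def by blast
  next
    fix w assume "w \<in> {v}"
    then show "w \<in> nbrs H r" using rv vS rS eH[of "{r, v}"] by auto
  qed
  have cH: "connected_graph H"
  proof -
    \<comment> \<open>Contracting the removed branch to \<open>r\<close> turns walks of the tree
      into walks of the remainder.\<close>
    define f where "f u = (if u \<in> S then r else u)" for u
    have "(f p, f q) \<in> conn (edges H)" if e: "{p, q} \<in> edges T" for p q
    proof (cases "{p, q} \<inter> S = {}")
      case True
      then show ?thesis using e by (auto simp: f_def eH intro: conn_edge)
    next
      case False
      then obtain b where b: "b \<in> B" "b \<in> {p, q}" using eB[OF e] by blast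
      then have "p \<in> nbrs T b \<and> b = q \<or> q \<in> nbrs T b \<and> b = p" using e
        by (auto simp: insert_commute)
      then have "f p = r \<and> f q = r" using b BS by (auto simp: f_def S_def)
      then show ?thesis by simp
    qed
    then have "(u, w) \<in> conn (edges T) \<Longrightarrow> (f u, f w) \<in> conn (edges H)" for u w
      using conn_map[of u w "edges T" f "edges H"] by blast
    then have "(u, w) \<in> conn (edges H)" if "u \<in> verts H" "w \<in> verts H" for u w
      using C that by (fastforce simp: connected_graph_conn vH f_def)
    then show ?thesis using rV rS by (auto simp: connected_graph_conn vH)
  qed
  have tH: "is_tree H" unfolding tree_iff using sH cH forest_mono[OF F, of "edges H"] eH by blast
  show thesis
  proof (rule that)
    show "T = glue H R" using SV rV eB BS by (auto simp: glue_def prod_eq_iff vR vH R_def H_def)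
    show "verts H \<inter> verts R = {r}" using rS rV by (auto simp: vR vH)
    show "is_tree H" "simple_graph R" by fact+
    show "forest (edges R)" by (rule forest_mono[OF F]) (auto simp: eR)
    show "nbrs R r = nbrs T r - {v}" using nRr B_def by simp
    show "nbrs H r = {v}" by fact
    show "r \<in> verts R" by (simp add: vR)
    have "(\<Union>b\<in>B. nbrs R b) = (\<Union>b\<in>B. nbrs T b)" using nRb by (intro SUP_cong) auto
    then show "verts R = insert r (nbrs R r \<union> (\<Union>b\<in>nbrs R r. nbrs R b))"
      unfolding nRr vR S_def by auto
    show "e \<inter> nbrs R r \<noteq> {}" if "e \<in> edges R" for e using that by (simp add: nRr eR)
    show "deg R b = deg T b" if "b \<in> nbrs R r" for b using nRb that nRr by (simp add: deg_def)
    show dH: "deg H u = deg T u" if "u \<in> verts H" "u \<noteq> r" for u using nHu[OF that]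
      by (simp add: deg_def)
    show "inner H = inner T - insert r (nbrs R r)"
    proof (intro set_eqI iffI)
      fix u assume u: "u \<in> inner H"
      then have "u \<noteq> r" using nHr by (auto simp: inner_def deg_def)
      then show "u \<in> inner T - insert r (nbrs R r)"
        using u dH[of u] BS by (auto simp: nRr inner_def vH)
    next
      fix u assume u: "u \<in> inner T - insert r (nbrs R r)"
      then have "u \<notin> S" using lf nRr by (auto simp: S_def)
      then show "u \<in> inner H" using u dH[of u] by (auto simp: inner_def vH)
    qed
  qed
qed

text \<open>A swap in the remainder is also one in the whole tree, where only the degree of
  \<open>r\<close> differs: \<delta> instead of 1. The ends \<open>x\<close> and \<open>y\<close>
  are no leaves, and \<open>a = r\<close> is trivial, so the only critical case is
  \<open>b = r\<close>. There maximality of the degree of \<open>v\<close> is needed.\<close>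

lemma class_opt_remove_branch:
  assumes tG: "is_tree G" and sR: "simple_graph R" and int: "verts G \<inter> verts R = {r}"
    and nG: "nbrs G r = {v}" and L: "class_opt (glue G R)" and rs: "end_branch \<delta> (glue G R) r v"
    and min: "\<And>u. u \<in> inner (glue G R) \<Longrightarrow> \<delta> \<le> deg (glue G R) u"
    and mx: "\<And>K r' v'. bswaps (glue G R) K \<Longrightarrow> end_branch \<delta> K r' v' \<Longrightarrow> deg K v' \<le> deg (glue G R) v"
  shows "class_opt G"
  unfolding class_opt_def
proof (intro allI impI)
  fix H assume XH: "bswaps G H"
  have sG: "simple_graph G" using tG by (simp add: tree_iff)
  have dr: "deg G r = 1" using nG by (simp add: deg_def)
  have tH: "is_tree H" using bswaps_tree[OF XH tG] .
  then have sH: "simple_graph H" by (simp add: tree_iff)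
  have vH: "verts H = verts G" and dH: "deg H = deg G" using bswaps_pres[OF XH sG] by auto
  let ?T = "glue G R" and ?K = "glue H R"
  have intH: "verts H \<inter> verts R = {r}" using int vH by simp
  have XK: "bswaps ?T ?K" by (rule bswaps_glue[OF sG sR int dr XH])
  have sT: "simple_graph ?T" by (rule simple_glue[OF sG sR])
  have sK: "simple_graph ?K" by (rule simple_glue[OF sH sR])
  have LK: "local_opt ?K" using L XK unfolding class_opt_def by blast
  have dK: "deg ?K = deg ?T" and iK: "inner ?K = inner ?T" and vK: "verts ?K = verts ?T"
    using bswaps_pres[OF XK sT] inner_bswaps[OF XK sT] by auto
  have uH: "u \<notin> verts R" if "u \<in> verts H" "u \<noteq> r" for u using that intH by auto
  have dKH: "deg ?K u = deg H u" if "u \<in> verts H" "u \<noteq> r" for u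
    using deg_glue_left[OF sR uH[OF that]] .
  have d2: "deg ?T r = \<delta>" and r: "r \<in> inner ?T" and vT: "v \<in> inner ?T"
    and rvT: "{r, v} \<in> edges ?T"
    using rs by (auto simp: end_branch_def branch_root_def)
  have \<delta>2: "2 \<le> \<delta>" using inner_deg_ge_2[OF sT rvT r] d2 by simp
  have "v \<in> nbrs G r" using nG by simp
  then have rvG: "{r, v} \<in> edges G" by simp
  from bswaps_leaf_edge[OF XH sG dr this]
  obtain v' where v': "{r, v'} \<in> edges H" "deg G v' = deg G v" by blast
  have "deg H r = 1" using dr dH by simp
  then have nH: "nbrs H r = {v'}" using v'(1) by (metis card_1_singletonE deg_def nbrs_iff singletonD)
  have v'V: "v' \<in> verts H" "v' \<noteq> r" using edge_verts[OF sH v'(1)] by auto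
  have vV: "v \<in> verts G" "v \<noteq> r" using edge_verts[OF sG rvG] by auto
  have dv': "deg ?K v' = deg ?T v"
    using dKH[OF v'V] v'(2) dH deg_glue_left[OF sR uH, of v] vV vH dKH[of v] dK by simp
  have rR: "r \<in> verts R" using int by auto
  have B1: "nbrs ?T r - {v} = nbrs R r" unfolding nbrs_glue nG
    using uH[of v] vV vH nbrs_verts[OF sR, of r] by auto
  have B2: "nbrs ?K r - {v'} = nbrs R r" unfolding nbrs_glue nH
    using uH[OF v'V] nbrs_verts[OF sR, of r] by auto
  have BH: "b \<notin> verts H" if "b \<in> nbrs R r" for b using that nbrs_verts[OF sR, of r] intH by blast
  have nB: "nbrs ?K b = nbrs ?T b" if "b \<in> nbrs R r" for b
    unfolding nbrs_glue using BH[OF that] vH nbrs_outside[OF sH] nbrs_outside[OF sG] by simp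
  have rsK: "end_branch \<delta> ?K r v'"
    unfolding end_branch_def
  proof (intro conjI)
    have "v' \<in> inner ?K" using dv' vT v'V dK by (auto simp: inner_def)
    then show "branch_root \<delta> ?K r v'" using r d2 dK iK v'(1) by (simp add: branch_root_def)
    show "\<forall>b\<in>nbrs ?K r - {v'}. b \<in> inner ?K \<and> pendant ?K b \<and> (\<forall>u\<in>verts ?K - (nbrs ?K r - {v'}). deg ?K u \<le> deg ?K b)"
      using rs nB unfolding end_branch_def B1 B2 iK dK vK pendant_def by simp
  qed
  show "local_opt H"
    unfolding local_opt_def
  proof (intro allI impI)
    fix x a y b assume s: "can_swap H x a y b" and lt: "deg H y < deg H x"
    note d = can_swap_distinct[OF sH s]
    have sKs: "can_swap ?K x a y b" by (rule swap_glue(1)[OF sH sR intH s])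
    have e: "{x, a} \<in> edges H" "{y, b} \<in> edges H" using s by (auto simp: can_swap_def)
    have xr: "x \<noteq> r" using can_swap_deg_ge_2[OF sH s] \<open>deg H r = 1\<close> by auto
    have yr: "y \<noteq> r"
      using can_swap_deg_ge_2[OF sH can_swap_flip[OF s]] \<open>deg H r = 1\<close> by auto
    have ltK: "deg ?K y < deg ?K x" using lt dKH d xr yr by simp
    have le: "deg ?K a \<le> deg ?K b" using LK sKs ltK unfolding local_opt_def by blast
    have b1: "1 \<le> deg H b"
      by (rule deg_pos_if_edge[OF sH, of b y]) (use e in \<open>simp add: insert_commute\<close>)
    consider "a = r" | "a \<noteq> r" "b \<noteq> r" | "a \<noteq> r" "b = r" by blast
    then show "deg H a \<le> deg H b"
    proof cases
      case 1
      then show ?thesis using b1 \<open>deg H r = 1\<close> by simp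
    next
      case 2
      then show ?thesis using le dKH d by simp
    next
      case 3
      show ?thesis
      proof (rule ccontr)
        assume na: "\<not> deg H a \<le> deg H b"
        have "y \<in> nbrs H r" using e(2) 3 by (simp add: insert_commute)
        then have y: "y = v'" unfolding nH by simp
        have da: "deg ?K a = deg H a" using dKH d 3 by simp
        then have "a \<in> inner ?K" using na b1 d by (auto simp: inner_def)
        then have "\<delta> \<le> deg ?K a" using min iK dK by simp
        \<comment> \<open>An inner \<open>a\<close> has degree at least \<delta>, and local
          optimality of the whole tree gives at most \<delta>. So this swap stays in the class and
          hangs the branch on \<open>x\<close>, whose degree exceeds that of
          \<open>v\<close>.\<close>
        then have eq: "deg ?K a = deg ?K b" using le d2 dK 3 by simp
        let ?L = "swap ?K x a y b"
        have "2 \<le> deg ?K a" using eq d2 dK \<delta>2 3 by simp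
        then have XL: "bswap ?K ?L" by (rule bswapI2[OF sKs eq])
        have nr: "nbrs ?L r = nbrs ?K r - {y} \<union> {x}" using nbrs_swap(4)[OF sK sKs] 3 by simp
        have xB: "x \<notin> nbrs R r" using BH d(7) by blast
        have aux: "A - {p} \<union> {q} - {q} = B" if "q \<notin> B" "A - {p} = B" for A B :: "'a set"
          and p q
          using that by blast
        have nrx: "nbrs ?L r - {x} = nbrs R r" unfolding nr by (rule aux[OF xB B2[folded y]])
        have nLb: "nbrs ?L u = nbrs ?K u" if "u \<in> nbrs R r" for u
        proof (rule nbrs_swap(5)[OF sK sKs])
          show "u \<notin> {x, a, y, b}" using BH[OF that] d(7-10) by auto
        qed
        have dL: "deg ?L = deg ?K" using deg_swap[OF sK sKs] by auto
        have iL: "inner ?L = inner ?K" by (rule inner_swap[OF sK sKs])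
        have "end_branch \<delta> ?L r x"
          unfolding end_branch_def
        proof (intro conjI)
          have "2 \<le> deg ?K x" using can_swap_deg_ge_2[OF sK sKs] .
          then have "x \<in> inner ?L" using d dL by (auto simp: inner_def)
          moreover have "x \<in> nbrs ?L r" using nr by auto
          ultimately show "branch_root \<delta> ?L r x" using r d2 dK iK dL iL
            by (simp add: branch_root_def)
          show "\<forall>b\<in>nbrs ?L r - {x}. b \<in> inner ?L \<and> pendant ?L b \<and> (\<forall>u\<in>verts ?L - (nbrs ?L r - {x}). deg ?L u \<le> deg ?L b)"
            using rsK nLb unfolding end_branch_def nrx B2 iL dL pendant_def verts_swap by simp
        qed
        moreover have "bswaps ?T ?L" using XK XL by simp
        ultimately have "deg ?L x \<le> deg ?T v" using mx by blast
        then have "deg ?K x \<le> deg ?K y" using dL dv' y by simp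
        then show False using ltK by simp
      qed
    qed
  qed
qed

section \<open>The labelled trees\<close>

definition inner_degs :: "'a graph \<Rightarrow> nat list \<Rightarrow> bool" where
  "inner_degs G ds \<longleftrightarrow> sorted_wrt (\<ge>) ds \<and> mset ds = image_mset (deg G) (mset_set (inner G))"

text \<open>What the choice of \<open>v_s\<close> relies on: the first labelled vertex with a leaf
  neighbour has the least degree among all vertices with a leaf neighbour, labelled or not.\<close>

definition labels_ok :: "'a graph \<Rightarrow> 'a list \<Rightarrow> bool" where
  "labels_ok M vs \<longleftrightarrow> sorted_wrt (\<lambda>u v. deg M u \<le> deg M v) vs \<and> set vs \<subseteq> inner M \<and>
     (\<forall>u. leaf_adjacent M u \<longrightarrow> u \<in> set vs)"

lemma finite_inner: "simple_graph G \<Longrightarrow> finite (inner G)"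
  by (simp add: inner_def simple_graph_def)

lemma inner_degs_reduced_seq:
  assumes "simple_graph G"
  shows "inner_degs G (reduced_seq (degree_seq G))"
  unfolding inner_degs_def
proof
  have "sorted (filter (\<lambda>d. d \<noteq> 1) (sorted_list_of_multiset (deg_mset G)))"
    by (intro sorted_wrt_filter) simp
  then show "sorted_wrt (\<ge>) (reduced_seq (degree_seq G))"
    unfolding reduced_seq_def degree_seq_def deg_mset_def[symmetric] rev_filter[symmetric]
    by (simp add: sorted_wrt_rev)
  have "mset (reduced_seq (degree_seq G)) = filter_mset (\<lambda>d. d \<noteq> 1) (image_mset (deg G) (mset_set (verts G)))"
    by (simp add: reduced_seq_def degree_seq_def)
  also have "\<dots> = image_mset (deg G) (filter_mset (\<lambda>v. deg G v \<noteq> 1) (mset_set (verts G)))"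
    by (simp add: filter_mset_image_mset)
  also have "filter_mset (\<lambda>v. deg G v \<noteq> 1) (mset_set (verts G)) = mset_set (inner G)"
    using assms by (simp add: inner_def simple_graph_def)
  finally show "mset (reduced_seq (degree_seq G)) = image_mset (deg G) (mset_set (inner G))" .
qed

lemma inner_degs_set: "simple_graph G \<Longrightarrow> inner_degs G ds \<Longrightarrow> set ds = deg G ` inner G"
  unfolding inner_degs_def by (metis finite_inner finite_set_mset_mset_set set_image_mset set_mset_mset)

lemma inner_degs_length: "inner_degs G ds \<Longrightarrow> length ds = card (inner G)"
  unfolding inner_degs_def by (metis size_image_mset size_mset size_mset_set)

lemma last_le:
  assumes "sorted_wrt (\<ge>) (ds :: nat list)" "d \<in> set ds"
  shows "last ds \<le> d"
proof -
  have "ds \<noteq> []" using assms(2) by auto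
  then have "ds = butlast ds @ [last ds]" by simp
  then have "sorted_wrt (\<ge>) (butlast ds @ [last ds])" "d \<in> set (butlast ds @ [last ds])"
    using assms by metis+
  then show ?thesis by (auto simp: sorted_wrt_append)
qed

lemma ex_enumeration:
  assumes "finite A" "mset zs = image_mset f (mset_set A)"
  shows "\<exists>xs. distinct xs \<and> set xs = A \<and> map f xs = zs"
  using assms
proof (induction zs arbitrary: A)
  case Nil
  then show ?case by (simp add: mset_set_empty_iff)
next
  case (Cons z zs)
  then have "z \<in># image_mset f (mset_set A)" by (metis list.set_intros(1) set_mset_mset)
  then obtain a where a: "a \<in> A" "f a = z" using Cons.prems(1) by auto
  have "mset_set A = add_mset a (mset_set (A - {a}))" using a(1) Cons.prems(1) by (metis mset_set.remove)
  then have "mset zs = image_mset f (mset_set (A - {a}))" using Cons.prems(2) a(2) by simp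
  then obtain xs where "distinct xs" "set xs = A - {a}" "map f xs = zs"
    using Cons.IH[of "A - {a}"] Cons.prems(1) by auto
  then show ?case using a by (intro exI[of _ "a # xs"]) auto
qed

text \<open>Reversed, \<open>ds\<close> is sorted and hence equals the sorted list of
  \<open>B\<close> followed by that of \<open>A\<close>. Ties between \<open>A\<close> and
  \<open>B\<close> are harmless because only multisets of degrees are compared.\<close>

lemma take_drop_dominating:
  fixes ds :: "nat list"
  assumes s: "sorted_wrt (\<ge>) ds" and m: "mset ds = A + B"
    and le: "\<And>a b. a \<in># A \<Longrightarrow> b \<in># B \<Longrightarrow> b \<le> a"
  shows "mset (take (size A) ds) = A" "mset (drop (size A) ds) = B"
proof -
  let ?l = "sorted_list_of_multiset B @ sorted_list_of_multiset A"
  have "sorted ?l" using le by (auto simp: sorted_append)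
  moreover have "mset ?l = mset (rev ds)" using m by simp
  ultimately have "sort (rev ds) = ?l" by (intro properties_for_sort)
  moreover have "sort (rev ds) = rev ds" using s by (intro sort_key_id_if_sorted) (simp add: sorted_wrt_rev)
  ultimately have e: "ds = rev (sorted_list_of_multiset A) @ rev (sorted_list_of_multiset B)"
    by (metis rev_append rev_rev_ident)
  have "length (rev (sorted_list_of_multiset A)) = size A"
    by (metis length_rev mset_sorted_list_of_multiset size_mset)
  then have t: "take (size A) ds = rev (sorted_list_of_multiset A)" "drop (size A) ds = rev (sorted_list_of_multiset B)"
    using e by (metis append_eq_conv_conj)+
  show "mset (take (size A) ds) = A" "mset (drop (size A) ds) = B" unfolding t by simp_all
qed

text \<open>Two adjacent leaves make up a whole component, so in a tree there would be no room for
  the inner vertex \<open>c\<close>.\<close>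

lemma edge_internal:
  assumes T: "is_tree G" and c: "c \<in> inner G" and e: "{u, w} \<in> edges G"
  shows "u \<in> inner G \<or> w \<in> inner G"
proof (cases "u = c")
  case False
  have G: "simple_graph G" using T by (simp add: tree_iff)
  have V: "u \<in> verts G" "w \<in> verts G" "c \<in> verts G" using edge_verts[OF G e] c
    by (auto simp: inner_def)
  show ?thesis
  proof (rule ccontr)
    assume n: "\<not> (u \<in> inner G \<or> w \<in> inner G)"
    then have "deg G u = 1" using V by (simp add: inner_def)
    then have nu: "nbrs G u = {w}" using e by (metis card_1_singletonE deg_def nbrs_iff singletonD)
    obtain q where q: "path (edges G) q" "hd q = u" "last q = c" using tree_path[OF T V(1,3)] .
    have "2 \<le> length q" using q False by (cases q; cases "tl q") (auto simp: path_def)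
    then have "{u, q ! 1} \<in> edges G" "q ! 1 \<in> inner G"
      using path_nth[OF q(1), of 0] path_internal[OF G q(1), of 1] q c by (auto simp: path_def hd_conv_nth)
    moreover from this have "q ! 1 = w" using nu by (metis nbrs_iff singletonD)
    ultimately show False using n by simp
  qed
qed (use c in simp)

text \<open>Interchanging the names of two leaves amounts to swapping them between their neighbours;
  if the neighbours coincide, nothing changes.\<close>

lemma leaf_transpose:
  assumes G: "simple_graph N" and C: "connected_graph N" and pq: "p \<noteq> q"
    and p: "nbrs N p = {u}" and q: "nbrs N q = {w}" and d: "deg N u = deg N w" "2 \<le> deg N u"
  shows "bswaps N (gmap (transp p q) N)"
proof -
  have e: "{u, p} \<in> edges N" "{w, q} \<in> edges N" using p q by (auto simp: insert_commute nbrs_def)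
  have V: "p \<in> verts N" "u \<in> verts N" "q \<in> verts N" "w \<in> verts N"
    using edge_verts[OF G e(1)] edge_verts[OF G e(2)] by auto
  have dp: "deg N p = 1" "deg N q = 1" using p q by (auto simp: deg_def)
  have ne: "u \<noteq> p" "u \<noteq> q" "w \<noteq> p" "w \<noteq> q" using dp d by auto
  have ep: "s = u" if "{p, s} \<in> edges N" for s using that p by (metis nbrs_iff singletonD)
  have eq: "s = w" if "{q, s} \<in> edges N" for s using that q by (metis nbrs_iff singletonD)
  define E0 where "E0 = {e \<in> edges N. p \<notin> e \<and> q \<notin> e}"
  have E: "edges N = E0 \<union> {{u, p}, {w, q}}"
  proof (intro equalityI subsetI)
    fix e assume e': "e \<in> edges N"
    then obtain s t where st: "e = {s, t}" using edge_doubleton[OF G] by blast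
    show "e \<in> E0 \<union> {{u, p}, {w, q}}"
    proof (cases "p \<in> e \<or> q \<in> e")
      case True
      then consider "s = p" | "t = p" | "s = q" | "t = q" using st by auto
      then show ?thesis using ep[of s] ep[of t] eq[of s] eq[of t] e' st by cases (auto simp: insert_commute)
    qed (use e' in \<open>simp add: E0_def\<close>)
  qed (use e in \<open>auto simp: E0_def\<close>)
  have t0: "(`) (transp p q) ` E0 = E0"
  proof -
    have "transp p q ` e = e" if "e \<in> E0" for e using that by (intro transp_fix) (auto simp: E0_def)
    then show ?thesis by auto
  qed
  have gm: "gmap (transp p q) N = (verts N, E0 \<union> {{u, q}, {w, p}})"
    unfolding gmap_def E image_Un t0 using V ne by (simp add: transp_image)
  show ?thesis
  proof (cases "u = w")
    case True
    then have "gmap (transp p q) N = N" unfolding gm using E by (auto simp: prod_eq_iff)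
    then show ?thesis by simp
  next
    case False
    \<comment> \<open>Contracting both leaves to their neighbours yields a walk from
      \<open>u\<close> to \<open>w\<close> without the two leaf edges.\<close>
    define f where "f v = (if v = p then u else if v = q then w else v)" for v
    have "(f s, f t) \<in> conn (edges N - {{u, p}, {w, q}})" if st: "{s, t} \<in> edges N" for s t
    proof -
      consider "{s, t} \<in> E0" | "{s, t} = {u, p}" | "{s, t} = {w, q}" using st E by auto
      then show ?thesis
      proof cases
        case 1
        then have "f s = s" "f t = t" "{s, t} \<in> edges N - {{u, p}, {w, q}}" by (auto simp: f_def E0_def)
        then show ?thesis using conn_edge by metis
      next
        case 2
        then have "f s = f t" using ne by (auto simp: f_def doubleton_eq_iff)
        then show ?thesis by simp
      next
        case 3
        then have "f s = f t" using ne pq by (auto simp: f_def doubleton_eq_iff)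
        then show ?thesis by simp
      qed
    qed
    moreover have "(u, w) \<in> conn (edges N)" using C V by (simp add: connected_graph_conn)
    ultimately have "(f u, f w) \<in> conn (edges N - {{u, p}, {w, q}})" by (rule conn_map[rotated])
    then have c: "(u, w) \<in> conn (edges N - {{u, p}, {w, q}})" using ne by (simp add: f_def)
    have "{u, q} \<notin> edges N" "{w, p} \<notin> edges N" using ep[of w] eq[of u] False
      by (auto simp: insert_commute)
    then have s: "can_swap N u p w q" using e c False pq ne unfolding can_swap_def by simp
    have "edges N - {{u, p}, {w, q}} = E0" unfolding E by (auto simp: E0_def)
    then have "swap N u p w q = gmap (transp p q) N" unfolding gm swap_def by simp
    then have "bswap N (gmap (transp p q) N)" using bswapI1[OF s d] by simp
    then show ?thesis by simp
  qed
qed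

text \<open>The given isomorphism may send some other leaf \<open>q\<close> to \<open>r\<close>. The
  neighbours of \<open>q\<close> and \<open>r'\<close> have equal degree by the invariant for leaf
  edges, so \<open>leaf_transpose\<close> corrects the isomorphism at the cost of one more
  swap.\<close>

lemma swap_equiv_at_leaf:
  assumes ev: "swap_equiv M G" and sM: "simple_graph M" and tG: "is_tree G"
    and r': "deg M r' = 1" "{r', u'} \<in> edges M" and r: "nbrs G r = {v}"
    and d: "deg M u' = deg G v" "2 \<le> deg G v"
  shows "\<exists>N g. bswaps M N \<and> inj_on g (verts N) \<and> gmap g N = G \<and> g r' = r"
proof -
  obtain N g where N: "bswaps M N" and g: "inj_on g (verts N)" "gmap g N = G"
    using ev by (auto simp: swap_equiv_def iso_def)
  have sN: "simple_graph N" and dN: "deg N = deg M" and vN: "verts N = verts M"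
    using bswaps_pres[OF N sM] by auto
  have sG: "simple_graph G" using tG by (simp add: tree_iff)
  have "iso N G" using g unfolding iso_def by metis
  then have "iso G N" by (rule iso_sym[OF sN])
  then have "is_tree N" using iso_tree tG by blast
  then have CN: "connected_graph N" by (simp add: tree_iff)
  have vr: "r \<in> verts G" "v \<in> verts G" using edge_verts[OF sG, of r v] r
    by (metis insertI1 nbrs_iff)+
  obtain q where q: "q \<in> verts N" "g q = r" using vr g by auto
  have r'N: "r' \<in> verts N" using edge_verts[OF sM r'(2)] vN by auto
  show ?thesis
  proof (cases "r' = q")
    case True
    then show ?thesis using N g q by blast
  next
    case False
    obtain u where u: "{r', u} \<in> edges N" "deg N u = deg G v"
      using bswaps_leaf_edge[OF N sM r'] d(1) dN by auto
    have "deg N r' = 1" using r'(1) dN by simp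
    then have nr': "nbrs N r' = {u}" using u(1) by (metis card_1_singletonE deg_def nbrs_iff singletonD)
    obtain w where w: "w \<in> verts N" "g w = v" using vr g by auto
    have "g ` nbrs N q = {v}" using nbrs_gmap[OF sN g(1) q(1)] g(2) q(2) r by simp
    then have gw: "g ` nbrs N q = g ` {w}" using w by simp
    have "nbrs N q = {w}"
      using inj_on_image_eq_iff[OF g(1), of "nbrs N q" "{w}"] gw w nbrs_verts[OF sN, of q] by blast
    moreover have "deg N w = deg G v" using deg_gmap[OF sN g(1) w(1)] g(2) w(2) by simp
    ultimately have step: "bswaps N (gmap (transp r' q) N)"
      using leaf_transpose[OF sN CN False nr'] u(2) d(2) by simp
    have vt: "transp r' q ` verts N = verts N" using transp_image[OF r'N q(1)] .
    have "gmap (g \<circ> transp r' q) (gmap (transp r' q) N) = gmap g N"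
      unfolding gmap_comp by (rule gmap_cong[OF sN]) simp
    moreover have "inj_on (g \<circ> transp r' q) (verts (gmap (transp r' q) N))"
      using g(1) vt by (intro comp_inj_on) auto
    moreover have "(g \<circ> transp r' q) r' = r" using q(2) by simp
    ultimately show ?thesis using N step g(2) by (metis rtranclp_trans)
  qed
qed

text \<open>The two maps agree on the common vertex. Injectivity follows by counting, as the images
  also meet in a single vertex.\<close>

lemma iso_glue:
  assumes sN: "simple_graph N" and sR: "simple_graph R" and int: "verts N \<inter> verts R = {r}"
    and g: "inj_on g (verts N)" and h: "inj_on h (verts R)" and r: "g r = h r"
    and int': "g ` verts N \<inter> h ` verts R = {g r}"
  shows "iso (glue N R) (glue (gmap g N) (gmap h R))"
proof -
  define f where "f v = (if v \<in> verts N then g v else h v)" for v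
  have fN: "f v = g v" if "v \<in> verts N" for v using that by (simp add: f_def)
  have fR: "f v = h v" if "v \<in> verts R" for v
  proof (cases "v \<in> verts N")
    case True
    then have "v = r" using that int by auto
    then show ?thesis using True r by (simp add: f_def)
  qed (simp add: f_def)
  have "gmap f (glue N R) = glue (gmap f N) (gmap f R)"
    by (simp add: gmap_def glue_def image_Un)
  also have "\<dots> = glue (gmap g N) (gmap h R)"
    using gmap_cong[OF sN, of f g] gmap_cong[OF sR, of f h] fN fR by simp
  finally have "gmap f (glue N R) = glue (gmap g N) (gmap h R)" .
  moreover have "inj_on f (verts (glue N R))"
  proof (rule eq_card_imp_inj_on)
    have fin: "finite (verts N)" "finite (verts R)" using sN sR by (auto simp: simple_graph_def)
    have "f ` verts (glue N R) = g ` verts N \<union> h ` verts R" using fN fR by (auto simp: image_Un)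
    moreover have "card (g ` verts N \<union> h ` verts R) = card (verts N \<union> verts R)"
      using card_Un_Int[of "g ` verts N" "h ` verts R"] card_Un_Int[OF fin] fin int int'
      by (simp add: card_image g h)
    ultimately show "card (f ` verts (glue N R)) = card (verts (glue N R))" by simp
    show "finite (verts (glue N R))" using fin by simp
  qed
  ultimately show ?thesis unfolding iso_def by metis
qed

section \<open>The induction on the number of inner vertices\<close>

lemma not_leaf_inner: "{v \<in> verts G. \<not> leaf G v} = inner G"
  by (auto simp: leaf_def inner_def)

text \<open>The induction statement. A labelled tree is required on the vertices of \<open>T\<close>
  because the type may offer no others. All choices in the construction are covered, so ties need no
  separate argument, and \<open>labels_ok\<close> is carried along for the choice of
  \<open>v_s\<close>.\<close>

definition mtrees_equiv :: "'a graph \<Rightarrow> nat list \<Rightarrow> bool" where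
  "mtrees_equiv T ds \<longleftrightarrow> (\<exists>M vs. mtree ds M vs \<and> verts M = verts T) \<and>
     (\<forall>M vs. mtree ds M vs \<longrightarrow> simple_graph M \<and> swap_equiv M T \<and> labels_ok M vs)"

lemma mtrees_equiv_bswaps:
  assumes "mtrees_equiv G ds" "bswaps T G" "simple_graph T"
  shows "mtrees_equiv T ds"
proof -
  have "bswaps G T" "verts G = verts T" using bswaps_sym[OF assms(2,3)] bswaps_pres[OF assms(2,3)] by auto
  then show ?thesis using assms(1) swap_equiv_trans unfolding mtrees_equiv_def by metis
qed

lemma inner_degs_bswaps: "bswaps T G \<Longrightarrow> simple_graph T \<Longrightarrow> inner_degs T ds \<Longrightarrow> inner_degs G ds"
  by (simp add: inner_degs_def bswaps_pres inner_bswaps)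

lemma inner_degs_butlast:
  assumes G: "simple_graph G" and r: "inner_degs G ds" and ne: "ds \<noteq> []"
    and c: "c \<in> inner G" "deg G c = last ds"
  shows "mset (butlast ds) = image_mset (deg G) (mset_set (inner G - {c}))"
proof -
  have "mset ds = add_mset (last ds) (mset (butlast ds))"
    using ne by (metis append_butlast_last_id mset.simps mset_append union_mset_add_mset_right add.right_neutral)
  moreover have "mset_set (inner G) = add_mset c (mset_set (inner G - {c}))"
    using mset_set.remove[OF finite_inner[OF G] c(1)] .
  ultimately show ?thesis using r c(2) by (simp add: inner_degs_def)
qed

lemma inner_degs_last:
  assumes "simple_graph G" "inner_degs G ds" "ds \<noteq> []"
  shows "\<exists>c\<in>inner G. deg G c = last ds" "\<And>u. u \<in> inner G \<Longrightarrow> last ds \<le> deg G u"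
proof -
  have "last ds \<in> deg G ` inner G" using last_in_set[OF assms(3)] inner_degs_set[OF assms(1,2)] by simp
  then show "\<exists>c\<in>inner G. deg G c = last ds" by (metis imageE)
  show "last ds \<le> deg G u" if "u \<in> inner G" for u
  proof (rule last_le)
    show "sorted_wrt (\<ge>) ds" using assms(2) by (simp add: inner_degs_def)
    show "deg G u \<in> set ds" unfolding inner_degs_set[OF assms(1,2)] using that by simp
  qed
qed

lemma ex_sorted_enum: "distinct xs \<Longrightarrow> \<exists>ws. distinct ws \<and> set ws = set xs \<and> sorted_wrt (\<lambda>u v. (f u :: nat) \<le> f v) ws"
proof -
  assume "distinct xs"
  moreover have "sorted (map f (sort_key f xs))" by simp
  then have "sorted_wrt (\<lambda>u v. f u \<le> f v) (sort_key f xs)" unfolding sorted_wrt_map .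
  ultimately show ?thesis by (intro exI[of _ "sort_key f xs"]) simp
qed

lemma mtrees_equiv_base:
  assumes T: "is_tree T" and L: "class_opt T" and r: "inner_degs T ds" and ne: "ds \<noteq> []"
    and len: "length ds \<le> last ds + 1"
  shows "mtrees_equiv T ds"
proof -
  have sT: "simple_graph T" using T by (simp add: tree_iff)
  obtain c0 where c0: "c0 \<in> inner T" "deg T c0 = last ds" using inner_degs_last(1)[OF sT r ne] by blast
  obtain G c where G: "bswaps T G" "c \<in> inner G" "deg G c = last ds" "inner G - {c} \<subseteq> nbrs G c"
    using star_like_exists[OF T L inner_degs_last(2)[OF sT r ne] c0] len inner_degs_length[OF r] by metis
  have tG: "is_tree G" using bswaps_tree[OF G(1) T] .
  then have sG: "simple_graph G" and F: "forest (edges G)" by (auto simp: tree_iff)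
  have rG: "inner_degs G ds" using inner_degs_bswaps[OF G(1) sT r] .
  have cV: "c \<in> verts G" using G(2) by (simp add: inner_def)
  obtain xs where xs: "distinct xs" "set xs = inner G - {c}" "map (deg G) xs = butlast ds"
    using ex_enumeration[OF _ inner_degs_butlast[OF sG rG ne G(2,3)]] finite_inner[OF sG] by auto
  have gs: "glued_stars c (nbrs G c) (butlast ds) xs G"
    unfolding xs(3)[symmetric]
  proof (rule glued_stars_from_tree[OF sG F cV xs(1)])
    show "set xs \<subseteq> nbrs G c" using xs(2) G(4) by simp
    show "verts G \<subseteq> insert c (nbrs G c \<union> (\<Union>x\<in>set xs. nbrs G x))"
    proof
      fix u assume u: "u \<in> verts G"
      show "u \<in> insert c (nbrs G c \<union> (\<Union>x\<in>set xs. nbrs G x))"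
      proof (cases "u = c \<or> u \<in> inner G")
        case True
        then show ?thesis using G(4) by auto
      next
        case False
        then have "1 \<le> deg G u" using tree_deg_pos[OF tG u cV] by simp
        then have "nbrs G u \<noteq> {}" by (auto simp: deg_def)
        then obtain w where w: "{u, w} \<in> edges G" by auto
        then have "w \<in> inner G" using edge_internal[OF tG G(2) w] False by simp
        moreover have "u \<in> nbrs G w" using w by (simp add: insert_commute)
        ultimately show ?thesis using xs(2) by (cases "w = c") auto
      qed
    qed
    show "c \<in> e \<or> (\<exists>x\<in>set xs. x \<in> e)" if e: "e \<in> edges G" for e
    proof -
      obtain u w where uw: "e = {u, w}" using edge_doubleton[OF sG e] by blast
      then have "u \<in> inner G \<or> w \<in> inner G" using edge_internal[OF tG G(2)] e by simp
      then show ?thesis using uw xs(2) by auto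
    qed
  qed
  have dc: "card (nbrs G c) = last ds" using G(3) by (simp add: deg_def)
  obtain ws where ws: "distinct ws" "set ws = set xs" "sorted_wrt (\<lambda>u v. deg G u \<le> deg G v) ws"
    using ex_sorted_enum[OF xs(1), of "deg G"] by blast
  have "mtree ds G (c # ws)"
  proof (rule mtree.base[OF ne len dc gs ws(1)])
    show "set ws = {v \<in> verts G. \<not> leaf G v} - {c}" unfolding not_leaf_inner ws(2) xs(2) ..
    show "sorted_wrt (\<lambda>u v. deg G u \<le> deg G v) (c # ws)"
      using ws xs(2) inner_degs_last(2)[OF sG rG ne] G(3) by simp
  qed
  moreover have "simple_graph M \<and> swap_equiv M G \<and> labels_ok M vs" if m: "mtree ds M vs" for M vs
    using m
  proof (cases rule: mtree.cases)
    case (base K c' xs' ws')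
    note sM = glued_stars_simple[OF base(5)]
    have "iso M G" using glued_stars_iso[OF base(5) gs] base(4) dc unfolding iso_def by metis
    then have "swap_equiv M G" unfolding swap_equiv_def by blast
    moreover have "labels_ok M vs"
      unfolding labels_ok_def
    proof (intro conjI allI impI)
      show "sorted_wrt (\<lambda>u v. deg M u \<le> deg M v) vs" using base(1,8) by simp
      have "1 \<noteq> last ds" using G(2,3) by (simp add: inner_def)
      then have c': "c' \<in> inner M" "deg M c' \<noteq> 1" using glued_stars_nbrs(1,2)[OF base(5)] base(4)
        by (auto simp: inner_def deg_def)
      then have sv: "set vs = inner M" using base(1,7) unfolding not_leaf_inner by auto
      then show "set vs \<subseteq> inner M" by simp
      fix u assume "leaf_adjacent M u"
      then obtain l where l: "leaf M l" "{u, l} \<in> edges M" by (auto simp: leaf_adjacent_def)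
      have ml: "deg M l = 1" using l by (simp add: leaf_def)
      \<comment> \<open>The entry for \<open>x\<close> is not 1, being the degree of an inner
        vertex, and not 0, since that vertex is adjacent to \<open>c\<close> in \<open>G\<close>.
        Hence the truncated subtraction in the degree of \<open>x\<close> is exact.\<close>
      have big: "deg M x \<noteq> 1" if x: "x \<in> set xs'" for x
      proof -
        obtain i where i: "i < length (butlast ds)" "x = xs' ! i"
          using x glued_stars_nbrs(6)[OF base(5)] by (auto simp: in_set_conv_nth)
        have "butlast ds ! i \<in> set ds" using i(1) by (meson in_set_butlastD nth_mem)
        then have "last ds \<le> butlast ds ! i" "butlast ds ! i \<noteq> 1"
          using last_le[of ds] rG inner_degs_set[OF sG rG] by (auto simp: inner_degs_def inner_def)
        moreover have "butlast ds ! i \<noteq> 0"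
        proof -
          have "xs ! i \<in> set xs" using i xs(3) by (metis length_map nth_mem)
          then have "xs ! i \<in> nbrs G c" using xs(2) G(4) by blast
          then have "1 \<le> deg G (xs ! i)"
            by (intro deg_pos_if_edge[OF sG, of _ c]) (simp add: insert_commute)
          then show ?thesis using xs(3) i(1) by (metis length_map not_one_le_zero nth_map)
        qed
        ultimately show ?thesis using glued_stars_nbrs(8)[OF base(5) i(1)] i(2) by simp
      qed
      have "u = c' \<or> u \<in> set xs'"
        using glued_stars_nbrs(9)[OF base(5) l(2)] big[of l] ml c'(2) by auto
      then have "deg M u \<noteq> 1" using big c'(2) by auto
      then show "u \<in> set vs" using sv edge_verts[OF sM l(2)] by (simp add: inner_def)
    qed
    ultimately show ?thesis using sM by blast
  next
    case (step M' vs' s r xs' R ws')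
    then show ?thesis using len by simp
  qed
  ultimately have "mtrees_equiv G ds" unfolding mtrees_equiv_def by blast
  then show ?thesis by (rule mtrees_equiv_bswaps[OF _ G(1) sT])
qed

lemma mtrees_equivD: "mtrees_equiv T ds \<Longrightarrow> mtree ds M vs \<Longrightarrow> simple_graph M \<and> swap_equiv M T \<and> labels_ok M vs"
  unfolding mtrees_equiv_def by blast

lemma leaf_adjacent_leaf_nbr_degs: "simple_graph G \<Longrightarrow> deg G ` {u. leaf_adjacent G u} = leaf_nbr_degs G"
proof (intro equalityI subsetI)
  fix k assume "simple_graph G" "k \<in> leaf_nbr_degs G"
  then obtain u l where ul: "{l, u} \<in> edges G" "deg G l = 1" "k = deg G u"
    by (auto simp: leaf_nbr_degs_def)
  then have "leaf G l" using edge_verts[OF \<open>simple_graph G\<close> ul(1)] by (simp add: leaf_def)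
  then have "leaf_adjacent G u" using ul(1) unfolding leaf_adjacent_def by (metis insert_commute)
  then show "k \<in> deg G ` {u. leaf_adjacent G u}" using ul(3) by blast
next
  fix k assume "k \<in> deg G ` {u. leaf_adjacent G u}"
  then obtain u l where "leaf G l" "{u, l} \<in> edges G" "k = deg G u" by (auto simp: leaf_adjacent_def)
  then have "{l, u} \<in> edges G" "deg G l = 1" "k = deg G u" by (simp_all add: insert_commute leaf_def)
  then show "k \<in> leaf_nbr_degs G" unfolding leaf_nbr_degs_def by blast
qed

text \<open>Suppose that a leaf \<open>l\<close> hangs on \<open>z\<close> with
  \<open>deg G z < deg G v\<close>. In the whole tree \<open>r\<close> is no leaf, so exchanging
  \<open>vr\<close> and \<open>zl\<close> would violate local optimality.\<close>

lemma root_minimal: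
  assumes tG: "is_tree G" and sR: "simple_graph R" and int: "verts G \<inter> verts R = {r}"
    and nG: "nbrs G r = {v}" and L: "local_opt (glue G R)" and v: "deg G v \<noteq> 1"
    and r: "2 \<le> deg (glue G R) r"
    and k: "k \<in> leaf_nbr_degs G"
  shows "deg G v \<le> k"
proof (rule ccontr)
  assume lt: "\<not> deg G v \<le> k"
  have sG: "simple_graph G" using tG by (simp add: tree_iff)
  obtain z l where zl: "{l, z} \<in> edges G" "deg G l = 1" "k = deg G z" using k
    by (auto simp: leaf_nbr_degs_def)
  have "v \<in> nbrs G r" using nG by simp
  then have rv: "{v, r} \<in> edges G" by (simp add: insert_commute)
  have dr: "deg G r = 1" using nG by (simp add: deg_def)
  have zv: "z \<noteq> v" using lt zl by auto
  have nr: "w = v" if "{r, w} \<in> edges G" for w using that nG by (metis nbrs_iff singletonD)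
  have zr: "z \<noteq> r" using nr[of l] zl v by (auto simp: insert_commute)
  have lr: "l \<noteq> r" using nr[of z] zl zv by auto
  have V: "v \<in> verts G" "r \<in> verts G" "z \<in> verts G" "l \<in> verts G"
    using edge_verts[OF sG rv] edge_verts[OF sG zl(1)] by auto
  have vr: "v \<noteq> r" using edge_verts[OF sG rv] by auto
  obtain q where q: "path (edges G) q" "hd q = v" "last q = z" using tree_path[OF tG V(1,3)] .
  have "r \<notin> set q" using vr zr q by (intro leaf_not_on_path[OF sG q(1) dr]) auto
  moreover have "l \<notin> set q"
    using v zl q edge_verts[OF sG zl(1)] by (intro leaf_not_on_path[OF sG q(1) zl(2)]) auto
  ultimately have "(v, z) \<in> conn (edges G - {{v, r}, {z, l}})"
    by (rule path_conn_avoid[OF q(1) _ _ q(2,3)])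
  moreover have "{z, l} \<in> edges G" using zl(1) by (simp add: insert_commute)
  ultimately have "can_swap G v r z l" using rv zv by (intro tree_can_swap tG) auto
  then have s: "can_swap (glue G R) v r z l" by (rule swap_glue(1)[OF sG sR int])
  have d: "deg (glue G R) u = deg G u" if "u \<in> verts G" "u \<noteq> r" for u
    using that int by (intro deg_glue_left[OF sR]) auto
  have "deg (glue G R) z < deg (glue G R) v" using d V vr zr lt zl by simp
  then have "deg (glue G R) r \<le> deg (glue G R) l" using L s unfolding local_opt_def by blast
  then show False using r d[OF V(4) lr] zl by simp
qed

text \<open>The new labels have at least the degrees of the old ones. The glued vertex
  \<open>r\<close> is no longer a leaf and has no neighbour in \<open>R\<close> that is a leaf, so
  every leaf hangs on an old labelled vertex or on some member of \<open>xs\<close>.\<close>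

lemma labels_ok_extend:
  assumes sM': "simple_graph M'" and gs: "glued_stars r (set xs) es xs R"
    and int: "verts M' \<inter> verts R = {r}"
    and r: "leaf M' r" and lab: "labels_ok M' vs"
    and ws: "set ws = set xs" "sorted_wrt (\<lambda>u v. deg (glue M' R) u \<le> deg (glue M' R) v) ws"
    and es: "\<And>e. e \<in> set es \<Longrightarrow> 2 \<le> e" "es \<noteq> []"
    and le: "\<And>u e. u \<in> inner M' \<Longrightarrow> e \<in> set es \<Longrightarrow> deg M' u \<le> e"
  shows "labels_ok (glue M' R) (vs @ ws)"
proof -
  let ?M = "glue M' R"
  have sR: "simple_graph R" by (rule glued_stars_simple[OF gs])
  have sM: "simple_graph ?M" by (rule simple_glue[OF sM' sR])
  note gn = glued_stars_nbrs[OF gs]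
  have dr: "deg M' r = 1" and rV: "r \<in> verts M'" using r by (auto simp: leaf_def)
  have left: "deg ?M u = deg M' u" if "u \<in> verts M'" "u \<noteq> r" for u
    using that int by (intro deg_glue_left[OF sR]) auto
  have xV: "x \<in> verts R" "x \<notin> verts M'" if "x \<in> set xs" for x
  proof -
    have "{r, x} \<in> edges R" using that gn(1) by (metis nbrs_iff)
    then have "x \<in> verts R" "x \<noteq> r" using edge_verts[OF sR, of r x] by auto
    then show "x \<in> verts R" "x \<notin> verts M'" using int by auto
  qed
  have dx: "deg ?M x \<in> set es" if x: "x \<in> set xs" for x
  proof -
    obtain i where i: "i < length es" "x = xs ! i" using x gn(6) by (auto simp: in_set_conv_nth)
    have "2 \<le> es ! i" using es(1) i(1) by simp
    then have "deg ?M x = es ! i" using deg_glue_right[OF sM' xV(2)[OF x]] gn(8)[OF i(1)] i(2) by simp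
    then show ?thesis using i(1) by simp
  qed
  have vsI: "u \<in> inner M'" "u \<in> verts M'" "u \<noteq> r" if "u \<in> set vs" for u
    using that lab dr by (auto simp: labels_ok_def inner_def)
  show ?thesis
    unfolding labels_ok_def
  proof (intro conjI allI impI)
    have "sorted_wrt (\<lambda>u v. deg ?M u \<le> deg ?M v) vs"
    proof (rule sorted_wrt_mono_rel[of _ "\<lambda>u v. deg M' u \<le> deg M' v"])
      show "deg ?M u \<le> deg ?M v" if "u \<in> set vs" "v \<in> set vs" "deg M' u \<le> deg M' v" for u v
        using that left vsI by simp
      show "sorted_wrt (\<lambda>u v. deg M' u \<le> deg M' v) vs" using lab by (simp add: labels_ok_def)
    qed
    moreover have "deg ?M u \<le> deg ?M w" if "u \<in> set vs" "w \<in> set ws" for u w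
      using that le[OF vsI(1) dx] left vsI ws(1) by simp
    ultimately show "sorted_wrt (\<lambda>u v. deg ?M u \<le> deg ?M v) (vs @ ws)" using ws(2)
      by (simp add: sorted_wrt_append)
    have "u \<in> inner ?M" if "u \<in> set vs" for u
      using vsI[OF that] left by (simp add: inner_def)
    moreover have "u \<in> inner ?M" if "u \<in> set ws" for u
    proof -
      have "2 \<le> deg ?M u" using es(1) dx that ws(1) by blast
      then show ?thesis using xV(1)[of u] that ws(1) by (simp add: inner_def)
    qed
    ultimately show "set (vs @ ws) \<subseteq> inner ?M" by auto
    fix u assume "leaf_adjacent ?M u"
    then obtain l where l: "leaf ?M l" "{u, l} \<in> edges ?M" by (auto simp: leaf_adjacent_def)
    have dl: "deg ?M l = 1" using l by (simp add: leaf_def)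
    have lx: "l \<notin> set xs" using dl dx[of l] es(1)[of 1] by auto
    have "xs \<noteq> []" using es(2) gn(6) by auto
    then obtain x where x: "x \<in> set xs" by (cases xs) auto
    obtain w where w: "w \<in> nbrs M' r" using dr by (metis card_1_singletonE deg_def insertI1)
    have "w \<noteq> x" using w edge_verts[OF sM', of r w] xV(2)[OF x] by auto
    moreover have "{r, w} \<in> edges ?M" "{r, x} \<in> edges ?M" using w x gn(1) by (auto simp: nbrs_def)
    ultimately have "2 \<le> deg ?M r" by (intro deg_ge_2I[OF sM])
    then have lr: "l \<noteq> r" using dl by auto
    show "u \<in> set (vs @ ws)"
    proof (cases "{u, l} \<in> edges M'")
      case True
      then have "l \<in> verts M'" using edge_verts[OF sM'] by blast
      then have "leaf M' l" using dl left[of l] lr by (simp add: leaf_def)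
      then have "leaf_adjacent M' u" using True unfolding leaf_adjacent_def by blast
      then show ?thesis using lab by (simp add: labels_ok_def)
    next
      case False
      then have "{u, l} \<in> edges R" using l(2) by simp
      then have "u = r \<and> l \<in> set xs \<or> l = r \<and> u \<in> set xs \<or> u \<in> set xs \<or> l \<in> set xs" by (rule gn(9))
      then show ?thesis using lx ws(1) by auto
    qed
  qed
qed

lemma mtrees_equiv_step:
  assumes T: "is_tree T" and L: "class_opt T" and inner_degs: "inner_degs T ds" and ne: "ds \<noteq> []"
    and len: "last ds + 2 \<le> length ds"
    and IH: "\<And>(G :: 'a graph) ds'. length ds' < length ds \<Longrightarrow> is_tree G \<Longrightarrow> class_opt G \<Longrightarrow> inner_degs G ds' \<Longrightarrow> ds' \<noteq> [] \<Longrightarrow> mtrees_equiv G ds'"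
  shows "mtrees_equiv (T :: 'a graph) ds"
proof -
  define \<delta> where "\<delta> = last ds"
  define ds' where "ds' = drop (\<delta> - 1) (butlast ds)"
  define es where "es = take (\<delta> - 1) ds"
  have sT: "simple_graph T" using T by (simp add: tree_iff)
  note min = inner_degs_last(2)[OF sT inner_degs ne, folded \<delta>_def]
  obtain c0 where c0: "c0 \<in> inner T" "deg T c0 = \<delta>" using inner_degs_last(1)[OF sT inner_degs ne]
    by (auto simp: \<delta>_def)
  have "\<delta> + 2 \<le> card (inner T)" using len inner_degs_length[OF inner_degs]
    by (simp add: \<delta>_def)
  from end_branch_exists[OF T L min c0 this]
  obtain G0 r0 v0 where rs0: "bswaps T G0" "end_branch \<delta> G0 r0 v0" by blast
  \<comment> \<open>Among all end branches in the class, one with the largest degree of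
    \<open>v\<close> is taken; \<open>class_opt_remove_branch\<close> depends on this
    choice.\<close>
  define P where "P = (\<lambda>(G, r, v). bswaps T G \<and> end_branch \<delta> G r v)"
  define f where "f = (\<lambda>(G :: 'a graph, r :: 'a, v). deg G v)"
  have P0: "P (G0, r0, v0)" using rs0 by (simp add: P_def)
  have "f y \<le> card (verts T)" if "P y" for y
  proof -
    obtain G r v where y: "y = (G, r, v)" by (metis surj_pair)
    then have step: "bswaps T G" using that by (simp add: P_def)
    have "card (nbrs G v) \<le> card (verts T)"
      using nbrs_verts[of G v] bswaps_pres[OF step sT] sT by (intro card_mono) (auto simp: simple_graph_def)
    then show ?thesis by (simp add: y f_def deg_def)
  qed
  then have "\<forall>y. P y \<longrightarrow> f y \<le> card (verts T)" by blast
  from ex_max_nat[of P, OF P0 this]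
  obtain y where y: "P y" and mx: "\<And>y'. P y' \<Longrightarrow> f y' \<le> f y" by blast
  obtain K r v where yK: "y = (K, r, v)" by (metis surj_pair)
  have XK: "bswaps T K" and rs: "end_branch \<delta> K r v" using y by (auto simp: P_def yK)
  have tK: "is_tree K" using bswaps_tree[OF XK T] .
  then have sK: "simple_graph K" by (simp add: tree_iff)
  have LK: "class_opt K" using bswaps_class_opt[OF L XK] .
  have redK: "inner_degs K ds" using inner_degs_bswaps[OF XK sT inner_degs] .
  note minK = inner_degs_last(2)[OF sK redK ne, folded \<delta>_def]
  have r: "r \<in> inner K" "deg K r = \<delta>" and rv: "{r, v} \<in> edges K" and v: "v \<in> inner K"
    and RSb: "\<And>b. b \<in> nbrs K r - {v} \<Longrightarrow> b \<in> inner K"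
      "\<And>b u. b \<in> nbrs K r - {v} \<Longrightarrow> u \<in> verts K - (nbrs K r - {v}) \<Longrightarrow> deg K u \<le> deg K b"
    using rs by (auto simp: end_branch_def branch_root_def)
  have d2: "2 \<le> \<delta>" using inner_deg_ge_2[OF sK rv r(1)] r(2) by simp
  obtain G R where KG: "K = glue G R" and int: "verts G \<inter> verts R = {r}" and tG: "is_tree G"
    and sR: "simple_graph R"
    and fR: "forest (edges R)" and nR: "nbrs R r = nbrs K r - {v}" and nG: "nbrs G r = {v}"
    and rR: "r \<in> verts R"
    and vR: "verts R = insert r (nbrs R r \<union> (\<Union>b\<in>nbrs R r. nbrs R b))"
    and eR: "\<And>e. e \<in> edges R \<Longrightarrow> e \<inter> nbrs R r \<noteq> {}"
    and dR: "\<And>b. b \<in> nbrs R r \<Longrightarrow> deg R b = deg K b"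
    and dG: "\<And>u. u \<in> verts G \<Longrightarrow> u \<noteq> r \<Longrightarrow> deg G u = deg K u"
    and iG: "inner G = inner K - insert r (nbrs R r)"
    by (rule end_branch_decompose[OF tK rs d2]) (rule that)
  have sG: "simple_graph G" using tG by (simp add: tree_iff)
  let ?B = "nbrs R r"
  have "deg K2 v' \<le> deg K v" if "bswaps K K2" "end_branch \<delta> K2 r' v'" for K2 r' v'
  proof -
    have "P (K2, r', v')" using XK that by (auto simp: P_def)
    from mx[OF this] show ?thesis by (simp add: f_def yK)
  qed
  then have LG: "class_opt G"
    using LK rs minK unfolding KG by (intro class_opt_remove_branch[OF tG sR int nG]) blast+
  have rvG: "{r, v} \<in> edges G" using nG by (metis insertI1 nbrs_iff)
  have vG: "v \<in> verts G" "v \<noteq> r" "r \<in> verts G" using edge_verts[OF sG rvG] by auto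
  have dv: "deg G v = deg K v" using dG vG by simp
  have v2: "2 \<le> deg G v" using dv minK[OF v] d2 by simp
  have dr: "deg G r = 1" using nG by (simp add: deg_def)
  have lG: "leaf G r" using dr vG by (simp add: leaf_def)

  have finB: "finite ?B" using sR by simp
  have rB: "r \<notin> ?B" using no_loop[OF sR] by auto
  have BI: "?B \<subseteq> inner K" using RSb(1) nR by auto
  have cardB: "card ?B = \<delta> - 1" using r(2) rv sK unfolding nR deg_def by simp
  \<comment> \<open>The degrees of the branch dominate all other inner degrees, so up to order they
    are the first \<open>\<delta> - 1\<close> entries of \<open>ds\<close>.\<close>
  have split: "mset ds = image_mset (deg K) (mset_set ?B) + image_mset (deg K) (mset_set (inner K - ?B))"
  proof -
    have "mset_set (inner K) = mset_set ?B + mset_set (inner K - ?B)"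
      using mset_set_Union[of ?B "inner K - ?B"] BI finB finite_inner[OF sK] by (simp add: Un_absorb1)
    then show ?thesis using redK by (simp add: inner_degs_def)
  qed
  have dom: "b \<le> a"
    if "a \<in># image_mset (deg K) (mset_set ?B)" "b \<in># image_mset (deg K) (mset_set (inner K - ?B))"
    for a b
  proof -
    have "a \<in> deg K ` ?B" using that(1) finB by simp
    moreover have "b \<in> deg K ` (inner K - ?B)" using that(2) finite_inner[OF sK] by simp
    ultimately obtain x u where "x \<in> ?B" "a = deg K x" "u \<in> inner K - ?B" "b = deg K u"
      by (elim imageE)
    then show ?thesis using RSb(2)[of x u] unfolding nR inner_def by blast
  qed
  have sds: "sorted_wrt (\<ge>) ds" using redK by (simp add: inner_degs_def)
  have mes: "mset es = image_mset (deg K) (mset_set ?B)"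
    and mdrop: "mset (drop (\<delta> - 1) ds) = image_mset (deg K) (mset_set (inner K - ?B))"
    using take_drop_dominating[OF sds split dom] cardB by (simp_all add: es_def)
  have sds': "sorted_wrt (\<ge>) ds'" unfolding ds'_def butlast_conv_take
    by (intro sorted_wrt_drop sorted_wrt_take sds)
  have dne: "drop (\<delta> - 1) ds \<noteq> []" using len by (simp add: \<delta>_def)
  \<comment> \<open>In the remainder \<open>r\<close> has become a leaf, so its degree \<delta>, the
    last entry, is dropped as well.\<close>
  have mds': "mset ds' = image_mset (deg K) (mset_set (inner K - ?B - {r}))"
  proof -
    have l: "last (drop (\<delta> - 1) ds) = \<delta>" using dne by (simp add: \<delta>_def last_drop)
    have "mset (drop (\<delta> - 1) ds) = add_mset \<delta> (mset ds')"
      unfolding ds'_def drop_butlast using dne l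
      by (metis append_butlast_last_id mset.simps mset_append union_mset_add_mset_right add.right_neutral)
    moreover have "mset_set (inner K - ?B) = add_mset r (mset_set (inner K - ?B - {r}))"
      using r(1) rB finite_inner[OF sK] by (intro mset_set.remove) auto
    ultimately show ?thesis using mdrop r(2) by simp
  qed
  have redG: "inner_degs G ds'"
  proof -
    have "inner K - ?B - {r} = inner G" using iG by auto
    moreover have "deg K u = deg G u" if "u \<in> inner G" for u
    proof -
      have "u \<noteq> r" using that unfolding iG by simp
      moreover have "u \<in> verts G" using that by (simp add: inner_def)
      ultimately show ?thesis using dG by simp
    qed
    then have "image_mset (deg K) (mset_set (inner G)) = image_mset (deg G) (mset_set (inner G))"
      using finite_inner[OF sG] by (intro image_mset_cong) simp
    ultimately show ?thesis using sds' mds' by (simp add: inner_degs_def)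
  qed
  have lds': "ds' \<noteq> []" "length ds' < length ds" using len d2 by (auto simp: ds'_def \<delta>_def)
  have mtrees_equiv: "mtrees_equiv G ds'" by (rule IH[OF lds'(2) tG LG redG lds'(1)])

  have es_ge: "2 \<le> e" if "e \<in> set es" for e
  proof -
    have "e \<in> set ds" using that unfolding es_def by (rule in_set_takeD)
    then have "\<delta> \<le> e" using last_le[OF sds] by (simp add: \<delta>_def)
    then show ?thesis using d2 by simp
  qed
  have es_ne: "es \<noteq> []" using d2 ne by (simp add: es_def)
  have es_ds': "d \<le> e" if "e \<in> set es" "d \<in> set ds'" for d e
  proof -
    have "d \<in> set (drop (\<delta> - 1) ds)" using that(2) unfolding ds'_def drop_butlast
      by (rule in_set_butlastD)
    moreover have "sorted_wrt (\<ge>) (es @ drop (\<delta> - 1) ds)" using sds by (simp add: es_def)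
    ultimately show ?thesis using that(1) by (auto simp: sorted_wrt_append)
  qed

  obtain xs where xs: "distinct xs" "set xs = ?B" "map (deg K) xs = es"
    using ex_enumeration[OF finB mes] by blast
  have xs': "map (deg R) xs = es" using xs dR by (auto cong: map_cong)
  have gs: "glued_stars r ?B es xs R"
    unfolding xs'[symmetric]
  proof (rule glued_stars_from_tree[OF sR fR rR xs(1)])
    show "set xs \<subseteq> ?B" using xs(2) by simp
    show "verts R \<subseteq> insert r (?B \<union> (\<Union>x\<in>set xs. nbrs R x))"
      using vR xs(2) by simp
    show "r \<in> e \<or> (\<exists>x\<in>set xs. x \<in> e)" if "e \<in> edges R" for e
      using eR[OF that] xs(2) by auto
  qed

  \<comment> \<open>With \<open>m_in\<close>, the degree of \<open>v\<close> is the minimum of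
    \<open>leaf_nbr_degs G\<close>, and this minimum is the same in every \<open>M'\<close>.\<close>
  have m_min: "deg G v \<le> k" if "k \<in> leaf_nbr_degs G" for k
    using root_minimal[OF tG sR int nG _ _ _ that] class_opt_local_opt[OF LK] v2 r(2) d2
    unfolding KG by simp
  have m_in: "deg G v \<in> leaf_nbr_degs G" using rvG dr unfolding leaf_nbr_degs_def by blast

  have "\<exists>M vs. mtree ds M vs \<and> verts M = verts K"
  proof -
    obtain M' vs where M': "mtree ds' M' vs" "verts M' = verts G" using mtrees_equiv
      unfolding mtrees_equiv_def by blast
    then have sM': "simple_graph M'" and ev: "swap_equiv M' G" and lab: "labels_ok M' vs"
      using mtrees_equivD[OF mtrees_equiv M'(1)] by auto
    have "deg G v \<in> leaf_nbr_degs M'" using m_in swap_equiv_leaf_nbr_degs[OF ev sM'] by simp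
    then obtain u where "leaf_adjacent M' u"
      unfolding leaf_adjacent_leaf_nbr_degs[OF sM', symmetric] by blast
    then have "\<exists>s. s < length vs \<and> leaf_adjacent M' (vs ! s)"
      using lab by (metis in_set_conv_nth labels_ok_def)
    then obtain s where s: "s < length vs \<and> leaf_adjacent M' (vs ! s)"
      and sm: "\<And>j. j < s \<Longrightarrow> \<not> (j < length vs \<and> leaf_adjacent M' (vs ! j))"
      using exists_least_iff[of "\<lambda>s. s < length vs \<and> leaf_adjacent M' (vs ! s)"] by blast
    obtain r' where r': "leaf M' r'" "{vs ! s, r'} \<in> edges M'" using s by (auto simp: leaf_adjacent_def)
    have r'V: "r' \<in> verts G" using r'(1) M'(2) by (simp add: leaf_def)
    then have "r' = r \<or> r' \<notin> verts R" using int by auto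
    from glued_stars_move[OF gs this]
    obtain R' where R': "glued_stars r' ?B es xs R'" "verts R' = insert r' (verts R - {r})" by blast
    have int': "verts M' \<inter> verts R' = {r'}" using R'(2) r'V M'(2) int by auto
    obtain ws where ws: "distinct ws" "set ws = set xs" "sorted_wrt (\<lambda>u v. deg (glue M' R') u \<le> deg (glue M' R') v) ws"
      using ex_sorted_enum[OF xs(1), of "deg (glue M' R')"] by blast
    have "mtree ds (glue M' R') (vs @ ws)"
    proof (rule mtree.step[OF ne len _ _ _ _ r'(1,2) _ int' _ ws])
      show "mtree (drop (last ds - 1) (butlast ds)) M' vs" using M'(1) by (simp add: ds'_def \<delta>_def)
      show "s < length vs" "leaf_adjacent M' (vs ! s)" using s by auto
      show "\<forall>j<s. \<not> leaf_adjacent M' (vs ! j)" using sm s by auto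
      show "glued_stars r' (set xs) (take (last ds - 1) ds) xs R'" using R'(1) xs(2)
        by (simp add: es_def \<delta>_def)
      show "glue M' R' = (verts M' \<union> verts R', edges M' \<union> edges R')" by (simp add: glue_def)
    qed
    moreover have "verts (glue M' R') = verts K" using M'(2) R'(2) r'V int KG by auto
    ultimately show ?thesis by blast
  qed
  moreover have "simple_graph M \<and> swap_equiv M K \<and> labels_ok M ls" if m: "mtree ds M ls" for M ls
    using m
  proof (cases rule: mtree.cases)
    case (base _ c xs' ws')
    then show ?thesis using len by simp
  next
    case (step M' vs s r' xs' R' ws')
    have m': "mtree ds' M' vs" using step(4) by (simp add: ds'_def \<delta>_def)
    have sM': "simple_graph M'" and ev: "swap_equiv M' G" and lab: "labels_ok M' vs"
      using mtrees_equivD[OF mtrees_equiv m'] by auto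
    have gs': "glued_stars r' (set xs') es xs' R'" using step(10) by (simp add: es_def \<delta>_def)
    have int': "verts M' \<inter> verts R' = {r'}" by (rule step(11))
    have sR': "simple_graph R'" by (rule glued_stars_simple[OF gs'])
    have M: "M = glue M' R'" using step(12) by (simp add: glue_def)
    have dr': "deg M' r' = 1" using step(8) by (simp add: leaf_def)
    have r'e: "{r', vs ! s} \<in> edges M'" using step(9) by (simp add: insert_commute)
    have ladM: "leaf_nbr_degs M' = leaf_nbr_degs G" by (rule swap_equiv_leaf_nbr_degs[OF ev sM'])
    \<comment> \<open>By \<open>labels_ok\<close>, the first labelled vertex with a leaf neighbour
      attains the minimum of \<open>leaf_nbr_degs M'\<close>.\<close>
    have dvs: "deg M' (vs ! s) = deg G v"
    proof (rule antisym)
      have "deg M' (vs ! s) \<in> leaf_nbr_degs M'" using dr' r'e unfolding leaf_nbr_degs_def by blast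
      then show "deg G v \<le> deg M' (vs ! s)" using m_min ladM by simp
      have "deg G v \<in> deg M' ` {u. leaf_adjacent M' u}" unfolding leaf_adjacent_leaf_nbr_degs[OF sM']
        using m_in ladM by simp
      then obtain u where u: "leaf_adjacent M' u" "deg M' u = deg G v" by auto
      then have "u \<in> set vs" using lab unfolding labels_ok_def by blast
      then obtain j where j: "j < length vs" "u = vs ! j" by (auto simp: in_set_conv_nth)
      then have "s \<le> j" using step(7) u(1) by (meson not_less)
      moreover have "sorted_wrt (\<lambda>u v. deg M' u \<le> deg M' v) vs" using lab
        by (simp add: labels_ok_def)
      ultimately show "deg M' (vs ! s) \<le> deg G v"
        using sorted_wrt_nth_less[of "\<lambda>u v. deg M' u \<le> deg M' v" vs s j] j u(2)
        by (cases "s = j") auto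
    qed
    \<comment> \<open>Equal degrees of \<open>vs ! s\<close> and \<open>v\<close> make it possible
      to send the gluing point \<open>r'\<close> to \<open>r\<close>, so that the isomorphisms of
      the two glued parts fit together.\<close>
    obtain N g where N: "bswaps M' N" "inj_on g (verts N)" "gmap g N = G" "g r' = r"
      using swap_equiv_at_leaf[OF ev sM' tG dr' r'e nG dvs v2] by blast
    have sN: "simple_graph N" and vN: "verts N = verts M'" using bswaps_pres[OF N(1) sM'] by auto
    have "card (set xs') = card ?B"
      using glued_stars_nbrs(4,6)[OF gs'] glued_stars_nbrs(4,6)[OF gs] xs(2) by (metis distinct_card)
    from glued_stars_iso[OF gs' gs this]
    obtain h where h: "inj_on h (verts R')" "gmap h R' = R" "h r' = r" by blast
    have "g ` verts N \<inter> h ` verts R' = {g r'}" using N(3,4) h(2) int by (metis verts_gmap)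
    then have "iso (glue N R') (glue (gmap g N) (gmap h R'))"
      using N(2,4) h(1,3) int' vN by (intro iso_glue[OF sN sR', of r']) auto
    then have "iso (glue N R') K" unfolding N(3) h(2) KG .
    moreover have "bswaps M (glue N R')" unfolding M by (rule bswaps_glue[OF sM' sR' int' dr' N(1)])
    ultimately have "swap_equiv M K" unfolding swap_equiv_def by blast
    moreover have "simple_graph M" unfolding M by (rule simple_glue[OF sM' sR'])
    moreover have "labels_ok M ls"
      unfolding M step(1)
    proof (rule labels_ok_extend[OF sM' gs' int' step(8) lab])
      show "set ws' = set xs'" by (rule step(14))
      show "sorted_wrt (\<lambda>u v. deg (glue M' R') u \<le> deg (glue M' R') v) ws'"
        using step(15) M by simp
      show "2 \<le> e" if "e \<in> set es" for e using es_ge[OF that] .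
      show "es \<noteq> []" by (rule es_ne)
      fix u e assume u: "u \<in> inner M'" and e: "e \<in> set es"
      have "u \<in> verts N" using u vN by (simp add: inner_def)
      moreover have "deg N u = deg M' u" using bswaps_pres(3)[OF N(1) sM'] by simp
      ultimately have "deg G (g u) = deg M' u" "g u \<in> verts G" using deg_gmap[OF sN N(2)] N(3) by auto
      then have "g u \<in> inner G" using u by (simp add: inner_def)
      then have "deg M' u \<in> set ds'"
        using inner_degs_set[OF sG redG] \<open>deg G (g u) = deg M' u\<close> by (metis imageI)
      then show "deg M' u \<le> e" using es_ds'[OF e] by simp
    qed
    ultimately show ?thesis by blast
  qed
  ultimately have "mtrees_equiv K ds" unfolding mtrees_equiv_def by blast
  then show ?thesis by (rule mtrees_equiv_bswaps[OF _ XK sT])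
qed

lemma mtrees_equiv_class_opt:
  assumes "is_tree T" "class_opt T" "inner_degs T ds" "ds \<noteq> []"
  shows "mtrees_equiv T ds"
  using assms
proof (induction "length ds" arbitrary: T ds rule: less_induct)
  case less
  show ?case
  proof (cases "length ds \<le> last ds + 1")
    case True
    then show ?thesis using mtrees_equiv_base less.prems by blast
  next
    case False
    then have "last ds + 2 \<le> length ds" by simp
    from mtrees_equiv_step[OF less.prems this less.hyps] show ?thesis by blast
  qed
qed

text \<open>The assumption \<open>ds \<noteq> []\<close> excludes only the two-vertex tree, for
  which there is no \<open>d_t\<close>. The relation \<open>mtree\<close> stands for every outcome
  of the construction on the given vertex type, so both existence and the claim for each outcome are
  asserted.\<close>

theorem theorem3p10:
  fixes D ds :: "nat list"
  assumes "trees_with D \<noteq> ({} :: 'a graph set)"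
    and "ds = reduced_seq D"
    and "ds \<noteq> []"
  shows "(\<exists>(M :: 'a graph) vs. mtree ds M vs) \<and>
         (\<forall>(M :: 'a graph) vs. mtree ds M vs \<longrightarrow>
            (\<forall>T \<in> (trees_with D :: 'a graph set).
               SO T = Max (SO ` (trees_with D :: 'a graph set)) \<longleftrightarrow>
               (\<exists>T'. branch_exchange\<^sup>*\<^sup>* M T' \<and> graph_iso T T')))"
proof -
  let ?TD = "trees_with D :: 'a graph set"
  have snd: "mtrees_equiv T ds" if T: "T \<in> ?TD" and m: "SO T = Max (SO ` ?TD)" for T
  proof -
    have "is_tree T" "degree_seq T = D" using T by (auto simp: trees_with_def)
    then show ?thesis
      using mtrees_equiv_class_opt[of T ds] max_class_opt[OF T m] inner_degs_reduced_seq[of T] assms(2,3)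
      by (simp add: tree_iff)
  qed
  have "Max (SO ` ?TD) \<in> SO ` ?TD" using finite_SO_trees assms(1) by (intro Max_in) auto
  then obtain T0 where T0: "T0 \<in> ?TD" "SO T0 = Max (SO ` ?TD)" by auto
  show ?thesis
  proof (intro conjI allI impI ballI)
    show "\<exists>(M :: 'a graph) vs. mtree ds M vs" using snd[OF T0] unfolding mtrees_equiv_def by blast
    fix M :: "'a graph" and vs T assume M: "mtree ds M vs" and T: "T \<in> ?TD"
    have tT: "is_tree T" "is_tree T0" using T T0(1) by (auto simp: trees_with_def)
    then have sT: "simple_graph T" "simple_graph T0" by (auto simp: tree_iff)
    \<comment> \<open>A fixed tree \<open>T0\<close> of maximal SO shows that \<open>M\<close> is a
      tree and has maximal SO itself; both directions of the equivalence need this.\<close>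
    have sM: "simple_graph M" and "swap_equiv M T0" using mtrees_equivD[OF snd[OF T0] M] by auto
    then obtain N where N: "bswaps M N" "iso N T0" by (auto simp: swap_equiv_def)
    have sN: "simple_graph N" using bswaps_pres[OF N(1) sM] by simp
    have "is_tree N" using iso_tree[OF iso_sym[OF sN N(2)] tT(2)] .
    then have tM: "is_tree M" using bswaps_tree[OF bswaps_sym[OF N(1) sM]] by simp
    have SM: "SO M = Max (SO ` ?TD)" using bswaps_SO[OF N(1) sM] iso_SO[OF N(2) sN] T0(2) by simp
    show "SO T = Max (SO ` ?TD) \<longleftrightarrow> (\<exists>T'. branch_exchange\<^sup>*\<^sup>* M T' \<and> graph_iso T T')"
    proof
      assume "SO T = Max (SO ` ?TD)"
      then have "swap_equiv M T" using mtrees_equivD[OF snd[OF T] M] by auto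
      then obtain H where H: "bswaps M H" "iso H T" by (auto simp: swap_equiv_def)
      obtain K where K: "branch_exchange\<^sup>*\<^sup>* M K" "iso K H"
        using bswaps_branch_exchanges[OF H(1) tM] by blast
      have sK: "simple_graph K" using branch_exchange_SO[OF K(1) tM] by (simp add: tree_iff)
      have "iso T K" by (rule iso_sym[OF sK iso_trans[OF K(2) H(2)]])
      then show "\<exists>T'. branch_exchange\<^sup>*\<^sup>* M T' \<and> graph_iso T T'"
        using K(1) iso_graph_iso[OF sT(1) sK] by blast
    next
      assume "\<exists>T'. branch_exchange\<^sup>*\<^sup>* M T' \<and> graph_iso T T'"
      then obtain K where K: "branch_exchange\<^sup>*\<^sup>* M K" "graph_iso T K" by blast
      have sK: "simple_graph K" "SO K = SO M" using branch_exchange_SO[OF K(1) tM] by (auto simp: tree_iff)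
      then show "SO T = Max (SO ` ?TD)"
        using iso_SO[of T K] K(2) iso_graph_iso[OF sT(1) sK(1)] sT(1) SM by simp
    qed
  qed
qed

end
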